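(* Let $(X,\Sigma,\nu)$ be a plain triple and $\lambda,\mu>0$, let $\widehat\gamma$ be the drift of the random walk $(X,\nu)$, and assume $\lambda\widehat\gamma<\mu$. Let $(\rho,r)$ be an admissible solution of the Twisted Traffic Equations associated with $(X,\Sigma,\nu,\lambda,\mu)$, and consider the 0-automatic queue of type $(X,\Sigma,\nu,r,\lambda,\mu)$ with its queue-content process in its stationary regime. Then the departure process is a Poisson process of rate $\rho\mu$. Furthermore, for every $t$, the queue-content at time $t$ is independent of the departure process up to time $t$.
   Context: Let $X$ be a monoid with product $\ast$ and unit $1_X$. $\Sigma^*$ denotes the free monoid of words over a finite set $\Sigma$, with empty word $1_{\Sigma^*}$. For a generating set $\Sigma$ of $X$, $|x|_\Sigma$ is the least $k$ with $x=a_1\ast\cdots\ast a_k$, $a_i\in\Sigma$. A plain monoid is a free product $X=S^*\star\mathbb F(T)\star X_1\star\cdots\star X_k$, where $S,T$ are finite sets, $S^*$ is the free monoid on $S$, $\mathbb F(T)$ is the free group on $T$ and $X_1,\dots,X_k$ are finite monoids; its natural generating set is $\Sigma=S\sqcup T\sqcup T^{-1}\sqcup(X_1\setminus\{1_{X_1}\})\sqcup\cdots\sqcup(X_k\setminus\{1_{X_k}\})$. Put $L(X,\Sigma)=\{u_1\cdots u_k\in\Sigma^*:\ u_i\ast u_{i+1}\notin\Sigma\cup\{1_X\}\text{ for all }i<k\}$. For $a\in\Sigma$ let $\mathrm{Next}(a)=\{b\in\Sigma: a\ast b\notin\Sigma\cup\{1_X\}\}$ (which equals $\{b: b\ast a\notin\Sigma\cup\{1_X\}\}$).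 For $x\in\mathbb R^\Sigma$ and $E\subset\Sigma$, $x(E)=\sum_{a\in E}x(a)$. Let $\mathcal B=\{x\in\mathbb R^\Sigma: x(a)>0\ \forall a,\ \sum_a x(a)=1\}$ and $\bar{\mathcal B}$ the analogous set with $x(a)\ge 0$. A plain triple $(X,\Sigma,\nu)$ consists of an infinite plain monoid $X$ not isomorphic to $\mathbb Z$ nor to $\mathbb Z/2\mathbb Z\star\mathbb Z/2\mathbb Z$, its natural generating set $\Sigma$, and a probability measure $\nu$ on $\Sigma$ whose support generates $X$. Random walk and drift: with $x_0,x_1,\dots$ i.i.d. of law $\nu$ and $X_n=x_0\ast\cdots\ast x_{n-1}$, the drift is the deterministic a.s. limit $\widehat\gamma=\lim_n |X_n|_\Sigma/n$. The 0-automatic queue of type $(X,\Sigma,\nu,r,\lambda,\mu)$ ($r\in\bar{\mathcal B}$, $\lambda,\mu>0$) is the continuous-time Markov jump process (queue-content process) on $L(X,\Sigma)$ with generator $Q_r$ defined as follows. A word $u=u_n\cdots u_1$ represents the buffer, $u_1$ being the front customer (in service) and $u_n$ the back customer. For $n\ge 1$ and $v\ne u$, $Q_r(u,v)$ is the sum of the following contributions to the target $v$: arrival contributions — for each $b\in\mathrm{Next}(u_n)$, $\lambda\nu(b)$ to $v=bu_n\cdots u_1$; for each $b\in\Sigma$ with $b\ast u_n=c\in\Sigma$, $c\ne u_n$, $\lambda\nu(b)$ to $v=cu_{n-1}\cdots u_1$; for each $b\in\Sigma$ with $b\ast u_n=1_X$, $\lambda\nu(b)$ to $v=u_{n-1}\cdots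 u_1$ — and a service contribution $\mu$ to $v=u_n\cdots u_2$ (which is $1_{\Sigma^*}$ if $n=1$). From the empty word, $Q_r(1_{\Sigma^*},a)=\lambda\nu(a)\,r(\mathrm{Next}(a))$ for $a\in\Sigma$. All other off-diagonal entries are $0$, and diagonal entries make row sums zero. Departures: a departure is a jump of the process due to a service completion, i.e. a jump of type $u_n\cdots u_1\to u_n\cdots u_2$ coming from the service contribution $\mu$; when such a jump target also receives an arrival contribution (this occurs for $u=a^n$ with $a\in\mathrm{Next}(a)$ and the cancellation $b\ast a=1_X$), the departures among these jumps occur at rate $\mu$. The departure process is the point process of departure instants. Twisted Traffic Equations associated with $(X,\Sigma,\nu,\lambda,\mu)$ (in $\eta\in\mathbb R_+^*$, $x\in\mathbb R_+^\Sigma$): for all $a\in\Sigma$, $\eta(\lambda+\mu)x(a)=\eta^2\mu x(a)+\lambda\nu(a)x(\mathrm{Next}(a))+\eta\lambda\sum_{(b,d)\in\Sigma^2:\ b\ast d=a}\nu(b)x(d)+\eta^2\lambda\sum_{(b,d)\in\Sigma^2:\ d\in\mathrm{Next}(a),\ b\ast d=1_X}\nu(b)\frac{x(d)}{x(\mathrm{Next}(d))}x(a)$. With $A(x)=\sum_{a\in\Sigma}\nu(a)x(\mathrm{Next}(a))$ and $C(x)=\sum_{(a,b)\in\Sigma^2:\ a\ast b=1_X}\nu(a)x(b)$, an admissible solution of the Twisted Traffic Equations is a solution $(\eta,x)=(\rho,r)$ with $\rho\in\mathbb R_+^*$, $r\in\mathcal B$ and $\rho=\lambda A(r)/(\mu+\lambda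 C(r))$. *)

theory Defs
  imports
    "HOL-Probability.Probability"
    "HOL-Algebra.Weak_Morphisms"
    "HOL-Algebra.Elementary_Groups"
begin

section \<open>Free products and plain monoids\<close>

inductive word_cong :: "'a set \<Rightarrow> ('a list \<times> 'a list) set \<Rightarrow> 'a list \<Rightarrow> 'a list \<Rightarrow> bool"
  for A :: "'a set" and R :: "('a list \<times> 'a list) set" where
  wc_rule: "\<lbrakk>(l, r) \<in> R; p \<in> lists A; q \<in> lists A\<rbrakk> \<Longrightarrow> word_cong A R (p @ l @ q) (p @ r @ q)"
| wc_refl: "w \<in> lists A \<Longrightarrow> word_cong A R w w"
| wc_sym: "word_cong A R u v \<Longrightarrow> word_cong A R v u"
| wc_trans: "\<lbrakk>word_cong A R u v; word_cong A R v w\<rbrakk> \<Longrightarrow> word_cong A R u w"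

definition word_class :: "'a set \<Rightarrow> ('a list \<times> 'a list) set \<Rightarrow> 'a list \<Rightarrow> 'a list set" where
  "word_class A R w = {w'. word_cong A R w w'}"

text \<open>The monoid presented by generators \<open>A\<close> and relations \<open>R\<close> (a subset of
  \<open>lists A \<times> lists A\<close>): words modulo the congruence generated by \<open>R\<close>.\<close>

definition presented_monoid :: "'a set \<Rightarrow> ('a list \<times> 'a list) set \<Rightarrow> 'a list set monoid" where
  "presented_monoid A R =
     \<lparr> carrier = word_class A R ` lists A,
       monoid.mult = (\<lambda>U V. \<Union>u\<in>U. \<Union>v\<in>V. word_class A R (u @ v)),
       one = word_class A R [] \<rparr>"

definition free_monoid :: "'s set \<Rightarrow> 's list monoid" where
  "free_monoid S = \<lparr> carrier = lists S, monoid.mult = (@), one = [] \<rparr>"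

text \<open>In the free group, \<open>(t, True)\<close> stands for \<open>t\<close> and \<open>(t, False)\<close> for its inverse.\<close>

definition free_group_rels :: "'t set \<Rightarrow> (('t \<times> bool) list \<times> ('t \<times> bool) list) set" where
  "free_group_rels T = {([(t, e), (t, \<not> e)], []) | t e. t \<in> T}"

definition free_group :: "'t set \<Rightarrow> ('t \<times> bool) list set monoid" where
  "free_group T = presented_monoid (T \<times> UNIV) (free_group_rels T)"

definition free_group_gen :: "'t set \<Rightarrow> 't \<Rightarrow> bool \<Rightarrow> ('t \<times> bool) list set" where
  "free_group_gen T t e = word_class (T \<times> UNIV) (free_group_rels T) [(t, e)]"

text \<open>The free product of a family of monoids: words over the disjoint union of the factors,
  modulo evaluating products inside a factor and deleting the units of the factors.\<close>

definition free_product_letters :: "'i set \<Rightarrow> ('i \<Rightarrow> 'a monoid) \<Rightarrow> ('i \<times> 'a) set" where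
  "free_product_letters I F = Sigma I (\<lambda>i. carrier (F i))"

definition free_product_rels ::
    "'i set \<Rightarrow> ('i \<Rightarrow> 'a monoid) \<Rightarrow> (('i \<times> 'a) list \<times> ('i \<times> 'a) list) set" where
  "free_product_rels I F =
     {([(i, x), (i, y)], [(i, x \<otimes>\<^bsub>F i\<^esub> y)]) | i x y. i \<in> I \<and> x \<in> carrier (F i) \<and> y \<in> carrier (F i)}
     \<union> {([(i, \<one>\<^bsub>F i\<^esub>)], []) | i. i \<in> I}"

definition free_product :: "'i set \<Rightarrow> ('i \<Rightarrow> 'a monoid) \<Rightarrow> ('i \<times> 'a) list set monoid" where
  "free_product I F = presented_monoid (free_product_letters I F) (free_product_rels I F)"

definition free_product_in :: "'i set \<Rightarrow> ('i \<Rightarrow> 'a monoid) \<Rightarrow> 'i \<Rightarrow> 'a \<Rightarrow> ('i \<times> 'a) list set" where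
  "free_product_in I F i x = word_class (free_product_letters I F) (free_product_rels I F) [(i, x)]"

text \<open>The factors of a plain monoid are put on one common type in order to form a single family.\<close>

datatype plain_index = FreeMonoidFactor | FreeGroupFactor | FiniteFactor nat

datatype ('s, 't, 'm) plain_elt =
  FreeMonoidElt "'s list" | FreeGroupElt "('t \<times> bool) list set" | FiniteElt 'm

definition plain_indices :: "'m monoid list \<Rightarrow> plain_index set" where
  "plain_indices Xs = {FreeMonoidFactor, FreeGroupFactor} \<union> FiniteFactor ` {..<length Xs}"

fun plain_factor ::
    "'s set \<Rightarrow> 't set \<Rightarrow> 'm monoid list \<Rightarrow> plain_index \<Rightarrow> ('s, 't, 'm) plain_elt monoid" where
  "plain_factor S T Xs FreeMonoidFactor = image_group FreeMonoidElt (free_monoid S)"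
| "plain_factor S T Xs FreeGroupFactor = image_group FreeGroupElt (free_group T)"
| "plain_factor S T Xs (FiniteFactor i) = image_group FiniteElt (Xs ! i)"

type_synonym ('s, 't, 'm) plain = "(plain_index \<times> ('s, 't, 'm) plain_elt) list set"

definition plain_monoid ::
    "'s set \<Rightarrow> 't set \<Rightarrow> 'm monoid list \<Rightarrow> ('s, 't, 'm) plain monoid" where
  "plain_monoid S T Xs = free_product (plain_indices Xs) (plain_factor S T Xs)"

definition plain_gens ::
    "'s set \<Rightarrow> 't set \<Rightarrow> 'm monoid list \<Rightarrow> ('s, 't, 'm) plain set" where
  "plain_gens S T Xs =
     (let \<iota> = free_product_in (plain_indices Xs) (plain_factor S T Xs) in
        {\<iota> FreeMonoidFactor (FreeMonoidElt [s]) | s. s \<in> S}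
      \<union> {\<iota> FreeGroupFactor (FreeGroupElt (free_group_gen T t e)) | t e. t \<in> T}
      \<union> {\<iota> (FiniteFactor i) (FiniteElt x) | i x.
            i < length Xs \<and> x \<in> carrier (Xs ! i) - {\<one>\<^bsub>Xs ! i\<^esub>}})"


section \<open>Random walks\<close>

definition word_val :: "'x monoid \<Rightarrow> 'x list \<Rightarrow> 'x" where
  "word_val X w = foldr (\<otimes>\<^bsub>X\<^esub>) w \<one>\<^bsub>X\<^esub>"

definition monoid_generates :: "'x monoid \<Rightarrow> 'x set \<Rightarrow> bool" where
  "monoid_generates X A \<longleftrightarrow> A \<subseteq> carrier X \<and> carrier X = word_val X ` lists A"

definition gen_length :: "'x monoid \<Rightarrow> 'x set \<Rightarrow> 'x \<Rightarrow> nat" where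
  "gen_length X \<Sigma> x = (LEAST k. \<exists>w\<in>lists \<Sigma>. length w = k \<and> word_val X w = x)"

definition plain_triple ::
    "('s, 't, 'm) plain monoid \<Rightarrow> ('s, 't, 'm) plain set \<Rightarrow> ('s, 't, 'm) plain pmf \<Rightarrow> bool" where
  "plain_triple X \<Sigma> \<nu> \<longleftrightarrow>
     (\<exists>S T Xs. finite S \<and> finite T \<and> (\<forall>F\<in>set Xs. monoid F \<and> finite (carrier F)) \<and>
        X = plain_monoid S T Xs \<and> \<Sigma> = plain_gens S T Xs) \<and>
     infinite (carrier X) \<and>
     \<not> X \<cong> integer_group \<and>
     \<not> X \<cong> free_product {..<2::nat} (\<lambda>_. integer_mod_group 2) \<and>
     set_pmf \<nu> \<subseteq> \<Sigma> \<and> monoid_generates X (set_pmf \<nu>)"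

definition has_drift :: "'x monoid \<Rightarrow> 'x set \<Rightarrow> 'x pmf \<Rightarrow> real \<Rightarrow> bool" where
  "has_drift X \<Sigma> \<nu> \<gamma> \<longleftrightarrow>
     (AE \<omega> in PiM (UNIV :: nat set) (\<lambda>_. measure_pmf \<nu>).
        (\<lambda>n. real (gen_length X \<Sigma> (word_val X (map \<omega> [0..<n]))) / real n) \<longlonglongrightarrow> \<gamma>)"


section \<open>Twisted Traffic Equations\<close>

definition next_gens :: "'x monoid \<Rightarrow> 'x set \<Rightarrow> 'x \<Rightarrow> 'x set" where
  "next_gens X \<Sigma> a = {b \<in> \<Sigma>. a \<otimes>\<^bsub>X\<^esub> b \<notin> \<Sigma> \<union> {\<one>\<^bsub>X\<^esub>}}"

definition open_simplex :: "'x set \<Rightarrow> ('x \<Rightarrow> real) set" where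
  "open_simplex \<Sigma> = {x. (\<forall>a\<in>\<Sigma>. x a > 0) \<and> sum x \<Sigma> = 1}"

definition twisted_traffic ::
    "'x monoid \<Rightarrow> 'x set \<Rightarrow> 'x pmf \<Rightarrow> real \<Rightarrow> real \<Rightarrow> real \<Rightarrow> ('x \<Rightarrow> real) \<Rightarrow> bool" where
  "twisted_traffic X \<Sigma> \<nu> lam \<mu> \<eta> x \<longleftrightarrow>
     (\<forall>a\<in>\<Sigma>.
        \<eta> * (lam + \<mu>) * x a =
          \<eta>\<^sup>2 * \<mu> * x a
          + lam * pmf \<nu> a * sum x (next_gens X \<Sigma> a)
          + \<eta> * lam * (\<Sum>(b, d) \<in> {(b, d) \<in> \<Sigma> \<times> \<Sigma>. b \<otimes>\<^bsub>X\<^esub> d = a}. pmf \<nu> b * x d)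
          + \<eta>\<^sup>2 * lam * (\<Sum>(b, d) \<in> {(b, d) \<in> \<Sigma> \<times> \<Sigma>. d \<in> next_gens X \<Sigma> a \<and> b \<otimes>\<^bsub>X\<^esub> d = \<one>\<^bsub>X\<^esub>}.
                pmf \<nu> b * (x d / sum x (next_gens X \<Sigma> d)) * x a))"

definition traffic_A :: "'x monoid \<Rightarrow> 'x set \<Rightarrow> 'x pmf \<Rightarrow> ('x \<Rightarrow> real) \<Rightarrow> real" where
  "traffic_A X \<Sigma> \<nu> x = (\<Sum>a\<in>\<Sigma>. pmf \<nu> a * sum x (next_gens X \<Sigma> a))"

definition traffic_C :: "'x monoid \<Rightarrow> 'x set \<Rightarrow> 'x pmf \<Rightarrow> ('x \<Rightarrow> real) \<Rightarrow> real" where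
  "traffic_C X \<Sigma> \<nu> x =
     (\<Sum>(a, b) \<in> {(a, b) \<in> \<Sigma> \<times> \<Sigma>. a \<otimes>\<^bsub>X\<^esub> b = \<one>\<^bsub>X\<^esub>}. pmf \<nu> a * x b)"

definition admissible_solution ::
    "'x monoid \<Rightarrow> 'x set \<Rightarrow> 'x pmf \<Rightarrow> real \<Rightarrow> real \<Rightarrow> real \<Rightarrow> ('x \<Rightarrow> real) \<Rightarrow> bool" where
  "admissible_solution X \<Sigma> \<nu> lam \<mu> \<rho> r \<longleftrightarrow>
     \<rho> > 0 \<and> r \<in> open_simplex \<Sigma> \<and> twisted_traffic X \<Sigma> \<nu> lam \<mu> \<rho> r \<and>
     \<rho> = lam * traffic_A X \<Sigma> \<nu> r / (\<mu> + lam * traffic_C X \<Sigma> \<nu> r)"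


section \<open>Markov jump processes\<close>

text \<open>\<open>generator_of E rate\<close> is the generator with off-diagonal entries \<open>rate\<close> and zero row sums;
  the diagonal values of \<open>rate\<close> are ignored.\<close>

definition generator_of :: "'e set \<Rightarrow> ('e \<Rightarrow> 'e \<Rightarrow> real) \<Rightarrow> 'e \<Rightarrow> 'e \<Rightarrow> real" where
  "generator_of E rate u v = (if v = u then - (\<Sum>\<^sub>\<infinity>w\<in>E - {u}. rate u w) else rate u v)"

definition transition_function :: "'e set \<Rightarrow> (real \<Rightarrow> 'e \<Rightarrow> 'e \<Rightarrow> real) \<Rightarrow> bool" where
  "transition_function E P \<longleftrightarrow>
     (\<forall>t\<ge>0. \<forall>u\<in>E. \<forall>v\<in>E. P t u v \<ge> 0) \<and>
     (\<forall>t\<ge>0. \<forall>u\<in>E. ((\<lambda>v. P t u v) has_sum 1) E) \<and>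
     (\<forall>u\<in>E. \<forall>v\<in>E. P 0 u v = of_bool (u = v)) \<and>
     (\<forall>s\<ge>0. \<forall>t\<ge>0. \<forall>u\<in>E. \<forall>v\<in>E. ((\<lambda>w. P s u w * P t w v) has_sum P (s + t) u v) E)"

definition has_generator ::
    "'e set \<Rightarrow> (real \<Rightarrow> 'e \<Rightarrow> 'e \<Rightarrow> real) \<Rightarrow> ('e \<Rightarrow> 'e \<Rightarrow> real) \<Rightarrow> bool" where
  "has_generator E P Q \<longleftrightarrow>
     (\<forall>u\<in>E. \<forall>v\<in>E. ((\<lambda>h. (P h u v - of_bool (u = v)) / h) \<longlongrightarrow> Q u v) (at_right 0))"

definition jump_path :: "(real \<Rightarrow> 'e) \<Rightarrow> bool" where
  "jump_path z \<longleftrightarrow>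
     (\<forall>t\<ge>0. \<exists>\<epsilon>>0. \<forall>s\<in>{t..<t + \<epsilon>}. z s = z t) \<and>
     (\<forall>t>0. \<exists>\<epsilon>>0. \<exists>y. \<forall>s\<in>{t - \<epsilon><..<t}. 0 \<le> s \<longrightarrow> z s = y)"

text \<open>A process, indexed by the times \<open>t \<ge> 0\<close>, with values in the countable set \<open>E\<close>, with
  right-continuous step paths, which is Markov and time-homogeneous with generator \<open>Q\<close>. The initial
  law is left free. The generators used below have bounded entries and zero row sums, so the
  transition function \<open>P\<close> is uniquely determined by \<open>Q\<close>.\<close>

definition markov_jump_process ::
    "'w measure \<Rightarrow> 'e set \<Rightarrow> ('e \<Rightarrow> 'e \<Rightarrow> real) \<Rightarrow> (real \<Rightarrow> 'w \<Rightarrow> 'e) \<Rightarrow> bool" where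
  "markov_jump_process M E Q Z \<longleftrightarrow>
     (\<forall>t\<ge>0. Z t \<in> measurable M (count_space E)) \<and>
     (AE \<omega> in M. jump_path (\<lambda>t. Z t \<omega>)) \<and>
     (\<exists>P. transition_function E P \<and> has_generator E P Q \<and>
        (\<forall>n (\<tau> :: nat \<Rightarrow> real) z. 0 \<le> \<tau> 0 \<and> (\<forall>i\<le>n. \<tau> i \<le> \<tau> (Suc i)) \<and> (\<forall>i\<le>Suc n. z i \<in> E) \<longrightarrow>
           measure M {\<omega> \<in> space M. \<forall>i\<le>Suc n. Z (\<tau> i) \<omega> = z i} =
           measure M {\<omega> \<in> space M. \<forall>i\<le>n. Z (\<tau> i) \<omega> = z i} * P (\<tau> (Suc n) - \<tau> n) (z n) (z (Suc n))))"

definition stationary_process ::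
    "'w measure \<Rightarrow> (real \<Rightarrow> 'w \<Rightarrow> 'e) \<Rightarrow> bool" where
  "stationary_process M Z \<longleftrightarrow>
     (\<forall>n (\<tau> :: nat \<Rightarrow> real) z s. 0 \<le> s \<and> (\<forall>i\<le>n. 0 \<le> \<tau> i) \<longrightarrow>
        measure M {\<omega> \<in> space M. \<forall>i\<le>n. Z (\<tau> i + s) \<omega> = z i} =
        measure M {\<omega> \<in> space M. \<forall>i\<le>n. Z (\<tau> i) \<omega> = z i})"


section \<open>Point processes on the positive half-line\<close>

definition npoints :: "('w \<Rightarrow> real set) \<Rightarrow> real \<Rightarrow> real \<Rightarrow> 'w \<Rightarrow> nat" where
  "npoints D s t \<omega> = card (D \<omega> \<inter> {s<..t})"

definition point_process :: "'w measure \<Rightarrow> ('w \<Rightarrow> real set) \<Rightarrow> bool" where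
  "point_process M D \<longleftrightarrow>
     (\<forall>\<omega>\<in>space M. D \<omega> \<subseteq> {0<..} \<and> (\<forall>t. finite (D \<omega> \<inter> {..t}))) \<and>
     (\<forall>s\<ge>0. \<forall>t\<ge>s. npoints D s t \<in> measurable M (count_space UNIV))"

definition poisson_process :: "'w measure \<Rightarrow> ('w \<Rightarrow> real set) \<Rightarrow> real \<Rightarrow> bool" where
  "poisson_process M D c \<longleftrightarrow>
     point_process M D \<and>
     (\<forall>s t. 0 \<le> s \<and> s < t \<longrightarrow>
        distr M (count_space UNIV) (npoints D s t) = measure_pmf (poisson_pmf (c * (t - s)))) \<and>
     (\<forall>n (\<tau> :: nat \<Rightarrow> real). 0 \<le> \<tau> 0 \<and> (\<forall>i<n. \<tau> i \<le> \<tau> (Suc i)) \<longrightarrow>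
        prob_space.indep_vars M (\<lambda>_. count_space UNIV) (\<lambda>i. npoints D (\<tau> i) (\<tau> (Suc i))) {..<n})"

text \<open>The \<sigma>-algebra generated by the points in \<open>(0, t]\<close>.\<close>

definition points_upto :: "'w measure \<Rightarrow> ('w \<Rightarrow> real set) \<Rightarrow> real \<Rightarrow> 'w set set" where
  "points_upto M D t =
     sigma_sets (space M) {npoints D 0 s -` B \<inter> space M | s B. 0 \<le> s \<and> s \<le> t}"


section \<open>The 0-automatic queue\<close>

text \<open>A buffer \<open>u\<^sub>n \<dots> u\<^sub>1\<close> is the list \<open>[u\<^sub>n, \<dots>, u\<^sub>1]\<close>: its head is the back customer, its last
  element is the customer in service.\<close>

definition queue_words :: "'x monoid \<Rightarrow> 'x set \<Rightarrow> 'x list set" where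
  "queue_words X \<Sigma> =
     {u \<in> lists \<Sigma>. \<forall>i. Suc i < length u \<longrightarrow> u ! i \<otimes>\<^bsub>X\<^esub> u ! Suc i \<notin> \<Sigma> \<union> {\<one>\<^bsub>X\<^esub>}}"

fun arrival_rate ::
    "'x monoid \<Rightarrow> 'x set \<Rightarrow> 'x pmf \<Rightarrow> ('x \<Rightarrow> real) \<Rightarrow> real \<Rightarrow> 'x list \<Rightarrow> 'x list \<Rightarrow> real" where
  "arrival_rate X \<Sigma> \<nu> r lam [] v =
     (\<Sum>a \<in> {a \<in> \<Sigma>. v = [a]}. lam * pmf \<nu> a * sum r (next_gens X \<Sigma> a))"
| "arrival_rate X \<Sigma> \<nu> r lam (a # w) v =
     (\<Sum>b \<in> {b \<in> next_gens X \<Sigma> a. v = b # a # w}. lam * pmf \<nu> b)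
     + (\<Sum>b \<in> {b \<in> \<Sigma>. b \<otimes>\<^bsub>X\<^esub> a \<in> \<Sigma> \<and> b \<otimes>\<^bsub>X\<^esub> a \<noteq> a \<and> v = (b \<otimes>\<^bsub>X\<^esub> a) # w}. lam * pmf \<nu> b)
     + (\<Sum>b \<in> {b \<in> \<Sigma>. b \<otimes>\<^bsub>X\<^esub> a = \<one>\<^bsub>X\<^esub> \<and> v = w}. lam * pmf \<nu> b)"

definition service_rate :: "real \<Rightarrow> 'x list \<Rightarrow> 'x list \<Rightarrow> real" where
  "service_rate \<mu> u v = (if u \<noteq> [] \<and> v = butlast u then \<mu> else 0)"

definition queue_generator ::
    "'x monoid \<Rightarrow> 'x set \<Rightarrow> 'x pmf \<Rightarrow> ('x \<Rightarrow> real) \<Rightarrow> real \<Rightarrow> real \<Rightarrow> 'x list \<Rightarrow> 'x list \<Rightarrow> real" where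
  "queue_generator X \<Sigma> \<nu> r lam \<mu> =
     generator_of (queue_words X \<Sigma>) (\<lambda>u v. arrival_rate X \<Sigma> \<nu> r lam u v + service_rate \<mu> u v)"

text \<open>Generator of the pair (queue-content, number of departures so far). A jump of the content can
  come both from a service and from a cancelling arrival (when all letters are equal), so that the
  departures are not a function of the queue-content: the counter records which jumps are services.\<close>

definition counted_queue_generator ::
    "'x monoid \<Rightarrow> 'x set \<Rightarrow> 'x pmf \<Rightarrow> ('x \<Rightarrow> real) \<Rightarrow> real \<Rightarrow> real
      \<Rightarrow> 'x list \<times> nat \<Rightarrow> 'x list \<times> nat \<Rightarrow> real" where
  "counted_queue_generator X \<Sigma> \<nu> r lam \<mu> =
     generator_of (queue_words X \<Sigma> \<times> UNIV)
       (\<lambda>(u, k) (v, l).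
          if l = k then arrival_rate X \<Sigma> \<nu> r lam u v
          else if l = Suc k then service_rate \<mu> u v
          else 0)"

text \<open>\<open>qc\<close> is a queue-content process of the queue of type \<open>(X, \<Sigma>, \<nu>, r, lam, \<mu>)\<close> and \<open>D\<close> is
  the random set of its departure instants.\<close>

definition automatic_queue ::
    "'w measure \<Rightarrow> 'x monoid \<Rightarrow> 'x set \<Rightarrow> 'x pmf \<Rightarrow> ('x \<Rightarrow> real) \<Rightarrow> real \<Rightarrow> real
      \<Rightarrow> (real \<Rightarrow> 'w \<Rightarrow> 'x list) \<Rightarrow> ('w \<Rightarrow> real set) \<Rightarrow> bool" where
  "automatic_queue M X \<Sigma> \<nu> r lam \<mu> qc D \<longleftrightarrow>
     markov_jump_process M (queue_words X \<Sigma>) (queue_generator X \<Sigma> \<nu> r lam \<mu>) qc \<and>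
     point_process M D \<and>
     markov_jump_process M (queue_words X \<Sigma> \<times> UNIV) (counted_queue_generator X \<Sigma> \<nu> r lam \<mu>)
       (\<lambda>t \<omega>. (qc t \<omega>, npoints D 0 t \<omega>))"

end

theory Submission
  imports Defs
begin

text \<open>The queue is quasi-reversible. Writing \<open>q(a) = r(a) / r(Next(a))\<close>, the Twisted Traffic
  Equations say that the product form \<open>u\<^sub>n \<dots> u\<^sub>1 \<mapsto> \<rho>\<^sup>n q(u\<^sub>n) \<dots> q(u\<^sub>2) r(u\<^sub>1)\<close> is an invariant
  measure of the queue-content, and the services then flow into every word at \<open>\<rho>\<mu>\<close> times its
  mass. A summable invariant measure is unique up to scaling, since every word leads to the empty word
  by services, so the stationary law, which exists by hypothesis, has the product form. Consequently
  the product of the stationary law and of a Poisson law with parameter \<open>\<rho>\<mu>t\<close> solves the forward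
  equation of the pair (content, departure counter); by uniqueness of the solution and the Markov
  property, the content stays independent of the whole past of the counter, whose increments are
  independent and Poisson.\<close>

section \<open>Presented monoids and free products\<close>

text \<open>The product form survives an arrival that turns the back customer d into b * d only
  because Next takes the same value at both letters: the weight of a back letter is divided by
  r(Next(.)), and the denominators must agree. The algebra of free products serves to establish
  this, the symmetry of Next, and that Next is empty either for all generators or for none. On the
  analytic side the hypotheses supply a transition function with its entrywise derivatives at time
  0. The exit rates are bounded, which dominates the difference quotients and yields the right
  derivative of every evolving law. Only right derivatives are obtained in this way, so two
  solutions of the forward equation have to be compared through them. That comparison also needs
  bounded column sums of the generator: a word has at most 3 |\<Sigma>| + 1 predecessors, whatever
  its length.\<close>

lemma word_cong_lists:
  assumes "R \<subseteq> lists A \<times> lists A" "word_cong A R u v"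
  shows "u \<in> lists A \<and> v \<in> lists A"
  using assms(2)
proof induction
  case (wc_rule l r p q)
  then show ?case using assms(1) by auto
qed auto

lemma word_cong_append:
  assumes R: "R \<subseteq> lists A \<times> lists A" and "word_cong A R u v"
    and p: "p \<in> lists A" and q: "q \<in> lists A"
  shows "word_cong A R (p @ u @ q) (p @ v @ q)"
  using assms(2)
proof induction
  case (wc_rule l r p' q')
  have "word_cong A R ((p @ p') @ l @ (q' @ q)) ((p @ p') @ r @ (q' @ q))"
    using wc_rule p q by (intro word_cong.wc_rule) auto
  then show ?case by simp
next
  case (wc_refl w)
  then show ?case using p q by (intro word_cong.wc_refl) auto
qed (blast intro: word_cong.wc_sym word_cong.wc_trans)+

lemma word_cong_append2:
  assumes R: "R \<subseteq> lists A \<times> lists A" and uu: "word_cong A R u u'" and vv: "word_cong A R v v'"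
  shows "word_cong A R (u @ v) (u' @ v')"
proof -
  have "word_cong A R (u @ v) (u' @ v)"
    using word_cong_append[OF R uu, of "[]" v] word_cong_lists[OF R vv] by simp
  moreover have "word_cong A R (u' @ v) (u' @ v')"
    using word_cong_append[OF R vv, of u' "[]"] word_cong_lists[OF R uu] by simp
  ultimately show ?thesis by (rule word_cong.wc_trans)
qed

lemma word_class_eq_iff:
  assumes "v \<in> lists A"
  shows "word_class A R u = word_class A R v \<longleftrightarrow> word_cong A R u v"
proof
  assume eq: "word_class A R u = word_class A R v"
  have "v \<in> word_class A R v" using assms by (simp add: word_class_def word_cong.wc_refl)
  with eq show "word_cong A R u v" by (auto simp: word_class_def)
next
  assume "word_cong A R u v"
  then show "word_class A R u = word_class A R v"
    by (auto simp: word_class_def intro: word_cong.wc_sym word_cong.wc_trans)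
qed

text \<open>The product of two classes is a union over representatives. The congruence is compatible
  with concatenation, so all the classes in this union coincide.\<close>

lemma presented_mult:
  assumes R: "R \<subseteq> lists A \<times> lists A" and u: "u \<in> lists A" and v: "v \<in> lists A"
  shows "word_class A R u \<otimes>\<^bsub>presented_monoid A R\<^esub> word_class A R v = word_class A R (u @ v)"
proof -
  have "word_class A R (u' @ v') = word_class A R (u @ v)"
    if "u' \<in> word_class A R u" "v' \<in> word_class A R v" for u' v'
  proof -
    have "word_cong A R (u' @ v') (u @ v)"
      using that by (intro word_cong_append2[OF R]) (auto simp: word_class_def intro: word_cong.wc_sym)
    then show ?thesis using word_class_eq_iff[of "u @ v" A R "u' @ v'"] u v by auto
  qed
  then have "(\<Union>u'\<in>word_class A R u. \<Union>v'\<in>word_class A R v. word_class A R (u' @ v'))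
      = (\<Union>u'\<in>word_class A R u. \<Union>v'\<in>word_class A R v. word_class A R (u @ v))"
    by (intro SUP_cong refl)
  also have "\<dots> = word_class A R (u @ v)"
  proof -
    have "u \<in> word_class A R u" "v \<in> word_class A R v"
      using u v by (auto simp: word_class_def intro: word_cong.wc_refl)
    then have "word_class A R u \<noteq> {}" "word_class A R v \<noteq> {}" by blast+
    then show ?thesis by simp
  qed
  finally have "(\<Union>u'\<in>word_class A R u. \<Union>v'\<in>word_class A R v. word_class A R (u' @ v')) = word_class A R (u @ v)" .
  then show ?thesis by (simp add: presented_monoid_def)
qed

lemma presented_monoid_is_monoid:
  assumes R: "R \<subseteq> lists A \<times> lists A"
  shows "monoid (presented_monoid A R)"
proof -
  have c: "carrier (presented_monoid A R) = word_class A R ` lists A"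
    and o: "\<one>\<^bsub>presented_monoid A R\<^esub> = word_class A R []"
    by (auto simp: presented_monoid_def)
  show ?thesis
  proof (rule monoidI, unfold c o)
    fix x y assume "x \<in> word_class A R ` lists A" "y \<in> word_class A R ` lists A"
    then obtain u v where "x = word_class A R u" "y = word_class A R v" "u \<in> lists A" "v \<in> lists A"
      by auto
    then show "x \<otimes>\<^bsub>presented_monoid A R\<^esub> y \<in> word_class A R ` lists A"
      by (auto simp: presented_mult[OF R])
  next
    fix x y z assume "x \<in> word_class A R ` lists A" "y \<in> word_class A R ` lists A" "z \<in> word_class A R ` lists A"
    then obtain u v w where "x = word_class A R u" "y = word_class A R v" "z = word_class A R w"
      and "u \<in> lists A" "v \<in> lists A" "w \<in> lists A"
      by auto
    then show "x \<otimes>\<^bsub>presented_monoid A R\<^esub> y \<otimes>\<^bsub>presented_monoid A R\<^esub> z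
      = x \<otimes>\<^bsub>presented_monoid A R\<^esub> (y \<otimes>\<^bsub>presented_monoid A R\<^esub> z)"
      using presented_mult[OF R] by (metis append_assoc append_in_lists_conv)
  next
    fix x assume "x \<in> word_class A R ` lists A"
    then show "word_class A R [] \<otimes>\<^bsub>presented_monoid A R\<^esub> x = x"
      and "x \<otimes>\<^bsub>presented_monoid A R\<^esub> word_class A R [] = x"
      using presented_mult[OF R] by (metis (no_types, lifting) append_Nil append_Nil2 imageE lists.Nil)+
  qed auto
qed

lemma monoid_image_group:
  assumes "monoid G" and inj: "inj_on f (carrier G)"
  shows "monoid (image_group f G)"
proof -
  interpret monoid G by fact
  show ?thesis
    by (rule monoidI) (auto simp: image_group_def inv_into_f_f[OF inj] m_assoc)
qed

lemma image_group_mult: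
  assumes "inj_on f (carrier G)" "x \<in> carrier G" "y \<in> carrier G"
  shows "f x \<otimes>\<^bsub>image_group f G\<^esub> f y = f (x \<otimes>\<^bsub>G\<^esub> y)"
  using assms by (auto simp: image_group_def inv_into_f_f)

lemma monoid_free_monoid: "monoid (free_monoid S)"
  by (rule monoidI) (auto simp: free_monoid_def)

lemma free_group_rels_sub: "free_group_rels T \<subseteq> lists (T \<times> UNIV) \<times> lists (T \<times> UNIV)"
  by (auto simp: free_group_rels_def)

lemma free_product_rels_sub:
  assumes "\<And>i. i \<in> I \<Longrightarrow> monoid (F i)"
  shows "free_product_rels I F \<subseteq> lists (free_product_letters I F) \<times> lists (free_product_letters I F)"
  using assms by (auto simp: free_product_rels_def free_product_letters_def monoid.m_closed)

lemma free_product_mult: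
  assumes "\<And>i. i \<in> I \<Longrightarrow> monoid (F i)"
    and "i \<in> I" "j \<in> I" "x \<in> carrier (F i)" "y \<in> carrier (F j)"
  shows "free_product_in I F i x \<otimes>\<^bsub>free_product I F\<^esub> free_product_in I F j y
    = word_class (free_product_letters I F) (free_product_rels I F) [(i, x), (j, y)]"
  using presented_mult[OF free_product_rels_sub[of I F, OF assms(1)], of "[(i, x)]" "[(j, y)]"] assms(2-5)
  by (simp add: free_product_in_def free_product_def free_product_letters_def)

lemma free_product_in_mult:
  assumes "\<And>i. i \<in> I \<Longrightarrow> monoid (F i)"
    and "i \<in> I" "x \<in> carrier (F i)" "y \<in> carrier (F i)"
  shows "free_product_in I F i x \<otimes>\<^bsub>free_product I F\<^esub> free_product_in I F i y
    = free_product_in I F i (x \<otimes>\<^bsub>F i\<^esub> y)"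
proof -
  have "word_cong (free_product_letters I F) (free_product_rels I F) ([] @ [(i, x), (i, y)] @ [])
     ([] @ [(i, x \<otimes>\<^bsub>F i\<^esub> y)] @ [])"
    by (rule word_cong.wc_rule) (use assms in \<open>auto simp: free_product_rels_def\<close>)
  then show ?thesis
    using assms word_class_eq_iff[of "[(i, x \<otimes>\<^bsub>F i\<^esub> y)]" "free_product_letters I F" "free_product_rels I F"
        "[(i, x), (i, y)]"]
    by (simp add: free_product_mult) (simp add: free_product_in_def free_product_letters_def monoid.m_closed)
qed

lemma free_product_in_one:
  assumes "i \<in> I"
  shows "free_product_in I F i \<one>\<^bsub>F i\<^esub> = \<one>\<^bsub>free_product I F\<^esub>"
proof -
  have "word_cong (free_product_letters I F) (free_product_rels I F) ([] @ [(i, \<one>\<^bsub>F i\<^esub>)] @ []) ([] @ [] @ [])"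
    by (rule word_cong.wc_rule) (use assms in \<open>auto simp: free_product_rels_def\<close>)
  then show ?thesis
    using word_class_eq_iff[of "[]" "free_product_letters I F" "free_product_rels I F" "[(i, \<one>\<^bsub>F i\<^esub>)]"]
    by (simp add: free_product_in_def free_product_def presented_monoid_def)
qed

subsection \<open>Normal forms in free products\<close>

text \<open>Van der Waerden's trick: the letters act on reduced words by left multiplication, and the
  action factors through the free product.\<close>

definition letter_act :: "('i \<Rightarrow> 'a monoid) \<Rightarrow> 'i \<times> 'a \<Rightarrow> ('i \<times> 'a) list \<Rightarrow> ('i \<times> 'a) list" where
  "letter_act F = (\<lambda>(i, x) w.
     if x = \<one>\<^bsub>F i\<^esub> then w
     else case w of [] \<Rightarrow> [(i, x)]
       | (j, y) # w' \<Rightarrow> if j = i then (if x \<otimes>\<^bsub>F i\<^esub> y = \<one>\<^bsub>F i\<^esub> then w' else (i, x \<otimes>\<^bsub>F i\<^esub> y) # w')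
                      else (i, x) # w)"

fun reduced_word :: "'i set \<Rightarrow> ('i \<Rightarrow> 'a monoid) \<Rightarrow> ('i \<times> 'a) list \<Rightarrow> bool" where
  "reduced_word I F [] = True"
| "reduced_word I F ((i, x) # w) \<longleftrightarrow>
     i \<in> I \<and> x \<in> carrier (F i) \<and> x \<noteq> \<one>\<^bsub>F i\<^esub> \<and> (w \<noteq> [] \<longrightarrow> fst (hd w) \<noteq> i) \<and> reduced_word I F w"

context
  fixes I :: "'i set" and F :: "'i \<Rightarrow> 'a monoid"
  assumes mon: "\<And>i. i \<in> I \<Longrightarrow> monoid (F i)"
begin

lemma reduced_word_letter_act:
  assumes "reduced_word I F w" "i \<in> I" "x \<in> carrier (F i)"
  shows "reduced_word I F (letter_act F (i, x) w)"
  using assms mon[of i]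
  by (cases w) (auto simp: letter_act_def monoid.m_closed)

text \<open>Only a first syllable from the same factor interacts with the letters, and there the
  claim is associativity. If y cancels that syllable, reducedness puts the next one into another
  factor, so that x meets no further product.\<close>

lemma letter_act_mult:
  assumes w: "reduced_word I F w" and i: "i \<in> I" and x: "x \<in> carrier (F i)" and y: "y \<in> carrier (F i)"
  shows "letter_act F (i, x) (letter_act F (i, y) w) = letter_act F (i, x \<otimes>\<^bsub>F i\<^esub> y) w"
proof -
  interpret monoid "F i" using mon i .
  consider "w = []" | j z v where "w = (j, z) # v" "j \<noteq> i" | z v where "w = (i, z) # v" by (cases w) auto
  then show ?thesis
  proof cases
    case 1
    then show ?thesis using x y by (auto simp: letter_act_def)
  next
    case 2
    then show ?thesis using x y by (auto simp: letter_act_def)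
  next
    case 3
    have "z \<in> carrier (F i)" "z \<noteq> \<one>\<^bsub>F i\<^esub>" using w 3 by auto
    moreover have "v \<noteq> [] \<Longrightarrow> fst (hd v) \<noteq> i" using w 3 by auto
    moreover have "x \<otimes>\<^bsub>F i\<^esub> (y \<otimes>\<^bsub>F i\<^esub> z) = z" if "x \<otimes>\<^bsub>F i\<^esub> y = \<one>\<^bsub>F i\<^esub>"
      using that x y \<open>z \<in> carrier (F i)\<close> m_assoc[of x y z] by simp
    ultimately show ?thesis using x y 3
      by (cases v) (auto simp: letter_act_def m_assoc)
  qed
qed

lemma reduced_word_foldr:
  assumes "u \<in> lists (free_product_letters I F)" "reduced_word I F w"
  shows "reduced_word I F (foldr (letter_act F) u w)"
  using assms by (induction u) (auto simp: free_product_letters_def intro: reduced_word_letter_act)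

text \<open>The two defining relations hold for the action on reduced words. The context of a
  rewriting step does no harm: its suffix acts first and produces another reduced word, to which the
  relation then applies.\<close>

lemma foldr_letter_act_cong:
  assumes "word_cong (free_product_letters I F) (free_product_rels I F) u v" "reduced_word I F w"
  shows "foldr (letter_act F) u w = foldr (letter_act F) v w"
  using assms
proof (induction arbitrary: w)
  case (wc_rule l r p q)
  let ?w = "foldr (letter_act F) q w"
  have "reduced_word I F ?w" using wc_rule reduced_word_foldr by auto
  then have "foldr (letter_act F) l ?w = foldr (letter_act F) r ?w"
    using wc_rule(1) by (auto simp: free_product_rels_def letter_act_mult) (auto simp: letter_act_def)
  then show ?case by simp
qed auto

text \<open>Acting on the empty word, the letter gives a word of one syllable, whereas the unit
  gives the empty word.\<close>

lemma free_product_in_neq_one: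
  assumes "k \<in> I" "z \<in> carrier (F k)" "z \<noteq> \<one>\<^bsub>F k\<^esub>"
  shows "free_product_in I F k z \<noteq> \<one>\<^bsub>free_product I F\<^esub>"
proof
  assume "free_product_in I F k z = \<one>\<^bsub>free_product I F\<^esub>"
  then have "word_cong (free_product_letters I F) (free_product_rels I F) [(k, z)] []"
    using word_class_eq_iff[of "[]" "free_product_letters I F" "free_product_rels I F" "[(k, z)]"]
    by (simp add: free_product_def presented_monoid_def free_product_in_def)
  from foldr_letter_act_cong[OF this, of "[]"] show False
    using assms by (auto simp: letter_act_def split: if_splits)
qed

text \<open>A class determines the word obtained by acting on the empty word. For the product this
  word has two syllables if the factors differ and at most one, read off inside the factor, if they
  agree; for a generator it has exactly one.\<close>

lemma free_product_mult_in_gens_iff: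
  assumes G: "\<And>i. i \<in> I \<Longrightarrow> G i \<subseteq> carrier (F i) - {\<one>\<^bsub>F i\<^esub>}"
    and i: "i \<in> I" and j: "j \<in> I" and x: "x \<in> G i" and y: "y \<in> G j"
  shows "free_product_in I F i x \<otimes>\<^bsub>free_product I F\<^esub> free_product_in I F j y
           \<in> {free_product_in I F k z | k z. k \<in> I \<and> z \<in> G k} \<union> {\<one>\<^bsub>free_product I F\<^esub>}
    \<longleftrightarrow> i = j \<and> x \<otimes>\<^bsub>F i\<^esub> y \<in> G i \<union> {\<one>\<^bsub>F i\<^esub>}" (is "?a \<otimes>\<^bsub>?X\<^esub> ?b \<in> ?\<Sigma> \<union> _ \<longleftrightarrow> _")
proof -
  have xc: "x \<in> carrier (F i)" "x \<noteq> \<one>\<^bsub>F i\<^esub>" and yc: "y \<in> carrier (F j)" "y \<noteq> \<one>\<^bsub>F j\<^esub>"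
    using G[OF i] G[OF j] x y by auto
  have "?a \<otimes>\<^bsub>?X\<^esub> ?b \<in> ?\<Sigma> \<union> {\<one>\<^bsub>?X\<^esub>}" if R: "i = j \<and> x \<otimes>\<^bsub>F i\<^esub> y \<in> G i \<union> {\<one>\<^bsub>F i\<^esub>}"
  proof -
    have "?a \<otimes>\<^bsub>?X\<^esub> ?b = free_product_in I F i (x \<otimes>\<^bsub>F i\<^esub> y)"
      using free_product_in_mult[where I = I and F = F, OF mon i xc(1), of y] R yc by simp
    then show ?thesis
      using R i free_product_in_one[OF i, of F] by auto
  qed
  moreover have "i = j \<and> x \<otimes>\<^bsub>F i\<^esub> y \<in> G i \<union> {\<one>\<^bsub>F i\<^esub>}" if L: "?a \<otimes>\<^bsub>?X\<^esub> ?b \<in> ?\<Sigma> \<union> {\<one>\<^bsub>?X\<^esub>}"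
  proof -
  have ab: "?a \<otimes>\<^bsub>?X\<^esub> ?b = word_class (free_product_letters I F) (free_product_rels I F) [(i, x), (j, y)]"
    using free_product_mult[where I = I and F = F, OF mon i j xc(1) yc(1)] .
  have "foldr (letter_act F) [(i, x), (j, y)] [] = []
    \<or> (\<exists>k z. k \<in> I \<and> z \<in> G k \<and> foldr (letter_act F) [(i, x), (j, y)] [] = foldr (letter_act F) [(k, z)] [])"
  proof (cases "?a \<otimes>\<^bsub>?X\<^esub> ?b = \<one>\<^bsub>?X\<^esub>")
    case True
    then have "word_cong (free_product_letters I F) (free_product_rels I F) [(i, x), (j, y)] []"
      unfolding ab using word_class_eq_iff[of "[]"] by (auto simp: free_product_def presented_monoid_def)
    from foldr_letter_act_cong[OF this, of "[]"] show ?thesis by auto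
  next
    case False
    with L obtain k z where k: "k \<in> I" "z \<in> G k" and e: "?a \<otimes>\<^bsub>?X\<^esub> ?b = free_product_in I F k z" by blast
    have kz: "[(k, z)] \<in> lists (free_product_letters I F)" using k G[of k] by (auto simp: free_product_letters_def)
    have "word_class (free_product_letters I F) (free_product_rels I F) [(i, x), (j, y)]
        = word_class (free_product_letters I F) (free_product_rels I F) [(k, z)]"
      using e by (simp only: ab free_product_in_def[of I F k z])
    then have "word_cong (free_product_letters I F) (free_product_rels I F) [(i, x), (j, y)] [(k, z)]"
      by (rule iffD1[OF word_class_eq_iff[OF kz]])
    from foldr_letter_act_cong[OF this, of "[]"] k show ?thesis by (metis reduced_word.simps(1))
  qed
  moreover have "foldr (letter_act F) [(k, z)] [] = [(k, z)]" if "k \<in> I" "z \<in> G k" for k z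
    using that G[of k] by (auto simp: letter_act_def)
  moreover have nf: "foldr (letter_act F) [(i, x), (j, y)] [] =
      (if i = j then if x \<otimes>\<^bsub>F i\<^esub> y = \<one>\<^bsub>F i\<^esub> then [] else [(i, x \<otimes>\<^bsub>F i\<^esub> y)] else [(i, x), (j, y)])"
    using xc yc by (auto simp: letter_act_def)
  ultimately show "i = j \<and> x \<otimes>\<^bsub>F i\<^esub> y \<in> G i \<union> {\<one>\<^bsub>F i\<^esub>}"
    using xc yc by (auto simp: nf split: if_splits)
  qed
  ultimately show ?thesis by blast
qed

text \<open>Excludes the unit from the preceding characterization: if x and y multiplied to the unit
  of their factor, the generator equal to their product would be the unit of the free
  product.\<close>

lemma free_product_mult_in_gens:
  assumes G: "\<And>i. i \<in> I \<Longrightarrow> G i \<subseteq> carrier (F i) - {\<one>\<^bsub>F i\<^esub>}"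
    and i: "i \<in> I" and j: "j \<in> I" and x: "x \<in> G i" and y: "y \<in> G j"
    and in_gens: "free_product_in I F i x \<otimes>\<^bsub>free_product I F\<^esub> free_product_in I F j y
           \<in> {free_product_in I F k z | k z. k \<in> I \<and> z \<in> G k}"
  shows "i = j" and "x \<otimes>\<^bsub>F i\<^esub> y \<in> G i"
proof -
  have *: "i = j \<and> x \<otimes>\<^bsub>F i\<^esub> y \<in> G i \<union> {\<one>\<^bsub>F i\<^esub>}"
    using free_product_mult_in_gens_iff[OF G i j x y] in_gens by blast
  then show "i = j" by simp
  show "x \<otimes>\<^bsub>F i\<^esub> y \<in> G i"
  proof (rule ccontr)
    assume "x \<otimes>\<^bsub>F i\<^esub> y \<notin> G i"
    with * have ij: "i = j" and xy: "x \<otimes>\<^bsub>F i\<^esub> y = \<one>\<^bsub>F i\<^esub>" by auto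
    obtain k z where k: "k \<in> I" "z \<in> G k" and
      e: "free_product_in I F i x \<otimes>\<^bsub>free_product I F\<^esub> free_product_in I F j y = free_product_in I F k z"
      using in_gens by blast
    have "free_product_in I F i x \<otimes>\<^bsub>free_product I F\<^esub> free_product_in I F i y = free_product_in I F i (x \<otimes>\<^bsub>F i\<^esub> y)"
      using G[OF i] x y ij i by (intro free_product_in_mult[where I = I and F = F, OF mon]) auto
    then have "free_product_in I F k z = \<one>\<^bsub>free_product I F\<^esub>"
      using e ij xy free_product_in_one[OF i, of F] by simp
    then show False
      using free_product_in_neq_one[of k z] k G[of k] by blast
  qed
qed

end

subsection \<open>Plain monoids\<close>

definition letter_exponent :: "'t \<Rightarrow> 't \<times> bool \<Rightarrow> int" where
  "letter_exponent t = (\<lambda>(s, e). if s = t then if e then 1 else - 1 else 0)"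

text \<open>Abelianization and word-length parity are enough to separate the products of two generators
  of a free group from the generators and, except for the trivial cancellations, from the unit.\<close>

lemma free_group_cong_invariants:
  assumes "word_cong (T \<times> UNIV) (free_group_rels T) u v"
  shows "even (length u) = even (length v)"
    and "sum_list (map (letter_exponent t) u) = sum_list (map (letter_exponent t) v)"
  using assms by induction (auto simp: free_group_rels_def letter_exponent_def)

lemma free_group_gen_mult:
  assumes "t \<in> T" "s \<in> T"
  shows "free_group_gen T t e \<otimes>\<^bsub>free_group T\<^esub> free_group_gen T s f
    = word_class (T \<times> UNIV) (free_group_rels T) [(t, e), (s, f)]"
  using assms presented_mult[OF free_group_rels_sub, of "[(t, e)]" T "[(s, f)]"]
  by (simp add: free_group_gen_def free_group_def)

lemma free_group_gen_neq_one:
  assumes "t \<in> T"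
  shows "free_group_gen T t e \<noteq> \<one>\<^bsub>free_group T\<^esub>"
proof
  assume "free_group_gen T t e = \<one>\<^bsub>free_group T\<^esub>"
  then have "word_cong (T \<times> UNIV) (free_group_rels T) [(t, e)] []"
    using word_class_eq_iff[of "[]" "T \<times> UNIV" "free_group_rels T"]
    by (auto simp: free_group_gen_def free_group_def presented_monoid_def)
  from free_group_cong_invariants(1)[OF this] show False by simp
qed

lemma free_group_gen_mult_neq_gen:
  assumes "t \<in> T" "s \<in> T" "t' \<in> T"
  shows "free_group_gen T t e \<otimes>\<^bsub>free_group T\<^esub> free_group_gen T s f \<noteq> free_group_gen T t' e'"
proof
  assume "free_group_gen T t e \<otimes>\<^bsub>free_group T\<^esub> free_group_gen T s f = free_group_gen T t' e'"
  then have "word_cong (T \<times> UNIV) (free_group_rels T) [(t, e), (s, f)] [(t', e')]"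
    using word_class_eq_iff[of "[(t', e')]" "T \<times> UNIV" "free_group_rels T"] assms
    by (auto simp: free_group_gen_mult) (auto simp: free_group_gen_def)
  from free_group_cong_invariants(1)[OF this] show False by simp
qed

lemma free_group_gen_mult_eq_one_iff:
  assumes "t \<in> T" "s \<in> T"
  shows "free_group_gen T t e \<otimes>\<^bsub>free_group T\<^esub> free_group_gen T s f = \<one>\<^bsub>free_group T\<^esub> \<longleftrightarrow> s = t \<and> f \<noteq> e"
proof -
  have "free_group_gen T t e \<otimes>\<^bsub>free_group T\<^esub> free_group_gen T s f = \<one>\<^bsub>free_group T\<^esub>
    \<longleftrightarrow> word_cong (T \<times> UNIV) (free_group_rels T) [(t, e), (s, f)] []"
    using word_class_eq_iff[of "[]" "T \<times> UNIV" "free_group_rels T"] assms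
    by (simp add: free_group_gen_mult) (simp add: free_group_def presented_monoid_def)
  moreover have "s = t \<and> f \<noteq> e" if "word_cong (T \<times> UNIV) (free_group_rels T) [(t, e), (s, f)] []"
    using free_group_cong_invariants(2)[OF that, of t] by (auto simp: letter_exponent_def split: if_splits)
  moreover have "word_cong (T \<times> UNIV) (free_group_rels T) ([] @ [(t, e), (t, \<not> e)] @ []) ([] @ [] @ [])"
    by (rule word_cong.wc_rule) (use assms in \<open>auto simp: free_group_rels_def\<close>)
  moreover have "f \<noteq> e \<longleftrightarrow> f = (\<not> e)" by auto
  ultimately show ?thesis by auto
qed

fun plain_factor_gens ::
    "'s set \<Rightarrow> 't set \<Rightarrow> 'm monoid list \<Rightarrow> plain_index \<Rightarrow> ('s, 't, 'm) plain_elt set" where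
  "plain_factor_gens S T Xs FreeMonoidFactor = {FreeMonoidElt [s] | s. s \<in> S}"
| "plain_factor_gens S T Xs FreeGroupFactor = {FreeGroupElt (free_group_gen T t e) | t e. t \<in> T}"
| "plain_factor_gens S T Xs (FiniteFactor i) = FiniteElt ` (carrier (Xs ! i) - {\<one>\<^bsub>Xs ! i\<^esub>})"

lemma plain_gens_eq:
  "plain_gens S T Xs = {free_product_in (plain_indices Xs) (plain_factor S T Xs) k z | k z.
     k \<in> plain_indices Xs \<and> z \<in> plain_factor_gens S T Xs k}" (is "?L = ?R")
proof
  show "?L \<subseteq> ?R"
  proof
    fix a assume "a \<in> ?L"
    then consider s where "s \<in> S" "a = free_product_in (plain_indices Xs) (plain_factor S T Xs) FreeMonoidFactor (FreeMonoidElt [s])"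
      | t e where "t \<in> T" "a = free_product_in (plain_indices Xs) (plain_factor S T Xs) FreeGroupFactor (FreeGroupElt (free_group_gen T t e))"
      | i x where "i < length Xs" "x \<in> carrier (Xs ! i) - {\<one>\<^bsub>Xs ! i\<^esub>}"
        "a = free_product_in (plain_indices Xs) (plain_factor S T Xs) (FiniteFactor i) (FiniteElt x)"
      unfolding plain_gens_def Let_def by blast
    then show "a \<in> ?R"
    proof cases
      case 1
      then show ?thesis
        by (intro CollectI exI[of _ FreeMonoidFactor] exI[of _ "FreeMonoidElt [s]"]) (auto simp: plain_indices_def)
    next
      case 2
      then show ?thesis
        by (intro CollectI exI[of _ FreeGroupFactor] exI[of _ "FreeGroupElt (free_group_gen T t e)"]) (auto simp: plain_indices_def)
    next
      case 3
      then show ?thesis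
        by (intro CollectI exI[of _ "FiniteFactor i"] exI[of _ "FiniteElt x"]) (auto simp: plain_indices_def)
    qed
  qed
  show "?R \<subseteq> ?L"
  proof
    fix a assume "a \<in> ?R"
    then obtain k z where k: "k \<in> plain_indices Xs" "z \<in> plain_factor_gens S T Xs k"
      and a: "a = free_product_in (plain_indices Xs) (plain_factor S T Xs) k z" by blast
    then show "a \<in> ?L"
      unfolding plain_gens_def Let_def a by (cases k) (auto simp: plain_indices_def)
  qed
qed

lemma finite_plain_gens:
  assumes "finite S" "finite T" "\<forall>F\<in>set Xs. finite (carrier F)"
  shows "finite (plain_gens S T Xs)"
proof -
  have "finite (plain_factor_gens S T Xs k)" if "k \<in> plain_indices Xs" for k
  proof (cases k)
    case FreeGroupFactor
    have "plain_factor_gens S T Xs k = (\<lambda>(t, e). FreeGroupElt (free_group_gen T t e)) ` (T \<times> UNIV)"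
      using FreeGroupFactor by auto
    then show ?thesis using assms by simp
  qed (use that assms in \<open>auto simp: plain_indices_def\<close>)
  moreover have "finite (plain_indices Xs)" by (simp add: plain_indices_def)
  moreover have "plain_gens S T Xs = (\<lambda>(k, z). free_product_in (plain_indices Xs) (plain_factor S T Xs) k z) `
      Sigma (plain_indices Xs) (plain_factor_gens S T Xs)"
    unfolding plain_gens_eq by auto
  ultimately show ?thesis by simp
qed

lemma monoid_plain_factor:
  assumes "\<forall>F\<in>set Xs. Group.monoid F" "k \<in> plain_indices Xs"
  shows "Group.monoid (plain_factor S T Xs k)"
proof (cases k)
  case FreeMonoidFactor
  then show ?thesis by (auto intro!: monoid_image_group monoid_free_monoid inj_onI)
next
  case FreeGroupFactor
  then show ?thesis
    by (auto intro!: monoid_image_group presented_monoid_is_monoid[OF free_group_rels_sub] inj_onI simp: free_group_def)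
next
  case (FiniteFactor i)
  then show ?thesis using assms by (auto intro!: monoid_image_group inj_onI simp: plain_indices_def)
qed

lemma free_group_gen_carrier: "t \<in> T \<Longrightarrow> free_group_gen T t e \<in> carrier (free_group T)"
  by (auto simp: free_group_gen_def free_group_def presented_monoid_def)

lemma plain_factor_gens_sub:
  "plain_factor_gens S T Xs k \<subseteq> carrier (plain_factor S T Xs k) - {\<one>\<^bsub>plain_factor S T Xs k\<^esub>}"
  by (cases k) (auto simp: image_group_def free_monoid_def free_group_gen_neq_one intro: free_group_gen_carrier)

lemma FreeGroupElt_mult:
  assumes "t \<in> T" "s \<in> T"
  shows "FreeGroupElt (free_group_gen T t e) \<otimes>\<^bsub>image_group FreeGroupElt (free_group T)\<^esub> FreeGroupElt (free_group_gen T s f)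
    = FreeGroupElt (free_group_gen T t e \<otimes>\<^bsub>free_group T\<^esub> free_group_gen T s f)"
  by (rule image_group_mult) (auto intro!: inj_onI free_group_gen_carrier assms)

lemma FreeMonoidElt_mult:
  assumes "s \<in> S" "s' \<in> S"
  shows "FreeMonoidElt [s] \<otimes>\<^bsub>image_group FreeMonoidElt (free_monoid S)\<^esub> FreeMonoidElt [s']
    = FreeMonoidElt [s, s']"
  using image_group_mult[of FreeMonoidElt "free_monoid S" "[s]" "[s']"] assms
  by (simp add: inj_on_def) (simp add: free_monoid_def)

text \<open>Within a factor, multiplication by a generator either never leaves the generators and the
  unit (finite factors), or produces nothing but the trivial cancellations (free factors).\<close>

lemma plain_factor_gens_mult:
  fixes S :: "'s set" and T :: "'t set"
  assumes mon: "\<forall>F\<in>set Xs. Group.monoid F" and k: "k \<in> plain_indices Xs"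
  shows "(\<forall>x\<in>plain_factor_gens S T Xs k. \<forall>y\<in>plain_factor_gens S T Xs k.
       x \<otimes>\<^bsub>plain_factor S T Xs k\<^esub> y \<in> plain_factor_gens S T Xs k \<union> {\<one>\<^bsub>plain_factor S T Xs k\<^esub>})
    \<or> (\<forall>x\<in>plain_factor_gens S T Xs k. \<forall>y\<in>plain_factor_gens S T Xs k.
       x \<otimes>\<^bsub>plain_factor S T Xs k\<^esub> y \<notin> plain_factor_gens S T Xs k
       \<and> (x \<otimes>\<^bsub>plain_factor S T Xs k\<^esub> y = \<one>\<^bsub>plain_factor S T Xs k\<^esub>
            \<longrightarrow> y \<otimes>\<^bsub>plain_factor S T Xs k\<^esub> x = \<one>\<^bsub>plain_factor S T Xs k\<^esub> \<and> x \<noteq> y))"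
proof (cases k)
  case FreeMonoidFactor
  then show ?thesis
    by (intro disjI2) (auto simp: FreeMonoidElt_mult image_group_one, auto simp: free_monoid_def)
next
  case FreeGroupFactor
  then show ?thesis
    by (intro disjI2) (auto simp: FreeGroupElt_mult image_group_one free_group_gen_mult_neq_gen free_group_gen_mult_eq_one_iff)
next
  case (FiniteFactor i)
  have "Group.monoid (Xs ! i)" using k mon FiniteFactor by (auto simp: plain_indices_def)
  then show ?thesis
    using FiniteFactor
    by (intro disjI1) (auto simp: image_group_one image_group_mult inj_on_def monoid.m_closed)
qed

text \<open>What the queue needs of a plain monoid. \<open>gens_mult_sym\<close> makes Next
  symmetric, which reconciles arrivals on the left with Next defined by products on the right.
  \<open>next_gens_mult\<close> lets the back letter change without disturbing the word behind it.
  \<open>next_gens_nonempty\<close> spreads positivity of r(Next(a)) from one generator to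
  all.\<close>

locale zero_automatic =
  fixes X :: "'x monoid" and \<Sigma> :: "'x set"
  assumes finite_gens: "finite \<Sigma>"
    and one_not_gen: "\<one>\<^bsub>X\<^esub> \<notin> \<Sigma>"
    and gens_mult_sym: "\<lbrakk>a \<in> \<Sigma>; b \<in> \<Sigma>; a \<otimes>\<^bsub>X\<^esub> b \<in> \<Sigma> \<union> {\<one>\<^bsub>X\<^esub>}\<rbrakk> \<Longrightarrow> b \<otimes>\<^bsub>X\<^esub> a \<in> \<Sigma> \<union> {\<one>\<^bsub>X\<^esub>}"
    and next_gens_mult: "\<lbrakk>a \<in> \<Sigma>; b \<in> \<Sigma>; a \<otimes>\<^bsub>X\<^esub> b \<in> \<Sigma>\<rbrakk> \<Longrightarrow> next_gens X \<Sigma> (a \<otimes>\<^bsub>X\<^esub> b) = next_gens X \<Sigma> b"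
    and next_gens_nonempty: "\<lbrakk>a \<in> \<Sigma>; next_gens X \<Sigma> a \<noteq> {}; b \<in> \<Sigma>\<rbrakk> \<Longrightarrow> next_gens X \<Sigma> b \<noteq> {}"

lemma zero_automatic_plain:
  assumes S: "finite S" and T: "finite T" and Xs: "\<forall>F\<in>set Xs. Group.monoid F \<and> finite (carrier F)"
  shows "zero_automatic (plain_monoid S T Xs) (plain_gens S T Xs)"
proof -
  let ?X = "plain_monoid S T Xs" and ?\<Sigma> = "plain_gens S T Xs"
  let ?I = "plain_indices Xs" and ?F = "plain_factor S T Xs" and ?G = "plain_factor_gens S T Xs"
  let ?in = "free_product_in ?I ?F"
  have mon: "\<And>k. k \<in> ?I \<Longrightarrow> Group.monoid (?F k)" using monoid_plain_factor Xs by blast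
  have Xm: "\<forall>F\<in>set Xs. Group.monoid F" using Xs by blast
  \<comment> \<open>Three consequences of the alternative for a factor: symmetry; a product of
    generators that is a generator forces the closed alternative; so does a square that is a
    generator or the unit, since trivial cancellations involve two different letters.\<close>
  have gm1: "y \<otimes>\<^bsub>?F k\<^esub> x \<in> ?G k \<union> {\<one>\<^bsub>?F k\<^esub>}"
    if "k \<in> ?I" "x \<in> ?G k" "y \<in> ?G k" "x \<otimes>\<^bsub>?F k\<^esub> y \<in> ?G k \<union> {\<one>\<^bsub>?F k\<^esub>}" for k x y
    using plain_factor_gens_mult[OF Xm that(1), of S T] that(2-) by blast
  have gm2: "u \<otimes>\<^bsub>?F k\<^esub> v \<in> ?G k \<union> {\<one>\<^bsub>?F k\<^esub>}"
    if "k \<in> ?I" "x \<in> ?G k" "y \<in> ?G k" "x \<otimes>\<^bsub>?F k\<^esub> y \<in> ?G k" "u \<in> ?G k" "v \<in> ?G k" for k x y u v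
    using plain_factor_gens_mult[OF Xm that(1), of S T] that(2-) by blast
  have gm3: "u \<otimes>\<^bsub>?F k\<^esub> v \<in> ?G k \<union> {\<one>\<^bsub>?F k\<^esub>}"
    if "k \<in> ?I" "x \<in> ?G k" "x \<otimes>\<^bsub>?F k\<^esub> x \<in> ?G k \<union> {\<one>\<^bsub>?F k\<^esub>}" "u \<in> ?G k" "v \<in> ?G k" for k x u v
    using plain_factor_gens_mult[OF Xm that(1), of S T] that(2-) by blast
  have gensE: "\<exists>k z. k \<in> ?I \<and> z \<in> ?G k \<and> a = ?in k z" if "a \<in> ?\<Sigma>" for a
    using that unfolding plain_gens_eq by blast
  have gensI: "?in k z \<in> ?\<Sigma>" if "k \<in> ?I" "z \<in> ?G k" for k z
    using that unfolding plain_gens_eq by blast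
  have iff: "?in i x \<otimes>\<^bsub>?X\<^esub> ?in j y \<in> ?\<Sigma> \<union> {\<one>\<^bsub>?X\<^esub>} \<longleftrightarrow> i = j \<and> x \<otimes>\<^bsub>?F i\<^esub> y \<in> ?G i \<union> {\<one>\<^bsub>?F i\<^esub>}"
    if "i \<in> ?I" "j \<in> ?I" "x \<in> ?G i" "y \<in> ?G j" for i j x y
    unfolding plain_gens_eq plain_monoid_def
    by (rule free_product_mult_in_gens_iff[OF mon plain_factor_gens_sub that])
  have inD: "i = j \<and> x \<otimes>\<^bsub>?F i\<^esub> y \<in> ?G i"
    if "i \<in> ?I" "j \<in> ?I" "x \<in> ?G i" "y \<in> ?G j" "?in i x \<otimes>\<^bsub>?X\<^esub> ?in j y \<in> ?\<Sigma>" for i j x y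
    using free_product_mult_in_gens[OF mon plain_factor_gens_sub that(1-4)
        that(5)[unfolded plain_gens_eq plain_monoid_def]] by blast
  have next_iff: "?in j y \<in> next_gens ?X ?\<Sigma> (?in i x) \<longleftrightarrow> \<not> (i = j \<and> x \<otimes>\<^bsub>?F i\<^esub> y \<in> ?G i \<union> {\<one>\<^bsub>?F i\<^esub>})"
    if "i \<in> ?I" "j \<in> ?I" "x \<in> ?G i" "y \<in> ?G j" for i j x y
    unfolding next_gens_def using iff[OF that] gensI[OF that(2,4)] by blast
  have next_sub: "next_gens ?X ?\<Sigma> a \<subseteq> ?\<Sigma>" for a by (auto simp: next_gens_def)
  show ?thesis
  proof
    show "finite ?\<Sigma>" using assms by (intro finite_plain_gens) auto
  next
    show "\<one>\<^bsub>?X\<^esub> \<notin> ?\<Sigma>"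
    proof
      assume "\<one>\<^bsub>?X\<^esub> \<in> ?\<Sigma>"
      then obtain k z where "k \<in> ?I" "z \<in> ?G k" "\<one>\<^bsub>?X\<^esub> = ?in k z" using gensE by meson
      then show False
        using free_product_in_neq_one[where I = ?I and F = ?F, OF mon, of k z] plain_factor_gens_sub[of S T Xs k]
        unfolding plain_monoid_def by auto
    qed
  next
    fix a b assume "a \<in> ?\<Sigma>" "b \<in> ?\<Sigma>" and ab: "a \<otimes>\<^bsub>?X\<^esub> b \<in> ?\<Sigma> \<union> {\<one>\<^bsub>?X\<^esub>}"
    then obtain i x j y where ij: "i \<in> ?I" "j \<in> ?I" "x \<in> ?G i" "y \<in> ?G j" and a: "a = ?in i x" "b = ?in j y"
      using gensE by meson
    have *: "i = j" "x \<otimes>\<^bsub>?F i\<^esub> y \<in> ?G i \<union> {\<one>\<^bsub>?F i\<^esub>}" using ab iff[OF ij] unfolding a by blast+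
    then have "y \<otimes>\<^bsub>?F i\<^esub> x \<in> ?G i \<union> {\<one>\<^bsub>?F i\<^esub>}" using gm1[OF ij(1,3)] ij(4) *(1) by blast
    then show "b \<otimes>\<^bsub>?X\<^esub> a \<in> ?\<Sigma> \<union> {\<one>\<^bsub>?X\<^esub>}" using iff[OF ij(2,1,4,3)] *(1) unfolding a by blast
  next
    fix a b assume "a \<in> ?\<Sigma>" "b \<in> ?\<Sigma>" and ab: "a \<otimes>\<^bsub>?X\<^esub> b \<in> ?\<Sigma>"
    then obtain i x j y where ij: "i \<in> ?I" "j \<in> ?I" "x \<in> ?G i" "y \<in> ?G j" and a: "a = ?in i x" "b = ?in j y"
      using gensE by meson
    have i: "i = j" "x \<otimes>\<^bsub>?F i\<^esub> y \<in> ?G i" using inD[OF ij] ab unfolding a by blast+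
    \<comment> \<open>The factor is closed, so generators of the same factor are never in Next of
      each other, and Next depends on the factor alone.\<close>
    have full: "u \<otimes>\<^bsub>?F i\<^esub> v \<in> ?G i \<union> {\<one>\<^bsub>?F i\<^esub>}" if "u \<in> ?G i" "v \<in> ?G i" for u v
      using gm2[OF ij(1,3) _ i(2) that] ij(4) i(1) by blast
    have abi: "a \<otimes>\<^bsub>?X\<^esub> b = ?in i (x \<otimes>\<^bsub>?F i\<^esub> y)"
      using free_product_in_mult[where I = ?I and F = ?F, OF mon ij(1), of x y] ij i(1)
        plain_factor_gens_sub[of S T Xs i] unfolding a plain_monoid_def by blast
    have "?in l z \<in> next_gens ?X ?\<Sigma> (a \<otimes>\<^bsub>?X\<^esub> b) \<longleftrightarrow> ?in l z \<in> next_gens ?X ?\<Sigma> b"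
      if l: "l \<in> ?I" "z \<in> ?G l" for l z
    proof (cases "l = i")
      case True
      have "y \<in> ?G i" "z \<in> ?G i" using ij(4) i(1) l(2) True by simp_all
      from next_iff[OF ij(1,1) i(2) this(2)] next_iff[OF ij(1,1) this(1,2)] full[OF i(2) this(2)] full[OF this]
      show ?thesis unfolding abi unfolding a True i(1)[symmetric] by blast
    next
      case False
      with next_iff[OF ij(1) l(1) i(2) l(2)] next_iff[OF ij(2) l(1) ij(4) l(2)] i(1)
      show ?thesis unfolding abi unfolding a by blast
    qed
    then show "next_gens ?X ?\<Sigma> (a \<otimes>\<^bsub>?X\<^esub> b) = next_gens ?X ?\<Sigma> b"
      using gensE next_sub by blast
  next
    fix a b assume "a \<in> ?\<Sigma>" "b \<in> ?\<Sigma>" and ne: "next_gens ?X ?\<Sigma> a \<noteq> {}"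
    then obtain c where c: "c \<in> next_gens ?X ?\<Sigma> a" by blast
    then have "c \<in> ?\<Sigma>" using next_sub by blast
    with \<open>a \<in> ?\<Sigma>\<close> \<open>b \<in> ?\<Sigma>\<close> obtain i x j y l z where i: "i \<in> ?I" "x \<in> ?G i" "a = ?in i x"
      and j: "j \<in> ?I" "y \<in> ?G j" "b = ?in j y" and l: "l \<in> ?I" "z \<in> ?G l" "c = ?in l z"
      using gensE by meson
    show "next_gens ?X ?\<Sigma> b \<noteq> {}"
    proof
      assume "next_gens ?X ?\<Sigma> b = {}"
      \<comment> \<open>If Next(b) is empty, every generator lies in the factor of b, and b * b is a
        generator or the unit. The factor is then closed, which contradicts the presence of c in
        Next(a).\<close>
      then have *: "j = k \<and> y \<otimes>\<^bsub>?F j\<^esub> w \<in> ?G j \<union> {\<one>\<^bsub>?F j\<^esub>}" if "k \<in> ?I" "w \<in> ?G k" for k w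
        using next_iff[OF j(1) that(1) j(2) that(2)] j(3) by blast
      have "j = i" "j = l" "y \<otimes>\<^bsub>?F j\<^esub> y \<in> ?G j \<union> {\<one>\<^bsub>?F j\<^esub>}" using *[OF i(1,2)] *[OF l(1,2)] *[OF j(1,2)] by blast+
      then have "x \<otimes>\<^bsub>?F i\<^esub> z \<in> ?G i \<union> {\<one>\<^bsub>?F i\<^esub>}" using gm3[OF j(1,2)] i(2) l(2) by blast
      then show False using next_iff[OF i(1) l(1) i(2) l(2)] c i(3) l(3) \<open>j = i\<close> \<open>j = l\<close> by blast
    qed
  qed
qed

section \<open>Markov semigroups with bounded generators\<close>

lemma has_sum_diff:
  fixes f g :: "'x \<Rightarrow> 'b :: real_normed_vector"
  assumes "(f has_sum a) A" "(g has_sum b) A"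
  shows "((\<lambda>x. f x - g x) has_sum (a - b)) A"
  using has_sum_add[OF assms(1), of "\<lambda>x. - g x" "- b"] assms(2) by (simp add: has_sum_uminus)

text \<open>A finite set B carries all but \<epsilon>/4 of the mass of g. On B the convergence is
  termwise; outside B both sums are bounded by the tail of g.\<close>

lemma infsum_dominated_convergence:
  fixes e :: "'h \<Rightarrow> 'x \<Rightarrow> real"
  assumes g: "g summable_on E"
    and dom: "\<forall>\<^sub>F h in F. \<forall>x\<in>E. \<bar>e h x\<bar> \<le> g x"
    and lim: "\<And>x. x \<in> E \<Longrightarrow> ((\<lambda>h. e h x) \<longlongrightarrow> l x) F"
    and F: "F \<noteq> bot"
  shows "((\<lambda>h. infsum (e h) E) \<longlongrightarrow> infsum l E) F"
proof -
  have l: "\<bar>l x\<bar> \<le> g x" if "x \<in> E" for x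
    by (rule tendsto_upperbound[OF tendsto_rabs[OF lim[OF that]] _ F])
      (use dom that in \<open>auto elim!: eventually_mono\<close>)
  have abs_sum: "(\<lambda>x. norm (k x)) summable_on S" "\<bar>infsum k S\<bar> \<le> infsum g S" if "\<forall>x\<in>E. \<bar>k x\<bar> \<le> g x" "S \<subseteq> E" for k S
  proof -
    have gS: "g summable_on S" using g that(2) by (rule summable_on_subset)
    then show *: "(\<lambda>x. norm (k x)) summable_on S"
      by (rule summable_on_comparison_test) (use that in auto)
    have "norm (infsum k S) \<le> infsum (\<lambda>x. norm (k x)) S" by (rule norm_infsum_bound[OF *])
    also have "\<dots> \<le> infsum g S" using * gS that by (intro infsum_mono) auto
    finally show "\<bar>infsum k S\<bar> \<le> infsum g S" by simp
  qed
  show ?thesis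
  proof (rule tendstoI)
    fix \<epsilon> :: real assume \<epsilon>: "\<epsilon> > 0"
    obtain B where B: "finite B" "B \<subseteq> E" "dist (sum g B) (infsum g E) \<le> \<epsilon> / 4"
      using infsum_finite_approximation[OF g, of "\<epsilon> / 4"] \<epsilon> by auto
    have "infsum g E = infsum g B + infsum g (E - B)"
      using infsum_Un_disjoint[of g B "E - B"] B g summable_on_subset[OF g]
      by (simp add: Un_absorb1 sup_absorb2 Diff_partition)
    then have tail: "infsum g (E - B) \<le> \<epsilon> / 4" using B by (simp add: dist_real_def)
    have split: "infsum k E = sum k B + infsum k (E - B)" if "\<forall>x\<in>E. \<bar>k x\<bar> \<le> g x" for k
      using infsum_Un_disjoint[of k B "E - B"] B abs_sum(1)[OF that, THEN abs_summable_summable]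
      by (simp add: Un_absorb1)
    have "((\<lambda>h. sum (e h) B) \<longlongrightarrow> sum l B) F"
      by (intro tendsto_sum lim) (use B in auto)
    then have "\<forall>\<^sub>F h in F. dist (sum (e h) B) (sum l B) < \<epsilon> / 4"
      by (rule tendstoD) (use \<epsilon> in simp)
    with dom show "\<forall>\<^sub>F h in F. dist (infsum (e h) E) (infsum l E) < \<epsilon>"
    proof eventually_elim
      case (elim h)
      have lg: "\<forall>x\<in>E. \<bar>l x\<bar> \<le> g x" using l by blast
      note se = split[OF elim(1)] and sl = split[OF lg]
      from elim(2) abs_sum(2)[OF elim(1), of "E - B"] abs_sum(2)[OF lg, of "E - B"] tail \<epsilon>
      have "\<bar>sum (e h) B - sum l B\<bar> < \<epsilon> / 4" "\<bar>infsum (e h) (E - B)\<bar> \<le> \<epsilon> / 4" "\<bar>infsum l (E - B)\<bar> \<le> \<epsilon> / 4"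
        by (simp_all add: dist_real_def)
      then have "\<bar>sum (e h) B - sum l B + infsum (e h) (E - B) - infsum l (E - B)\<bar> < \<epsilon>"
        using \<epsilon> by linarith
      then have "\<bar>(sum (e h) B + infsum (e h) (E - B)) - (sum l B + infsum l (E - B))\<bar> < \<epsilon>"
        by (simp add: algebra_simps)
      then show ?case unfolding dist_real_def se sl .
    qed
  qed
qed

text \<open>A mean value theorem from right derivatives alone. Consider the last time at which w is
  below the line of slope \<epsilon> through its initial value: it exists by continuity, and the
  right derivative at that time, being less than \<epsilon>, would allow a later one unless the end
  of the interval is reached.\<close>

lemma right_derivative_nonpos_imp_le:
  fixes w :: "real \<Rightarrow> real"
  assumes T: "0 \<le> T" and cont: "continuous_on {0..T} w"
    and der: "\<And>s. 0 \<le> s \<Longrightarrow> s < T \<Longrightarrow> \<exists>d\<le>0. ((\<lambda>h. (w (s + h) - w s) / h) \<longlongrightarrow> d) (at_right 0)"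
  shows "w T \<le> w 0"
proof (rule field_le_epsilon)
  fix e :: real assume e: "e > 0"
  \<comment> \<open>The denominator T + 1 in place of T keeps the slope positive also for T =
    0.\<close>
  define \<epsilon> where "\<epsilon> = e / (T + 1)"
  have \<epsilon>: "\<epsilon> > 0" "\<epsilon> * T \<le> e" using e T by (auto simp: \<epsilon>_def divide_simps)
  define S where "S = {s \<in> {0..T}. w s - \<epsilon> * s \<le> w 0}"
  have "closed S"
    unfolding S_def by (intro continuous_on_closed_Collect_le continuous_intros cont closed_atLeastAtMost)
  have S0: "0 \<in> S" and bdd: "bdd_above S" using T by (auto simp: S_def intro!: bdd_aboveI[of _ T])
  define s where "s = Sup S"
  have s: "s \<in> S" unfolding s_def using closed_contains_Sup[OF _ bdd \<open>closed S\<close>] S0 by blast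
  have "s = T"
  proof (rule ccontr)
    assume "s \<noteq> T"
    then have sT: "0 \<le> s" "s < T" using s by (auto simp: S_def)
    obtain d where d: "d \<le> 0" "((\<lambda>h. (w (s + h) - w s) / h) \<longlongrightarrow> d) (at_right 0)"
      using der[OF sT] by blast
    have "\<forall>\<^sub>F h in at_right 0. (w (s + h) - w s) / h < \<epsilon>"
      using order_tendstoD(2)[OF d(2), of \<epsilon>] d(1) \<epsilon> by simp
    moreover have "\<forall>\<^sub>F h in at_right 0. h < T - s"
      using sT eventually_at_right_field[of "\<lambda>h. h < T - s" 0] by (auto intro!: exI[of _ "T - s"])
    moreover have "\<forall>\<^sub>F h in at_right (0::real). 0 < h" by (simp add: eventually_at_right_less)
    ultimately have "\<forall>\<^sub>F h in at_right 0. (w (s + h) - w s) / h < \<epsilon> \<and> h < T - s \<and> 0 < h"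
      by eventually_elim simp
    then obtain h where h: "(w (s + h) - w s) / h < \<epsilon>" "h < T - s" "0 < h"
      using eventually_happens' trivial_limit_at_right_real by blast
    then have "w (s + h) - w s < \<epsilon> * h" by (simp add: divide_simps)
    with h s have "s + h \<in> S" by (auto simp: S_def algebra_simps)
    then have "s + h \<le> s" unfolding s_def using bdd by (intro cSup_upper)
    with h show False by simp
  qed
  with s \<epsilon> show "w T \<le> w 0 + e" by (auto simp: S_def)
qed

section \<open>Regularity in time of a transition function\<close>

context
  fixes E :: "'e set" and P :: "real \<Rightarrow> 'e \<Rightarrow> 'e \<Rightarrow> real" and Q :: "'e \<Rightarrow> 'e \<Rightarrow> real"
  assumes tf: "transition_function E P" and gen: "has_generator E P Q"
begin

lemma trans_nonneg: "0 \<le> t \<Longrightarrow> u \<in> E \<Longrightarrow> v \<in> E \<Longrightarrow> 0 \<le> P t u v"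
  using tf unfolding transition_function_def by blast

lemma trans_has_sum: "0 \<le> t \<Longrightarrow> u \<in> E \<Longrightarrow> (P t u has_sum 1) E"
  using tf unfolding transition_function_def by blast

lemma trans_0: "u \<in> E \<Longrightarrow> v \<in> E \<Longrightarrow> P 0 u v = of_bool (u = v)"
  using tf unfolding transition_function_def by blast

lemma trans_add:
  "0 \<le> s \<Longrightarrow> 0 \<le> t \<Longrightarrow> u \<in> E \<Longrightarrow> v \<in> E \<Longrightarrow> ((\<lambda>w. P s u w * P t w v) has_sum P (s + t) u v) E"
  using tf unfolding transition_function_def by blast

lemma trans_sum_le_1:
  assumes "0 \<le> t" "u \<in> E" "finite A" "A \<subseteq> E"
  shows "sum (P t u) A \<le> 1"
  using finite_sum_le_has_sum[OF trans_has_sum[OF assms(1,2)] assms(3,4)] trans_nonneg assms by auto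

lemma trans_le_1: "0 \<le> t \<Longrightarrow> u \<in> E \<Longrightarrow> v \<in> E \<Longrightarrow> P t u v \<le> 1"
  using trans_sum_le_1[of t u "{v}"] by simp

text \<open>The function t |-> 1 - P t u u is subadditive, because staying at u at both times s and
  s + t is one way of being there at time s + t. Hence its value at t is at most n times its value
  at t/n, and n tends to infinity.\<close>

lemma trans_diag_le:
  assumes t: "0 \<le> t" and u: "u \<in> E"
  shows "1 - P t u u \<le> - Q u u * t"
proof (cases "t = 0")
  case True
  then show ?thesis using trans_0[OF u u] by simp
next
  case False
  with t have t: "t > 0" by simp
  have sub: "1 - P (real n * s) u u \<le> real n * (1 - P s u u)" if s: "0 \<le> s" for n s
  proof (induction n)
    case 0
    then show ?case using trans_0[OF u u] by simp
  next
    case (Suc n)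
    have ns: "0 \<le> real n * s" using s by simp
    have "P (real n * s) u u * P s u u \<le> P (real n * s + s) u u"
      using finite_sum_le_has_sum[OF trans_add[OF ns s u u], of "{u}"] trans_nonneg ns s u by auto
    moreover have "0 \<le> (1 - P (real n * s) u u) * (1 - P s u u)"
      using trans_le_1 ns s u by (intro mult_nonneg_nonneg) auto
    ultimately show ?case using Suc by (simp add: algebra_simps)
  qed
  have fl: "filterlim (\<lambda>n. t / real (Suc n)) (at_right 0) sequentially"
    unfolding filterlim_at
  proof
    show "(\<lambda>n. t / real (Suc n)) \<longlonglongrightarrow> 0"
      using tendsto_mult_right_zero[OF LIMSEQ_inverse_real_of_nat, of t] by (simp add: divide_inverse)
  qed (use t in simp)
  have "((\<lambda>h. (P h u u - of_bool (u = u)) / h) \<longlongrightarrow> Q u u) (at_right 0)"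
    using gen u unfolding has_generator_def by blast
  from filterlim_compose[OF this fl]
  have "(\<lambda>n. - ((P (t / real (Suc n)) u u - of_bool (u = u)) / (t / real (Suc n))) * t) \<longlonglongrightarrow> - Q u u * t"
    by (intro tendsto_intros)
  moreover have "1 - P t u u \<le> - ((P (t / real (Suc n)) u u - of_bool (u = u)) / (t / real (Suc n))) * t" for n
  proof -
    have "- ((p - of_bool (u = u)) / (t / real (Suc n))) * t = real (Suc n) * (1 - p)" for p
      using t by (simp add: field_simps)
    moreover have "real (Suc n) * (t / real (Suc n)) = t" by simp
    ultimately show ?thesis using sub[of "t / real (Suc n)" "Suc n"] t by simp
  qed
  ultimately show ?thesis by (intro LIMSEQ_le_const) auto
qed

lemma trans_diff_le:
  assumes t: "0 \<le> t" and u: "u \<in> E" and v: "v \<in> E"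
  shows "\<bar>P t u v - of_bool (u = v)\<bar> \<le> - Q u u * t"
proof (cases "u = v")
  case True
  then show ?thesis using trans_diag_le[OF t u] trans_le_1[OF t u u] by simp
next
  case False
  then show ?thesis
    using trans_diag_le[OF t u] trans_sum_le_1[OF t u, of "{u, v}"] trans_nonneg[OF t u v] u v by simp
qed

text \<open>Split according to the state at the short time h. The paths that have left u contribute
  between 0 and 1 - P h u u, and so does the mass (1 - P h u u) * P t u v lost from the others; the
  increment is the difference of the two.\<close>

lemma trans_lipschitz:
  assumes t: "0 \<le> t" and h: "0 \<le> h" and u: "u \<in> E" and v: "v \<in> E"
  shows "\<bar>P (t + h) u v - P t u v\<bar> \<le> - Q u u * h"
proof -
  have s1: "((\<lambda>w. P h u w * P t w v) has_sum P (t + h) u v) E"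
    using trans_add[OF h t u v] by (simp add: add.commute)
  then have "((\<lambda>w. P h u w * P t w v) has_sum (P (t + h) u v - P h u u * P t u v)) (E - {u})"
    using has_sum_Diff[OF s1 has_sum_finiteI[of "{u}", OF _ refl]] u by simp
  moreover have "(P h u has_sum (1 - P h u u)) (E - {u})"
    using has_sum_Diff[OF trans_has_sum[OF h u] has_sum_finiteI[of "{u}", OF _ refl]] u by simp
  ultimately have "P (t + h) u v - P h u u * P t u v \<le> 1 - P h u u"
    by (rule has_sum_mono) (use trans_le_1[OF t _ v] trans_nonneg[OF h u] in \<open>auto intro!: mult_left_le\<close>)
  moreover have "0 \<le> P (t + h) u v - P h u u * P t u v"
    using \<open>((\<lambda>w. P h u w * P t w v) has_sum (P (t + h) u v - P h u u * P t u v)) (E - {u})\<close>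
    by (rule has_sum_nonneg) (use trans_nonneg t h u v in auto)
  moreover have "0 \<le> (1 - P h u u) * P t u v" "(1 - P h u u) * P t u v \<le> 1 - P h u u"
    using trans_le_1[OF h u u] trans_le_1[OF t u v] trans_nonneg[OF t u v] by (auto intro!: mult_left_le)
  ultimately show ?thesis
    using trans_diag_le[OF h u] by (simp add: algebra_simps abs_le_iff)
qed

section \<open>Evolution of an initial measure under the transition function\<close>

definition evolve :: "('e \<Rightarrow> real) \<Rightarrow> real \<Rightarrow> 'e \<Rightarrow> real" where
  "evolve m t y = (\<Sum>\<^sub>\<infinity>x\<in>E. m x * P t x y)"

context
  fixes m :: "'e \<Rightarrow> real"
  assumes m_nonneg: "\<And>x. x \<in> E \<Longrightarrow> 0 \<le> m x" and m_sum: "m summable_on E"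
begin

lemma summable_on_trans:
  assumes t: "0 \<le> t" and f: "\<And>x. x \<in> E \<Longrightarrow> 0 \<le> f x \<and> f x \<le> (1::real)"
  shows "(\<lambda>x. m x * f x) summable_on E"
  by (rule summable_on_comparison_test[OF m_sum]) (use f m_nonneg in \<open>auto intro!: mult_left_le\<close>)

lemma summable_on_trans_pairs:
  assumes t: "0 \<le> t"
  shows "(\<lambda>(x, w). m x * P t x w) summable_on E \<times> E"
proof (rule summable_on_SigmaI[where g = m])
  show "((\<lambda>y. case (x, y) of (x, w) \<Rightarrow> m x * P t x w) has_sum m x) E" if "x \<in> E" for x
    using has_sum_cmult_right[OF trans_has_sum[OF t that], of "m x"] by simp
qed (use m_sum m_nonneg trans_nonneg t in auto)

lemma evolve_nonneg: "0 \<le> t \<Longrightarrow> y \<in> E \<Longrightarrow> 0 \<le> evolve m t y"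
  unfolding evolve_def by (intro infsum_nonneg) (simp add: m_nonneg trans_nonneg)

lemma evolve_le: "0 \<le> t \<Longrightarrow> y \<in> E \<Longrightarrow> evolve m t y \<le> infsum m E"
  unfolding evolve_def
  by (intro infsum_mono summable_on_trans m_sum) (auto intro!: mult_left_le m_nonneg trans_nonneg trans_le_1)

lemma evolve_0: "y \<in> E \<Longrightarrow> evolve m 0 y = m y"
  unfolding evolve_def
  by (rule infsumI, rule has_sum_finite_neutralI[of "{y}"]) (auto simp: trans_0)

lemma evolve_summable:
  assumes "0 \<le> t"
  shows "evolve m t summable_on E"
proof -
  have "(\<lambda>(w, x). m x * P t x w) summable_on E \<times> E"
    using summable_on_trans_pairs[OF assms] by (subst summable_on_swap) (simp add: case_prod_unfold)
  then have "(\<lambda>w. \<Sum>\<^sub>\<infinity>x\<in>E. m x * P t x w) summable_on E"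
    by (rule summable_on_Sigma_banach)
  then show ?thesis by (simp add: evolve_def[abs_def])
qed

lemma evolve_add:
  assumes s: "0 \<le> s" and t: "0 \<le> t" and y: "y \<in> E"
  shows "evolve m (s + t) y = (\<Sum>\<^sub>\<infinity>w\<in>E. evolve m s w * P t w y)"
proof -
  have sp: "(\<lambda>(x, w). m x * P s x w * P t w y) summable_on E \<times> E"
    by (rule summable_on_comparison_test[OF summable_on_trans_pairs[OF s]])
      (use m_nonneg trans_nonneg trans_le_1 s t y in \<open>auto intro!: mult_left_le mult_nonneg_nonneg\<close>)
  have "evolve m (s + t) y = (\<Sum>\<^sub>\<infinity>x\<in>E. \<Sum>\<^sub>\<infinity>w\<in>E. m x * P s x w * P t w y)"
    unfolding evolve_def
    using has_sum_cmult_right[OF trans_add[OF s t _ y]]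
    by (intro infsum_cong infsumI[symmetric]) (simp add: mult.assoc)
  also have "\<dots> = (\<Sum>\<^sub>\<infinity>w\<in>E. \<Sum>\<^sub>\<infinity>x\<in>E. m x * P s x w * P t w y)"
    by (rule infsum_swap_banach[OF sp])
  also have "\<dots> = (\<Sum>\<^sub>\<infinity>w\<in>E. evolve m s w * P t w y)"
    unfolding evolve_def by (intro infsum_cong infsum_cmult_left') 
  finally show ?thesis .
qed

text \<open>The difference quotients of the entries are bounded by q, so m x * q dominates and the
  derivative may be taken under the sum. The set A contains every state with a nonzero rate into y,
  which makes the limit a finite sum.\<close>

lemma evolve_right_derivative_0:
  assumes q: "\<And>x. x \<in> E \<Longrightarrow> - Q x x \<le> q" and y: "y \<in> E"
    and A: "finite A" "A \<subseteq> E" "\<And>x. x \<in> E - A \<Longrightarrow> Q x y = 0"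
  shows "((\<lambda>h. (evolve m h y - m y) / h) \<longlongrightarrow> (\<Sum>x\<in>A. m x * Q x y)) (at_right 0)"
proof -
  let ?e = "\<lambda>h x. m x * ((P h x y - of_bool (x = y)) / h)"
  have "((\<lambda>h. infsum (?e h) E) \<longlongrightarrow> infsum (\<lambda>x. m x * Q x y) E) (at_right 0)"
  proof (rule infsum_dominated_convergence[where g = "\<lambda>x. m x * q"])
    show "(\<lambda>x. m x * q) summable_on E" using m_sum by (rule summable_on_cmult_left)
    have "\<forall>\<^sub>F h in at_right (0::real). 0 < h" by (simp add: eventually_at_right_less)
    then show "\<forall>\<^sub>F h in at_right 0. \<forall>x\<in>E. \<bar>?e h x\<bar> \<le> m x * q"
    proof eventually_elim
      case (elim h)
      show ?case
      proof
        fix x assume x: "x \<in> E"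
        have "\<bar>P h x y - of_bool (x = y)\<bar> \<le> q * h"
          using trans_diff_le[of h x y] q[OF x] x y elim
          by (meson less_imp_le mult_right_mono order_trans)
        then have "\<bar>(P h x y - of_bool (x = y)) / h\<bar> \<le> q" using elim by (simp add: divide_simps)
        then show "\<bar>?e h x\<bar> \<le> m x * q"
          unfolding abs_mult abs_of_nonneg[OF m_nonneg[OF x]] by (rule mult_left_mono[OF _ m_nonneg[OF x]])
      qed
    qed
    show "((\<lambda>h. ?e h x) \<longlongrightarrow> m x * Q x y) (at_right 0)" if "x \<in> E" for x
      using gen that y unfolding has_generator_def by (intro tendsto_intros) blast
  qed (rule trivial_limit_at_right_real)
  also have "infsum (\<lambda>x. m x * Q x y) E = (\<Sum>x\<in>A. m x * Q x y)"
    using A by (intro infsumI has_sum_finite_neutralI) auto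
  finally have "((\<lambda>h. infsum (?e h) E) \<longlongrightarrow> (\<Sum>x\<in>A. m x * Q x y)) (at_right 0)" .
  moreover have "\<forall>\<^sub>F h in at_right (0::real). 0 < h" by (simp add: eventually_at_right_less)
  then have "\<forall>\<^sub>F h in at_right 0. infsum (?e h) E = (evolve m h y - m y) / h"
  proof eventually_elim
    case (elim h)
    have "((\<lambda>x. m x * P h x y) has_sum evolve m h y) E"
      unfolding evolve_def
      using summable_on_trans[of h "\<lambda>x. P h x y"] trans_nonneg[of h _ y] trans_le_1[of h _ y] y elim by simp
    moreover have "((\<lambda>x. m x * of_bool (x = y)) has_sum m y) E"
      using y by (intro has_sum_finite_neutralI[of "{y}"]) auto
    ultimately have "((\<lambda>x. inverse h * (m x * P h x y - m x * of_bool (x = y))) has_sum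
        (inverse h * (evolve m h y - m y))) E"
      by (intro has_sum_cmult_right has_sum_diff)
    then show ?case by (intro infsumI) (simp add: divide_inverse algebra_simps)
  qed
  ultimately show ?thesis by (rule Lim_transform_eventually)
qed

end

text \<open>By the semigroup property, time t is time 0 of the evolution started from
  \<open>evolve m t\<close>.\<close>

lemma evolve_right_derivative:
  assumes m: "\<And>x. x \<in> E \<Longrightarrow> 0 \<le> m x" "m summable_on E"
    and q: "\<And>x. x \<in> E \<Longrightarrow> - Q x x \<le> q" and y: "y \<in> E"
    and A: "finite A" "A \<subseteq> E" "\<And>x. x \<in> E - A \<Longrightarrow> Q x y = 0" and t: "0 \<le> t"
  shows "((\<lambda>h. (evolve m (t + h) y - evolve m t y) / h) \<longlongrightarrow> (\<Sum>x\<in>A. evolve m t x * Q x y)) (at_right 0)"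
proof -
  have "((\<lambda>h. (evolve (evolve m t) h y - evolve m t y) / h) \<longlongrightarrow> (\<Sum>x\<in>A. evolve m t x * Q x y)) (at_right 0)"
    using evolve_right_derivative_0[OF evolve_nonneg[OF m t] evolve_summable[OF m t] q y A] .
  moreover have "\<forall>\<^sub>F h in at_right (0::real). 0 < h" by (simp add: eventually_at_right_less)
  then have "\<forall>\<^sub>F h in at_right 0. (evolve (evolve m t) h y - evolve m t y) / h
      = (evolve m (t + h) y - evolve m t y) / h"
  proof eventually_elim
    case (elim h)
    then show ?case using evolve_add[OF m t _ y, of h] by (simp add: evolve_def[of "evolve m t"])
  qed
  ultimately show ?thesis by (rule Lim_transform_eventually)
qed

text \<open>The entries are Lipschitz in time with a constant at most q, hence the law is Lipschitz
  with constant q times the total mass.\<close>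

lemma evolve_continuous:
  assumes m: "\<And>x. x \<in> E \<Longrightarrow> 0 \<le> m x" "m summable_on E"
    and q: "\<And>x. x \<in> E \<Longrightarrow> - Q x x \<le> q" and y: "y \<in> E"
  shows "continuous_on {0..T} (\<lambda>t. evolve m t y)"
proof -
  have sm: "(\<lambda>x. m x * P t x y) summable_on E" if "0 \<le> t" for t
    using that y by (intro summable_on_trans[OF m that]) (auto intro: trans_nonneg trans_le_1)
  have *: "\<bar>evolve m (t + h) y - evolve m t y\<bar> \<le> infsum m E * q * h" if t: "0 \<le> t" and h: "0 \<le> h" for t h
  proof -
    have le: "norm (m x * P (t + h) x y - m x * P t x y) \<le> m x * (q * h)" if x: "x \<in> E" for x
    proof -
      have "\<bar>P (t + h) x y - P t x y\<bar> \<le> q * h"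
        using trans_lipschitz[OF t h x y] mult_right_mono[OF q[OF x] h] by simp
      then show ?thesis
        using m(1)[OF x] by (simp add: right_diff_distrib[symmetric] abs_mult mult_left_mono)
    qed
    have s: "(\<lambda>x. norm (m x * P (t + h) x y - m x * P t x y)) summable_on E"
      by (rule summable_on_comparison_test[OF summable_on_cmult_left[OF m(2), of "q * h"]]) (use le in auto)
    have "norm (evolve m (t + h) y - evolve m t y) = norm (infsum (\<lambda>x. m x * P (t + h) x y - m x * P t x y) E)"
      unfolding evolve_def using t h
      by (intro arg_cong[where f = norm] infsumI[symmetric] has_sum_diff has_sum_infsum sm) auto
    also have "\<dots> \<le> infsum (\<lambda>x. norm (m x * P (t + h) x y - m x * P t x y)) E"
      by (rule norm_infsum_bound[OF s])
    also have "\<dots> \<le> infsum (\<lambda>x. m x * (q * h)) E"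
      by (rule infsum_mono[OF s summable_on_cmult_left[OF m(2)] le])
    also have "\<dots> = infsum m E * q * h" by (simp add: infsum_cmult_left' mult.assoc)
    finally show ?thesis by simp
  qed
  have q0: "0 \<le> q" using q[OF y] trans_diag_le[of 1 y] trans_le_1[of 1 y y] y by simp
  have "(infsum m E * q)-lipschitz_on {0..T} (\<lambda>t. evolve m t y)"
  proof (rule lipschitz_onI)
    fix a b assume ab: "a \<in> {0..T}" "b \<in> {0..T}"
    show "dist (evolve m a y) (evolve m b y) \<le> infsum m E * q * dist a b"
    proof (cases "a \<le> b")
      case True
      then show ?thesis using *[of a "b - a"] ab by (simp add: dist_real_def abs_minus_commute)
    next
      case False
      then show ?thesis using *[of b "a - b"] ab by (simp add: dist_real_def)
    qed
  qed (use q0 m in \<open>auto intro!: mult_nonneg_nonneg infsum_nonneg\<close>)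
  then show ?thesis by (rule lipschitz_on_continuous_on)
qed

text \<open>Bounded column sums make the forward equation a linear ODE with bounded operator for the
  supremum norm, so Picard iteration of the difference of two bounded solutions gives uniqueness.\<close>

theorem forward_equation_unique:
  assumes m: "\<And>x. x \<in> E \<Longrightarrow> 0 \<le> m x" "m summable_on E"
    and q: "\<And>x. x \<in> E \<Longrightarrow> - Q x x \<le> q"
    and A: "\<And>y. y \<in> E \<Longrightarrow> finite (A y)" "\<And>y. y \<in> E \<Longrightarrow> A y \<subseteq> E"
      "\<And>x y. y \<in> E \<Longrightarrow> x \<in> E - A y \<Longrightarrow> Q x y = 0"
    and K: "\<And>y. y \<in> E \<Longrightarrow> (\<Sum>x\<in>A y. \<bar>Q x y\<bar>) \<le> K"
    and g0: "\<And>y. y \<in> E \<Longrightarrow> g 0 y = m y"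
    and gB: "\<And>t y. 0 \<le> t \<Longrightarrow> y \<in> E \<Longrightarrow> \<bar>g t y\<bar> \<le> B"
    and g': "\<And>t y. 0 \<le> t \<Longrightarrow> y \<in> E \<Longrightarrow> ((\<lambda>t. g t y) has_real_derivative (\<Sum>x\<in>A y. g t x * Q x y)) (at t)"
    and t: "0 \<le> t" and y: "y \<in> E"
  shows "evolve m t y = g t y"
proof -
  define D where "D = (\<lambda>t y. evolve m t y - g t y)"
  define C where "C = infsum m E + B"
  \<comment> \<open>The Picard bounds for the difference D: C bounds both solutions together, and
    the next bound is the integral of K times the previous one. They are the terms of an exponential
    series, so they tend to 0.\<close>
  define \<phi> where "\<phi> = (\<lambda>n t. C * (K * t) ^ n / fact n)"
  have K0: "0 \<le> K" using K[OF y] by (meson abs_ge_zero order_trans sum_nonneg)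
  have D0: "D 0 y = 0" if "y \<in> E" for y using that evolve_0[OF m] g0 by (simp add: D_def)
  have D': "((\<lambda>h. (D (t + h) y - D t y) / h) \<longlongrightarrow> (\<Sum>x\<in>A y. D t x * Q x y)) (at_right 0)"
    if "0 \<le> t" "y \<in> E" for t y
  proof -
    have "((\<lambda>h. (g (t + h) y - g t y) / h) \<longlongrightarrow> (\<Sum>x\<in>A y. g t x * Q x y)) (at_right 0)"
      using g'[OF that] unfolding DERIV_def by (rule tendsto_mono[rotated]) (simp add: at_le)
    from tendsto_diff[OF evolve_right_derivative[OF m q that(2) A(1-3)[OF that(2)] that(1)] this]
    show ?thesis
      by (simp add: D_def diff_divide_distrib[symmetric] sum_subtractf[symmetric] algebra_simps)
  qed
  have Dcont: "continuous_on {0..T} (\<lambda>t. D t y)" if "y \<in> E" for y T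
  proof -
    have "continuous_on {0..T} (\<lambda>t. g t y)"
      using g'[OF _ that] by (intro continuous_at_imp_continuous_on ballI) (auto intro: DERIV_isCont)
    then show ?thesis unfolding D_def by (intro continuous_intros evolve_continuous[OF m q that])
  qed
  have \<phi>': "((\<lambda>t. \<phi> (Suc n) t) has_real_derivative K * \<phi> n t) (at t)" for n t
    unfolding \<phi>_def by (rule derivative_eq_intros refl | simp add: field_simps del: of_nat_Suc)+
  have bound: "\<bar>D t y\<bar> \<le> \<phi> n t" if "0 \<le> t" "y \<in> E" for n t y
    using that
  proof (induction n arbitrary: t y)
    case 0
    then show ?case
      using gB[of t y] evolve_le[OF m, of t y] evolve_nonneg[OF m, of t y]
      by (simp add: \<phi>_def C_def D_def abs_le_iff)
  next
    case (Suc n)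
    \<comment> \<open>The comparison lemma is one-sided, so D and - D are treated separately through
      the sign \<sigma>.\<close>
    have *: "\<sigma> * D t y \<le> \<phi> (Suc n) t" if \<sigma>: "\<sigma> = 1 \<or> \<sigma> = - 1" for \<sigma> :: real
    proof -
      have "\<sigma> * D t y - \<phi> (Suc n) t \<le> \<sigma> * D 0 y - \<phi> (Suc n) 0"
      proof (rule right_derivative_nonpos_imp_le[OF Suc.prems(1)])
        show "continuous_on {0..t} (\<lambda>t. \<sigma> * D t y - \<phi> (Suc n) t)"
          unfolding \<phi>_def using Dcont[OF Suc.prems(2)] by (intro continuous_intros) auto
        fix s assume s: "0 \<le> s" "s < t"
        have "((\<lambda>h. (\<phi> (Suc n) (s + h) - \<phi> (Suc n) s) / h) \<longlongrightarrow> K * \<phi> n s) (at_right 0)"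
          using \<phi>'[of n s] unfolding DERIV_def by (rule tendsto_mono[rotated]) (simp add: at_le)
        from tendsto_diff[OF tendsto_mult_left[OF D'[OF s(1) Suc.prems(2)], of \<sigma>] this]
        have lim: "((\<lambda>h. ((\<sigma> * D (s + h) y - \<phi> (Suc n) (s + h)) - (\<sigma> * D s y - \<phi> (Suc n) s)) / h)
            \<longlongrightarrow> \<sigma> * (\<Sum>x\<in>A y. D s x * Q x y) - K * \<phi> n s) (at_right 0)"
          by (simp add: diff_divide_distrib add_divide_distrib algebra_simps)
        have "\<bar>\<Sum>x\<in>A y. D s x * Q x y\<bar> \<le> (\<Sum>x\<in>A y. \<bar>D s x * Q x y\<bar>)" by (rule sum_abs)
        also have "\<dots> \<le> (\<Sum>x\<in>A y. \<phi> n s * \<bar>Q x y\<bar>)"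
          unfolding abs_mult using A(2)[OF Suc.prems(2)] Suc.IH[OF s(1)]
          by (intro sum_mono mult_right_mono) auto
        also have "\<dots> \<le> \<phi> n s * K"
          unfolding sum_distrib_left[symmetric]
          using K[OF Suc.prems(2)] Suc.IH[OF s(1) Suc.prems(2)] by (intro mult_left_mono) auto
        finally have "\<sigma> * (\<Sum>x\<in>A y. D s x * Q x y) - K * \<phi> n s \<le> 0"
          using \<sigma> by (auto simp: mult.commute)
        with lim show "\<exists>d\<le>0. ((\<lambda>h. ((\<sigma> * D (s + h) y - \<phi> (Suc n) (s + h)) - (\<sigma> * D s y - \<phi> (Suc n) s)) / h)
            \<longlongrightarrow> d) (at_right 0)" by blast
      qed
      then show ?thesis using D0[OF Suc.prems(2)] by (simp add: \<phi>_def)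
    qed
    from *[of 1] *[of "-1"] show ?case by (simp add: abs_le_iff)
  qed
  have "(\<lambda>n. C * ((K * t) ^ n / fact n)) \<longlonglongrightarrow> C * 0"
    using summable_LIMSEQ_zero[OF summable_exp[of "K * t"]]
    by (intro tendsto_mult_left) (simp add: divide_inverse mult.commute)
  then have "(\<lambda>n. \<phi> n t) \<longlonglongrightarrow> 0" by (simp add: \<phi>_def)
  then have "\<bar>D t y\<bar> \<le> 0" using bound[OF t y] by (intro LIMSEQ_le_const) auto
  then show ?thesis by (simp add: D_def)
qed

end

section \<open>Quasi-reversibility of the queue\<close>

text \<open>A jump rate is a sum over the letters that lead to a given target; summed over all
  targets, each letter counts once.\<close>

lemma sum_fiber:
  fixes g :: "'b \<Rightarrow> real"
  assumes "finite V" "finite B" "\<phi> ` B \<subseteq> V"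
  shows "(\<Sum>v\<in>V. \<Sum>b\<in>{b \<in> B. v = \<phi> b}. g b) = sum g B"
  using sum.group[OF assms(2,1,3), of g] by (simp add: eq_commute)

locale queue_data = zero_automatic X \<Sigma> for X :: "'x monoid" and \<Sigma> :: "'x set" +
  fixes \<nu> :: "'x pmf" and lam \<mu> \<rho> :: real and r :: "'x \<Rightarrow> real"
  assumes nu_sub: "set_pmf \<nu> \<subseteq> \<Sigma>" and lam_pos: "lam > 0" and mu_pos: "\<mu> > 0"
    and adm: "admissible_solution X \<Sigma> \<nu> lam \<mu> \<rho> r"
begin

abbreviation "L \<equiv> queue_words X \<Sigma>"
abbreviation "N \<equiv> next_gens X \<Sigma>"
abbreviation "rN a \<equiv> sum r (N a)"
abbreviation "arr \<equiv> arrival_rate X \<Sigma> \<nu> r lam"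
abbreviation "serv \<equiv> service_rate \<mu>"
abbreviation "R w u \<equiv> arr w u + serv w u"

lemma rho_pos: "\<rho> > 0" and r_pos: "a \<in> \<Sigma> \<Longrightarrow> r a > 0" and r_sum: "sum r \<Sigma> = 1"
  using adm by (auto simp: admissible_solution_def open_simplex_def)

lemma nu_sum: "sum (pmf \<nu>) \<Sigma> = 1"
  using sum_pmf_eq_1[OF finite_gens nu_sub] .

lemma N_sub: "N a \<subseteq> \<Sigma>" by (auto simp: next_gens_def)

lemma finite_N [simp]: "finite (N a)" using finite_gens N_sub finite_subset by blast

lemma N_sym: "a \<in> \<Sigma> \<Longrightarrow> b \<in> \<Sigma> \<Longrightarrow> b \<in> N a \<longleftrightarrow> a \<in> N b"
  using gens_mult_sym[of a b] gens_mult_sym[of b a] by (auto simp: next_gens_def)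

text \<open>Arrivals multiply the back letter from the left, so this is the form in which Next
  enters the jump rates.\<close>

lemma N_left: "a \<in> \<Sigma> \<Longrightarrow> N a = {b \<in> \<Sigma>. b \<otimes>\<^bsub>X\<^esub> a \<notin> \<Sigma> \<union> {\<one>\<^bsub>X\<^esub>}}"
  using N_sub N_sym by (auto simp: next_gens_def)

lemma rN_nonneg: "0 \<le> rN a"
  using N_sub r_pos by (intro sum_nonneg) (auto intro: less_imp_le)

lemma A_nonneg: "0 \<le> traffic_A X \<Sigma> \<nu> r"
  unfolding traffic_A_def by (intro sum_nonneg mult_nonneg_nonneg rN_nonneg) auto

lemma C_nonneg: "0 \<le> traffic_C X \<Sigma> \<nu> r"
  unfolding traffic_C_def using less_imp_le[OF r_pos] by (intro sum_nonneg) (auto intro!: mult_nonneg_nonneg)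

lemma rho_eq: "\<rho> * (\<mu> + lam * traffic_C X \<Sigma> \<nu> r) = lam * traffic_A X \<Sigma> \<nu> r"
proof -
  have "\<mu> + lam * traffic_C X \<Sigma> \<nu> r > 0" using mu_pos lam_pos C_nonneg by (simp add: add_pos_nonneg)
  then show ?thesis using adm by (simp add: admissible_solution_def)
qed

text \<open>Since \<rho> > 0, the formula for \<rho> excludes A(r) = 0, so some r(Next(a)) is
  nonzero and that Next is nonempty.\<close>

lemma N_nonempty: "a \<in> \<Sigma> \<Longrightarrow> N a \<noteq> {}"
proof -
  have "traffic_A X \<Sigma> \<nu> r \<noteq> 0" using adm rho_pos by (auto simp: admissible_solution_def)
  moreover have "traffic_A X \<Sigma> \<nu> r = 0" if "\<forall>a\<in>\<Sigma>. rN a = 0"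
    unfolding traffic_A_def using that by (intro sum.neutral) simp
  ultimately obtain a0 where "a0 \<in> \<Sigma>" "rN a0 \<noteq> 0" by blast
  moreover from this have "N a0 \<noteq> {}" by (metis sum.empty)
  ultimately show "a \<in> \<Sigma> \<Longrightarrow> N a \<noteq> {}" using next_gens_nonempty[of a0 a] by blast
qed

lemma rN_pos: "a \<in> \<Sigma> \<Longrightarrow> 0 < rN a"
  using N_sub N_nonempty r_pos by (intro sum_pos) auto

subsection \<open>Queue words\<close>

lemma L_Nil [simp]: "[] \<in> L" by (simp add: queue_words_def)

lemma L_single [simp]: "[a] \<in> L \<longleftrightarrow> a \<in> \<Sigma>" by (simp add: queue_words_def)

lemma L_lists: "u \<in> L \<Longrightarrow> set u \<subseteq> \<Sigma>" by (auto simp: queue_words_def)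

lemma L_Cons: "a # b # w \<in> L \<longleftrightarrow> a \<in> \<Sigma> \<and> b \<in> N a \<and> b # w \<in> L"
proof -
  have "(\<forall>i. Suc i < length (a # b # w) \<longrightarrow> (a # b # w) ! i \<otimes>\<^bsub>X\<^esub> (a # b # w) ! Suc i \<notin> \<Sigma> \<union> {\<one>\<^bsub>X\<^esub>})
    \<longleftrightarrow> a \<otimes>\<^bsub>X\<^esub> b \<notin> \<Sigma> \<union> {\<one>\<^bsub>X\<^esub>} \<and> (\<forall>i. Suc i < length (b # w) \<longrightarrow> (b # w) ! i \<otimes>\<^bsub>X\<^esub> (b # w) ! Suc i \<notin> \<Sigma> \<union> {\<one>\<^bsub>X\<^esub>})"
    (is "(\<forall>i. ?P i) \<longleftrightarrow> _")
  proof -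
    have "(\<forall>i. ?P i) \<longleftrightarrow> ?P 0 \<and> (\<forall>i. ?P (Suc i))" by (metis not0_implies_Suc)
    then show ?thesis by simp
  qed
  then show ?thesis by (auto simp: queue_words_def next_gens_def)
qed

lemma L_tl: "u \<in> L \<Longrightarrow> tl u \<in> L"
  by (cases u; cases "tl u") (auto simp: L_Cons)

lemma L_snoc: "u \<noteq> [] \<Longrightarrow> u @ [d] \<in> L \<longleftrightarrow> u \<in> L \<and> d \<in> N (last u)"
proof (induction u rule: induct_list012)
  case (2 a)
  then show ?case using L_Cons[of a d "[]"] N_sub by auto
next
  case (3 a b w)
  then show ?case by (auto simp: L_Cons)
qed simp

lemma L_snocD: "u @ [d] \<in> L \<Longrightarrow> u \<in> L \<and> d \<in> \<Sigma>"
  using L_snoc[of u d] N_sub by (cases "u = []") auto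

lemma countable_L: "countable L"
  by (rule countable_subset[of _ "lists \<Sigma>"]) (auto simp: queue_words_def intro: countable_finite finite_gens)

text \<open>A finite exhaustion of the state space. A jump changes the length by at most one, so the
  words that u jumps to or is reached from lie in \<open>Lle (Suc (length u))\<close>, and the sums
  over all words become finite.\<close>

definition Lle :: "nat \<Rightarrow> 'x list set" where
  "Lle n = {w \<in> L. length w \<le> n}"

lemma finite_Lle [simp]: "finite (Lle n)"
  by (rule finite_subset[OF _ finite_lists_length_le[OF finite_gens, of n]]) (auto simp: Lle_def dest: L_lists)

lemma Lle_sub: "Lle n \<subseteq> L" by (auto simp: Lle_def)

lemma Lle_mono: "n \<le> m \<Longrightarrow> Lle n \<subseteq> Lle m" by (auto simp: Lle_def)

lemma arr_nonneg: "0 \<le> arr w u"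
proof (cases w)
  case Nil
  then show ?thesis using lam_pos rN_nonneg by (auto intro!: sum_nonneg)
next
  case (Cons a w')
  then show ?thesis using lam_pos by (auto intro!: add_nonneg_nonneg sum_nonneg)
qed

lemma R_nonneg: "0 \<le> serv w u" "0 \<le> R w u"
  using arr_nonneg[of w u] mu_pos by (auto simp: service_rate_def)

lemma arr_nonzeroE:
  assumes "arr w u \<noteq> 0"
  obtains (start) a where "w = []" "u = [a]" "a \<in> \<Sigma>"
    | (push) a w' b where "w = a # w'" "b \<in> N a" "u = b # a # w'"
    | (change) a w' b where "w = a # w'" "b \<in> \<Sigma>" "b \<otimes>\<^bsub>X\<^esub> a \<in> \<Sigma>" "b \<otimes>\<^bsub>X\<^esub> a \<noteq> a" "u = (b \<otimes>\<^bsub>X\<^esub> a) # w'"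
    | (cancel) a w' b where "w = a # w'" "b \<in> \<Sigma>" "b \<otimes>\<^bsub>X\<^esub> a = \<one>\<^bsub>X\<^esub>" "u = w'"
proof (cases w)
  case Nil
  with assms have "{a \<in> \<Sigma>. u = [a]} \<noteq> {}" by (auto simp del: Collect_empty_eq) 
  then show ?thesis using Nil start by blast
next
  case (Cons a w')
  have "{b \<in> N a. u = b # a # w'} \<noteq> {} \<or> {b \<in> \<Sigma>. b \<otimes>\<^bsub>X\<^esub> a \<in> \<Sigma> \<and> b \<otimes>\<^bsub>X\<^esub> a \<noteq> a \<and> u = (b \<otimes>\<^bsub>X\<^esub> a) # w'} \<noteq> {}
    \<or> {b \<in> \<Sigma>. b \<otimes>\<^bsub>X\<^esub> a = \<one>\<^bsub>X\<^esub> \<and> u = w'} \<noteq> {}"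
  proof (rule ccontr)
    assume "\<not> ?thesis"
    then have "{b \<in> N a. u = b # a # w'} = {}" "{b \<in> \<Sigma>. b \<otimes>\<^bsub>X\<^esub> a \<in> \<Sigma> \<and> b \<otimes>\<^bsub>X\<^esub> a \<noteq> a \<and> u = (b \<otimes>\<^bsub>X\<^esub> a) # w'} = {}"
      "{b \<in> \<Sigma>. b \<otimes>\<^bsub>X\<^esub> a = \<one>\<^bsub>X\<^esub> \<and> u = w'} = {}" by blast+
    then show False using assms unfolding Cons arrival_rate.simps by (simp only: sum.empty)
  qed
  then show ?thesis using Cons push change cancel by blast
qed

lemma arr_self [simp]: "arr u u = 0"
proof (rule ccontr)
  assume "arr u u \<noteq> 0"
  then show False by (cases rule: arr_nonzeroE) auto
qed

lemma serv_self [simp]: "serv u u = 0"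
proof -
  have "u \<noteq> butlast u" if "u \<noteq> []"
    using that by (metis append_butlast_last_id append_self_conv not_Cons_self2)
  then show ?thesis by (auto simp: service_rate_def)
qed

text \<open>The letter behind the changed one must lie in Next of both the old and the new letter,
  and these sets agree by \<open>next_gens_mult\<close>.\<close>

lemma L_change: "b \<in> \<Sigma> \<Longrightarrow> a \<in> \<Sigma> \<Longrightarrow> b \<otimes>\<^bsub>X\<^esub> a \<in> \<Sigma> \<Longrightarrow> (b \<otimes>\<^bsub>X\<^esub> a) # w \<in> L \<longleftrightarrow> a # w \<in> L"
  by (cases w) (auto simp: L_Cons next_gens_mult)

lemma arr_target:
  assumes "arr w u \<noteq> 0" "w \<in> L"
  shows "u \<in> Lle (Suc (length w))"
  using assms(1)
proof (cases rule: arr_nonzeroE)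
  case (push a w' b)
  then show ?thesis using assms(2) N_sub[of a] N_sym[of a b] L_lists[OF assms(2)] by (auto simp: Lle_def L_Cons)
next
  case (change a w' b)
  then show ?thesis using assms(2) L_change L_lists[OF assms(2)] by (auto simp: Lle_def)
next
  case (cancel a w' b)
  then show ?thesis using L_tl[OF assms(2)] by (auto simp: Lle_def)
qed (use assms(2) in \<open>auto simp: Lle_def\<close>)

text \<open>The predecessors by arrival are \<open>tl u\<close> (a letter was pushed), the words
  obtained from u by changing its back letter, and those from which a back letter was cancelled.
  Their number does not grow with the length of u.\<close>

lemma arr_source:
  assumes "arr w u \<noteq> 0" "w \<in> L"
  shows "w \<in> Lle (Suc (length u))" "w \<in> insert (tl u) ((\<lambda>d. d # tl u) ` \<Sigma> \<union> (\<lambda>d. d # u) ` \<Sigma>)"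
  using assms(1) L_lists[OF assms(2)] assms(2) by (cases rule: arr_nonzeroE; auto simp: Lle_def)+

lemma serv_source:
  assumes "serv w u \<noteq> 0" "w \<in> L"
  obtains d where "w = u @ [d]" "d \<in> \<Sigma>"
proof -
  have "w \<noteq> []" "u = butlast w" using assms by (auto simp: service_rate_def split: if_splits)
  then have "w = u @ [last w]" by simp
  with assms(2) have "last w \<in> \<Sigma>" using L_snocD by metis
  with \<open>w = u @ [last w]\<close> that show thesis by blast
qed

lemma serv_snoc [simp]: "serv (u @ [d]) u = \<mu>" by (simp add: service_rate_def)

lemma serv_target:
  assumes "serv w u \<noteq> 0" "w \<in> L"
  shows "u \<in> Lle (Suc (length w))"
proof -
  obtain d where "w = u @ [d]" using serv_source[OF assms] .
  then show ?thesis using L_snocD[of u d] assms(2) by (simp add: Lle_def)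
qed

lemma R_target: "R w u \<noteq> 0 \<Longrightarrow> w \<in> L \<Longrightarrow> u \<in> Lle (Suc (length w))"
  using arr_target[of w u] serv_target[of w u] by (cases "arr w u = 0") auto

lemma serv_source_le: "serv w u \<noteq> 0 \<Longrightarrow> w \<in> L \<Longrightarrow> w \<in> Lle (Suc (length u))"
  by (erule serv_source) (auto simp: Lle_def)

subsection \<open>Exit rates\<close>

text \<open>The exit rate. An arrival b with b * \<open>hd u\<close> = \<open>hd u\<close> leaves
  the content unchanged and hence is not a jump.\<close>

definition tot :: "'x list \<Rightarrow> real" where
  "tot u = (if u = [] then lam * traffic_A X \<Sigma> \<nu> r
     else lam * (1 - (\<Sum>b\<in>{b \<in> \<Sigma>. b \<otimes>\<^bsub>X\<^esub> hd u = hd u}. pmf \<nu> b)) + \<mu>)"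

text \<open>For a nonempty word the letters split into those pushed, those changing the back letter,
  those cancelling it and those leaving it alone; their probabilities add up to 1, and only the last
  class is missing from the jumps.\<close>

lemma sum_arr:
  assumes u: "u \<in> L" and V: "finite V" "Lle (Suc (length u)) \<subseteq> V"
  shows "(\<Sum>v\<in>V. arr u v) = (if u = [] then lam * traffic_A X \<Sigma> \<nu> r
     else lam * (1 - (\<Sum>b\<in>{b \<in> \<Sigma>. b \<otimes>\<^bsub>X\<^esub> hd u = hd u}. pmf \<nu> b)))"
proof (cases u)
  case Nil
  have "(\<lambda>a. [a]) ` \<Sigma> \<subseteq> V" using V Nil by (auto simp: Lle_def)
  from sum_fiber[OF V(1) finite_gens this, of "\<lambda>a. lam * pmf \<nu> a * rN a"] Nil
  show ?thesis by (simp add: traffic_A_def sum_distrib_left mult.assoc)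
next
  case (Cons a w)
  have a: "a \<in> \<Sigma>" using L_lists[OF u] Cons by auto
  have aw: "a # w \<in> L" using u Cons by simp
  define B2 where "B2 = {b \<in> \<Sigma>. b \<otimes>\<^bsub>X\<^esub> a \<in> \<Sigma> \<and> b \<otimes>\<^bsub>X\<^esub> a \<noteq> a}"
  define B3 where "B3 = {b \<in> \<Sigma>. b \<otimes>\<^bsub>X\<^esub> a = \<one>\<^bsub>X\<^esub>}"
  define B4 where "B4 = {b \<in> \<Sigma>. b \<otimes>\<^bsub>X\<^esub> a = a}"
  have fin: "finite B2" "finite B3" "finite B4" by (auto simp: B2_def B3_def B4_def finite_gens)
  have memV: "v \<in> V" if "v \<in> L" "length v \<le> Suc (Suc (length w))" for v
    using that V(2) Cons by (auto simp: Lle_def)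
  have Na: "b \<in> \<Sigma>" "a \<in> N b" if "b \<in> N a" for b
    using that N_sub[of a] N_sym[of a b] a by auto
  have 1: "(\<Sum>v\<in>V. \<Sum>b\<in>{b \<in> N a. v = b # a # w}. lam * pmf \<nu> b) = (\<Sum>b\<in>N a. lam * pmf \<nu> b)"
    using aw Na V(1) by (intro sum_fiber) (auto intro!: memV simp: L_Cons)
  have 2: "(\<Sum>v\<in>V. \<Sum>b\<in>{b \<in> B2. v = (b \<otimes>\<^bsub>X\<^esub> a) # w}. lam * pmf \<nu> b) = (\<Sum>b\<in>B2. lam * pmf \<nu> b)"
    using aw a V(1) fin by (intro sum_fiber) (auto intro!: memV simp: B2_def L_change)
  have 3: "(\<Sum>v\<in>V. \<Sum>b\<in>{b \<in> B3. v = w}. lam * pmf \<nu> b) = (\<Sum>b\<in>B3. lam * pmf \<nu> b)"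
    using L_tl[OF aw] V(1) fin by (intro sum_fiber) (auto intro!: memV)
  have "(\<Sum>v\<in>V. arr u v) = (\<Sum>v\<in>V. \<Sum>b\<in>{b \<in> N a. v = b # a # w}. lam * pmf \<nu> b)
     + (\<Sum>v\<in>V. \<Sum>b\<in>{b \<in> B2. v = (b \<otimes>\<^bsub>X\<^esub> a) # w}. lam * pmf \<nu> b)
     + (\<Sum>v\<in>V. \<Sum>b\<in>{b \<in> B3. v = w}. lam * pmf \<nu> b)"
    unfolding sum.distrib[symmetric] Cons by (intro sum.cong refl) (simp add: B2_def B3_def conj_assoc)
  also have "\<dots> = lam * (sum (pmf \<nu>) (N a) + sum (pmf \<nu>) B2 + sum (pmf \<nu>) B3)"
    unfolding 1 2 3 by (simp add: sum_distrib_left distrib_left)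
  also have "sum (pmf \<nu>) (N a) + sum (pmf \<nu>) B2 + sum (pmf \<nu>) B3 = 1 - sum (pmf \<nu>) B4"
  proof -
    have e: "\<Sigma> = N a \<union> (B2 \<union> (B3 \<union> B4))"
      using a unfolding N_left[OF a] B2_def B3_def B4_def by blast
    have disj: "N a \<inter> (B2 \<union> (B3 \<union> B4)) = {}" "B2 \<inter> (B3 \<union> B4) = {}" "B3 \<inter> B4 = {}"
      using a one_not_gen unfolding N_left[OF a] B2_def B3_def B4_def by auto
    have "sum (pmf \<nu>) (N a \<union> (B2 \<union> (B3 \<union> B4))) = sum (pmf \<nu>) (N a) + (sum (pmf \<nu>) B2 + (sum (pmf \<nu>) B3 + sum (pmf \<nu>) B4))"
      using fin disj by (simp add: sum.union_disjoint)
    then have "sum (pmf \<nu>) \<Sigma> = sum (pmf \<nu>) (N a) + (sum (pmf \<nu>) B2 + (sum (pmf \<nu>) B3 + sum (pmf \<nu>) B4))"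
      by (simp only: e[symmetric])
    then show ?thesis using nu_sum by simp
  qed
  finally show ?thesis using Cons by (simp add: B4_def)
qed

lemma sum_serv:
  assumes u: "u \<in> L" and V: "finite V" "Lle (Suc (length u)) \<subseteq> V"
  shows "(\<Sum>v\<in>V. serv u v) = (if u = [] then 0 else \<mu>)"
proof (cases "u = []")
  case False
  have "serv u (butlast u) \<noteq> 0" using False mu_pos by (simp add: service_rate_def)
  then have "butlast u \<in> V" using serv_target[OF _ u] V(2) by blast
  then show ?thesis using False V(1) by (simp add: service_rate_def)
qed (simp add: service_rate_def)

lemma sum_R:
  assumes u: "u \<in> L" and V: "finite V" "Lle (Suc (length u)) \<subseteq> V"
  shows "(\<Sum>v\<in>V. R u v) = tot u"
  unfolding sum.distrib sum_arr[OF assms] sum_serv[OF assms] by (simp add: tot_def)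

lemma tot_nonneg: "u \<in> L \<Longrightarrow> 0 \<le> tot u"
  using sum_R[of u "Lle (Suc (length u))"] sum_nonneg[of "Lle (Suc (length u))" "R u"] R_nonneg(2) by simp

definition tmax :: real where "tmax = lam * traffic_A X \<Sigma> \<nu> r + lam + \<mu>"

lemma tot_le: "tot u \<le> tmax"
proof -
  have "lam * (1 - (\<Sum>b\<in>{b \<in> \<Sigma>. b \<otimes>\<^bsub>X\<^esub> hd u = hd u}. pmf \<nu> b)) \<le> lam"
    using lam_pos by (simp add: sum_nonneg mult_left_le)
  moreover have "0 \<le> lam * traffic_A X \<Sigma> \<nu> r" using A_nonneg lam_pos by simp
  ultimately show ?thesis
    unfolding tot_def tmax_def using lam_pos mu_pos by (split if_split, intro conjI impI, linarith+)
qed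

lemma R_le:
  assumes "u \<in> L"
  shows "R u v \<le> tmax"
proof -
  have "R u v \<le> (\<Sum>v\<in>insert v (Lle (Suc (length u))). R u v)"
    by (rule member_le_sum[where f = "R u"]) (auto simp: R_nonneg simp del: sum.insert)
  also have "\<dots> = tot u" using assms by (intro sum_R) auto
  finally show ?thesis using tot_le order_trans by blast
qed

text \<open>The count of predecessors is 1 for a push and |\<Sigma>| each for a change, a
  cancellation and a service; each rate is at most \<open>tmax\<close>. This uniform column bound is
  what \<open>forward_equation_unique\<close> asks for.\<close>

lemma sum_R_column:
  assumes u: "u \<in> L"
  shows "(\<Sum>w\<in>Lle (Suc (length u)). R w u) \<le> real (3 * card \<Sigma> + 1) * tmax"
proof -
  define Pr where "Pr = insert (tl u) ((\<lambda>d. d # tl u) ` \<Sigma> \<union> (\<lambda>d. d # u) ` \<Sigma> \<union> (\<lambda>d. u @ [d]) ` \<Sigma>)"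
  have tmax0: "0 \<le> tmax" using tot_le[of u] tot_nonneg[OF u] by simp
  have "card ((\<lambda>d. d # tl u) ` \<Sigma> \<union> (\<lambda>d. d # u) ` \<Sigma> \<union> (\<lambda>d. u @ [d]) ` \<Sigma>) \<le> 3 * card \<Sigma>"
    using card_Un_le[of "(\<lambda>d. d # tl u) ` \<Sigma> \<union> (\<lambda>d. d # u) ` \<Sigma>" "(\<lambda>d. u @ [d]) ` \<Sigma>"]
      card_Un_le[of "(\<lambda>d. d # tl u) ` \<Sigma>" "(\<lambda>d. d # u) ` \<Sigma>"]
      card_image_le[OF finite_gens, of "\<lambda>d. d # tl u"] card_image_le[OF finite_gens, of "\<lambda>d. d # u"]
      card_image_le[OF finite_gens, of "\<lambda>d. u @ [d]"] by simp
  then have "card Pr \<le> 3 * card \<Sigma> + 1"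
    unfolding Pr_def by (intro card_insert_le_m1) simp_all
  moreover have "finite Pr" by (simp add: Pr_def finite_gens)
  ultimately have c: "card (Lle (Suc (length u)) \<inter> Pr) \<le> 3 * card \<Sigma> + 1"
    by (meson card_mono inf_le2 order_trans)
  have "(\<Sum>w\<in>Lle (Suc (length u)). R w u) = (\<Sum>w\<in>Lle (Suc (length u)) \<inter> Pr. R w u)"
  proof (rule sum.mono_neutral_right)
    show "\<forall>w\<in>Lle (Suc (length u)) - Lle (Suc (length u)) \<inter> Pr. R w u = 0"
    proof
      fix w assume w: "w \<in> Lle (Suc (length u)) - Lle (Suc (length u)) \<inter> Pr"
      then have wL: "w \<in> L" "w \<notin> Pr" using Lle_sub by auto
      have "arr w u = 0" using arr_source(2)[OF _ wL(1), of u] wL(2) by (auto simp: Pr_def)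
      moreover have "serv w u = 0" using serv_source[OF _ wL(1), of u] wL(2) by (auto simp: Pr_def)
      ultimately show "R w u = 0" by simp
    qed
  qed auto
  also have "\<dots> \<le> real (card (Lle (Suc (length u)) \<inter> Pr)) * tmax"
    using R_le Lle_sub by (intro sum_bounded_above) auto
  also have "\<dots> \<le> real (3 * card \<Sigma> + 1) * tmax"
    using c tmax0 by (intro mult_right_mono) (auto simp del: of_nat_add of_nat_mult)
  finally show ?thesis .
qed

subsection \<open>The multiplicative invariant measure\<close>

definition qr :: "'x \<Rightarrow> real" where "qr a = r a / rN a"

text \<open>Left unnormalized: the stationary law supplies the factor \<open>p []\<close>, and its
  own summability replaces that of \<open>pw\<close>.\<close>

fun pw :: "'x list \<Rightarrow> real" where
  "pw [] = 1"
| "pw [a] = \<rho> * r a"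
| "pw (a # b # w) = \<rho> * qr a * pw (b # w)"

lemma pw_nonneg: "u \<in> L \<Longrightarrow> 0 \<le> pw u"
proof (induction u rule: pw.induct)
  case (2 a)
  then show ?case using rho_pos r_pos[of a] by simp
next
  case (3 a b w)
  then show ?case using rho_pos r_pos[of a] rN_nonneg[of a] by (auto simp: L_Cons qr_def)
qed simp

text \<open>A new front customer d turns the weight r(a) of the former one into qr(a) and adds
  \<rho> * r(d). Summing r(d) over Next(a) gives exactly the denominator of qr(a), and a single
  factor \<rho> remains.\<close>

lemma pw_snoc:
  "u \<in> L \<Longrightarrow> (\<Sum>d\<in>(if u = [] then \<Sigma> else N (last u)). pw (u @ [d])) = \<rho> * pw u"
proof (induction u rule: pw.induct)
  case 1
  then show ?case by (simp add: sum_distrib_left[symmetric] r_sum)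
next
  case (2 a)
  have "(\<Sum>d\<in>N a. pw ([a] @ [d])) = \<rho> * qr a * \<rho> * rN a" by (simp add: sum_distrib_left mult.assoc)
  then show ?case using rN_pos[of a] 2 by (simp add: qr_def)
next
  case (3 a b w)
  then have "(\<Sum>d\<in>N (last (b # w)). pw ((b # w) @ [d])) = \<rho> * pw (b # w)" by (auto simp: L_Cons)
  then show ?case by (simp add: sum_distrib_left[symmetric])
qed

lemma pw_service_inflow:
  assumes u: "u \<in> L" and W: "finite W" "Lle (Suc (length u)) \<subseteq> W" "W \<subseteq> L"
  shows "(\<Sum>w\<in>W. pw w * serv w u) = \<mu> * \<rho> * pw u"
proof -
  define D where "D = (if u = [] then \<Sigma> else N (last u))"
  have D: "u @ [d] \<in> L \<longleftrightarrow> d \<in> D" for d using u L_snoc[of u d] by (auto simp: D_def)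
  have "(\<Sum>w\<in>W. pw w * serv w u) = (\<Sum>w\<in>(\<lambda>d. u @ [d]) ` D. pw w * serv w u)"
  proof (rule sum.mono_neutral_right)
    show "(\<lambda>d. u @ [d]) ` D \<subseteq> W" using D W by (auto simp: Lle_def)
    show "\<forall>w\<in>W - (\<lambda>d. u @ [d]) ` D. pw w * serv w u = 0"
    proof
      fix w assume w: "w \<in> W - (\<lambda>d. u @ [d]) ` D"
      then have "w \<in> L" using W by auto
      then have "serv w u = 0" using serv_source[of w u] w D by (metis DiffE image_eqI)
      then show "pw w * serv w u = 0" by simp
    qed
  qed (use W in auto)
  also have "\<dots> = (\<Sum>d\<in>D. pw (u @ [d]) * \<mu>)" by (subst sum.reindex) (auto simp: inj_on_def)
  also have "\<dots> = \<mu> * \<rho> * pw u"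
    using pw_snoc[OF u] by (simp add: D_def sum_distrib_right[symmetric])
  finally show ?thesis .
qed

lemma sum_pairs:
  fixes f :: "'x \<Rightarrow> 'x \<Rightarrow> real"
  shows "(\<Sum>(b, d)\<in>{(b, d) \<in> \<Sigma> \<times> \<Sigma>. P b d}. f b d) = (\<Sum>d\<in>\<Sigma>. \<Sum>b\<in>{b \<in> \<Sigma>. P b d}. f b d)"
proof -
  have "(\<Sum>d\<in>\<Sigma>. \<Sum>b\<in>{b \<in> \<Sigma>. P b d}. f b d) = (\<Sum>(d, b)\<in>Sigma \<Sigma> (\<lambda>d. {b \<in> \<Sigma>. P b d}). f b d)"
    by (rule sum.Sigma) (auto simp: finite_gens)
  also have "\<dots> = (\<Sum>(b, d)\<in>{(b, d) \<in> \<Sigma> \<times> \<Sigma>. P b d}. f b d)"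
    by (rule sum.reindex_bij_witness[of _ "\<lambda>(b, d). (d, b)" "\<lambda>(d, b). (b, d)"]) auto
  finally show ?thesis by simp
qed

text \<open>Arrivals empty the queue only by cancelling a single customer, which amounts to \<rho> *
  lam * C(r). The formula for \<rho> in an admissible solution is the balance of this flow.\<close>

lemma pw_arrival_inflow_Nil:
  assumes W: "finite W" "Lle (Suc 0) \<subseteq> W" "W \<subseteq> L"
  shows "(\<Sum>w\<in>W. pw w * arr w []) = tot [] - \<mu> * \<rho>"
proof -
  have "(\<Sum>w\<in>W. pw w * arr w []) = (\<Sum>w\<in>(\<lambda>d. [d]) ` \<Sigma>. pw w * arr w [])"
  proof (rule sum.mono_neutral_right)
    show "(\<lambda>d. [d]) ` \<Sigma> \<subseteq> W" using W(2) by (auto simp: Lle_def)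
    show "\<forall>w\<in>W - (\<lambda>d. [d]) ` \<Sigma>. pw w * arr w [] = 0"
    proof
      fix w assume w: "w \<in> W - (\<lambda>d. [d]) ` \<Sigma>"
      then have "w \<in> L" using W by auto
      then have "arr w [] = 0" using arr_source(2)[of w "[]"] w by (cases "w = []") auto
      then show "pw w * arr w [] = 0" by simp
    qed
  qed (use W in auto)
  also have "\<dots> = (\<Sum>d\<in>\<Sigma>. \<Sum>b\<in>{b \<in> \<Sigma>. b \<otimes>\<^bsub>X\<^esub> d = \<one>\<^bsub>X\<^esub>}. \<rho> * lam * (pmf \<nu> b * r d))"
    by (subst sum.reindex) (auto simp: inj_on_def sum_distrib_left mult_ac intro!: sum.cong)
  also have "\<dots> = \<rho> * lam * traffic_C X \<Sigma> \<nu> r"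
    unfolding traffic_C_def sum_pairs by (simp add: sum_distrib_left)
  also have "\<dots> = tot [] - \<mu> * \<rho>" using rho_eq by (simp add: tot_def algebra_simps)
  finally show ?thesis .
qed

lemma twisted_traffic_eq:
  assumes a: "a \<in> \<Sigma>"
  shows "\<rho> * (lam + \<mu>) * r a = \<rho>\<^sup>2 * \<mu> * r a + lam * pmf \<nu> a * rN a
      + \<rho> * lam * (\<Sum>d\<in>\<Sigma>. r d * (\<Sum>b\<in>{b \<in> \<Sigma>. b \<otimes>\<^bsub>X\<^esub> d = a}. pmf \<nu> b))
      + \<rho>\<^sup>2 * lam * r a * (\<Sum>d\<in>N a. qr d * (\<Sum>b\<in>{b \<in> \<Sigma>. b \<otimes>\<^bsub>X\<^esub> d = \<one>\<^bsub>X\<^esub>}. pmf \<nu> b))"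
proof -
  have 1: "(\<Sum>(b, d)\<in>{(b, d) \<in> \<Sigma> \<times> \<Sigma>. b \<otimes>\<^bsub>X\<^esub> d = a}. pmf \<nu> b * r d)
      = (\<Sum>d\<in>\<Sigma>. r d * (\<Sum>b\<in>{b \<in> \<Sigma>. b \<otimes>\<^bsub>X\<^esub> d = a}. pmf \<nu> b))"
    unfolding sum_pairs by (simp add: sum_distrib_left mult.commute)
  have "(\<Sum>(b, d)\<in>{(b, d) \<in> \<Sigma> \<times> \<Sigma>. d \<in> N a \<and> b \<otimes>\<^bsub>X\<^esub> d = \<one>\<^bsub>X\<^esub>}. pmf \<nu> b * (r d / rN d) * r a)
      = (\<Sum>d\<in>\<Sigma>. \<Sum>b\<in>{b \<in> \<Sigma>. d \<in> N a \<and> b \<otimes>\<^bsub>X\<^esub> d = \<one>\<^bsub>X\<^esub>}. pmf \<nu> b * (r d / rN d) * r a)"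
    by (rule sum_pairs)
  also have "\<dots> = (\<Sum>d\<in>N a. \<Sum>b\<in>{b \<in> \<Sigma>. d \<in> N a \<and> b \<otimes>\<^bsub>X\<^esub> d = \<one>\<^bsub>X\<^esub>}. pmf \<nu> b * (r d / rN d) * r a)"
    using N_sub by (intro sum.mono_neutral_right finite_gens) auto
  also have "\<dots> = r a * (\<Sum>d\<in>N a. qr d * (\<Sum>b\<in>{b \<in> \<Sigma>. b \<otimes>\<^bsub>X\<^esub> d = \<one>\<^bsub>X\<^esub>}. pmf \<nu> b))"
    by (auto simp: sum_distrib_left qr_def mult_ac intro!: sum.cong)
  finally have 2: "(\<Sum>(b, d)\<in>{(b, d) \<in> \<Sigma> \<times> \<Sigma>. d \<in> N a \<and> b \<otimes>\<^bsub>X\<^esub> d = \<one>\<^bsub>X\<^esub>}. pmf \<nu> b * (r d / rN d) * r a)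
      = r a * (\<Sum>d\<in>N a. qr d * (\<Sum>b\<in>{b \<in> \<Sigma>. b \<otimes>\<^bsub>X\<^esub> d = \<one>\<^bsub>X\<^esub>}. pmf \<nu> b))" .
  have "twisted_traffic X \<Sigma> \<nu> lam \<mu> \<rho> r" using adm unfolding admissible_solution_def by blast
  from bspec[OF this[unfolded twisted_traffic_def] a] show ?thesis
    unfolding 1 2 by (simp only: mult.assoc)
qed

text \<open>The inflows are pushes from \<open>w0\<close>, changes from \<open>d # w0\<close> and
  cancellations from \<open>d # a # w0\<close>. Up to a common factor they are the last three terms
  of the Twisted Traffic Equation at a; its term with \<rho>^2 * \<mu> is the inflow by services,
  which is absent here and appears as - \<mu> * \<rho>.\<close>

lemma pw_arrival_inflow_Cons:
  assumes u: "a # w0 \<in> L"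
    and W: "finite W" "Lle (Suc (length (a # w0))) \<subseteq> W" "W \<subseteq> L"
  shows "(\<Sum>w\<in>W. pw w * arr w (a # w0)) = (tot (a # w0) - \<mu> * \<rho>) * pw (a # w0)"
proof -
  let ?u = "a # w0"
  have a: "a \<in> \<Sigma>" using L_lists[OF u] by auto
  have w0: "w0 \<in> L" using L_tl[OF u] by simp
  define T where "T d = (\<Sum>b\<in>{b \<in> \<Sigma>. b \<otimes>\<^bsub>X\<^esub> d = a}. pmf \<nu> b)" for d
  define Cn where "Cn d = (\<Sum>b\<in>{b \<in> \<Sigma>. b \<otimes>\<^bsub>X\<^esub> d = \<one>\<^bsub>X\<^esub>}. pmf \<nu> b)" for d
  \<comment> \<open>The part of the weight contributed by \<open>w0\<close> once the dependence on
    the back letter is removed: \<open>w0\<close> has weight k * r(Next(a)), with k = 1 if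
    \<open>w0\<close> is empty, and every word \<open>d # w0\<close> that an arrival can change into
    the given one has weight k * \<rho> * r(d).\<close>
  define k where "k = pw ?u / (\<rho> * r a)"
  have ra: "r a > 0" "rN a > 0" using a r_pos rN_pos by auto
  have pwu: "pw ?u = k * \<rho> * r a" using ra rho_pos by (simp add: k_def)
  have pw0: "pw w0 = k * rN a" if "w0 \<noteq> []"
    using that ra rho_pos unfolding k_def by (cases w0) (simp_all add: qr_def)
  have arr1: "pw w0 * arr w0 ?u = k * lam * pmf \<nu> a * rN a"
  proof (cases w0)
    case Nil
    have "{x \<in> \<Sigma>. [a] = [x]} = {a}" using a by auto
    moreover have "k = 1" using Nil ra rho_pos by (simp add: k_def)
    ultimately show ?thesis using Nil by simp
  next
    case (Cons c w')
    have "a \<in> N c" using u Cons N_sym[of a c] a L_lists[OF u] by (auto simp: L_Cons)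
    then have "{b \<in> N c. ?u = b # c # w'} = {a}" using Cons by auto
    moreover have "{b \<in> \<Sigma>. b \<otimes>\<^bsub>X\<^esub> c \<in> \<Sigma> \<and> b \<otimes>\<^bsub>X\<^esub> c \<noteq> c \<and> ?u = (b \<otimes>\<^bsub>X\<^esub> c) # w'} = {}"
      using Cons by auto
    moreover have "{b \<in> \<Sigma>. b \<otimes>\<^bsub>X\<^esub> c = \<one>\<^bsub>X\<^esub> \<and> ?u = w'} = {}"
      using Cons by (auto dest: arg_cong[where f = length])
    ultimately have "arr w0 ?u = lam * pmf \<nu> a"
      using Cons arrival_rate.simps(2)[of X \<Sigma> \<nu> r lam c w' ?u] by simp
    then show ?thesis using pw0 Cons by simp
  qed
  \<comment> \<open>The term d = a is missing because such an arrival is no jump. The same amount is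
    missing from \<open>tot\<close>, so the two cancel at the end.\<close>
  have arr2: "arr (d # w0) ?u = lam * (if d = a then 0 else T d)" if d: "d \<in> \<Sigma>" for d
  proof -
    have "{b \<in> N d. ?u = b # d # w0} = {}" "{b \<in> \<Sigma>. b \<otimes>\<^bsub>X\<^esub> d = \<one>\<^bsub>X\<^esub> \<and> ?u = w0} = {}"
      by (auto dest: arg_cong[where f = length])
    moreover have "{b \<in> \<Sigma>. b \<otimes>\<^bsub>X\<^esub> d \<in> \<Sigma> \<and> b \<otimes>\<^bsub>X\<^esub> d \<noteq> d \<and> ?u = (b \<otimes>\<^bsub>X\<^esub> d) # w0}
        = (if d = a then {} else {b \<in> \<Sigma>. b \<otimes>\<^bsub>X\<^esub> d = a})" using a by auto
    ultimately show ?thesis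
      using arrival_rate.simps(2)[of X \<Sigma> \<nu> r lam d w0 ?u] by (simp add: T_def sum_distrib_left)
  qed
  have arr3: "arr (d # ?u) ?u = lam * Cn d" for d
  proof -
    have "{b \<in> N d. ?u = b # d # ?u} = {}"
      "{b \<in> \<Sigma>. b \<otimes>\<^bsub>X\<^esub> d \<in> \<Sigma> \<and> b \<otimes>\<^bsub>X\<^esub> d \<noteq> d \<and> ?u = (b \<otimes>\<^bsub>X\<^esub> d) # ?u} = {}"
      by (auto dest: arg_cong[where f = length])
    then show ?thesis
      using arrival_rate.simps(2)[of X \<Sigma> \<nu> r lam d ?u ?u] by (simp add: Cn_def sum_distrib_left)
  qed
  have pw2: "pw (d # w0) * T d = k * \<rho> * (r d * T d)" if d: "d \<in> \<Sigma>" for d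
  proof (cases "T d = 0")
    case False
    then obtain b where b: "b \<in> \<Sigma>" "b \<otimes>\<^bsub>X\<^esub> d = a"
      unfolding T_def by (metis (mono_tags, lifting) empty_Collect_eq sum.empty)
    \<comment> \<open>The denominators r(Next(d)) and r(Next(a)) cancel here. If no b changes d into
      a they may differ, but then T d = 0.\<close>
    then have "N a = N d" using next_gens_mult[of b d] d a by simp
    then have "pw (d # w0) = k * \<rho> * r d"
      using pw0 ra rho_pos by (cases w0) (simp_all add: qr_def k_def)
    then show ?thesis by simp
  qed simp
  define S2 where "S2 = (\<lambda>d. d # w0) ` \<Sigma>"
  define S3 where "S3 = (\<lambda>d. d # ?u) ` N a"
  have fin: "finite S2" "finite S3" by (auto simp: S2_def S3_def finite_gens)
  have W_mem: "w \<in> W" if "w \<in> L" "arr w ?u \<noteq> 0" for w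
    using arr_source(1)[OF that(2,1)] W(2) by auto
  \<comment> \<open>Neither range contains the other: some \<open>d # w0\<close> need not be queue
    words, and W contains words that are no predecessors. The rate vanishes on both
    differences.\<close>
  have "(\<Sum>w\<in>W. pw w * arr w ?u) = (\<Sum>w\<in>insert w0 (S2 \<union> S3). pw w * arr w ?u)"
  proof (rule sum.mono_neutral_cong)
    fix w assume w: "w \<in> insert w0 (S2 \<union> S3) - W"
    have "arr w ?u = 0"
    proof (rule ccontr)
      assume nz: "arr w ?u \<noteq> 0"
      with w W_mem have "w \<notin> L" by blast
      then have "w \<noteq> w0" "w \<notin> S3"
        using w0 N_sym[OF a] N_sub[of a] u by (auto simp: S3_def L_Cons)
      then obtain d where d: "d \<in> \<Sigma>" "w = d # w0" using w by (auto simp: S2_def)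
      then have "T d \<noteq> 0" using nz arr2[OF d(1)] by (auto split: if_splits)
      then obtain b where b: "b \<in> \<Sigma>" "b \<otimes>\<^bsub>X\<^esub> d = a"
        unfolding T_def by (metis (mono_tags, lifting) empty_Collect_eq sum.empty)
      then have "w \<in> L" using L_change[of b d w0] d u a by simp
      then show False using \<open>w \<notin> L\<close> by simp
    qed
    then show "pw w * arr w ?u = 0" by simp
  next
    fix w assume w: "w \<in> W - insert w0 (S2 \<union> S3)"
    then have wL: "w \<in> L" using W by auto
    have "arr w ?u = 0"
    proof (rule ccontr)
      assume "arr w ?u \<noteq> 0"
      from arr_source(2)[OF this wL] w obtain d where d: "d \<in> \<Sigma>" "w = d # ?u" "d \<notin> N a"
        by (auto simp: S2_def S3_def)
      then show False using wL N_sym[OF a d(1)] by (auto simp: L_Cons)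
    qed
    then show "pw w * arr w ?u = 0" by simp
  qed (use W fin in auto)
  also have "\<dots> = pw w0 * arr w0 ?u + (\<Sum>w\<in>S2. pw w * arr w ?u) + (\<Sum>w\<in>S3. pw w * arr w ?u)"
  proof -
    have "w0 \<notin> S2 \<union> S3" "S2 \<inter> S3 = {}"
      by (auto simp: S2_def S3_def dest: arg_cong[where f = length])
    then show ?thesis using fin by (simp add: sum.union_disjoint)
  qed
  also have "(\<Sum>w\<in>S2. pw w * arr w ?u) = k * \<rho> * lam * ((\<Sum>d\<in>\<Sigma>. r d * T d) - r a * T a)"
  proof -
    have "(\<Sum>w\<in>S2. pw w * arr w ?u) = (\<Sum>d\<in>\<Sigma>. pw (d # w0) * (lam * (if d = a then 0 else T d)))"
      unfolding S2_def by (subst sum.reindex) (auto simp: inj_on_def arr2 simp del: arrival_rate.simps intro!: sum.cong)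
    also have "\<dots> = (\<Sum>d\<in>\<Sigma>. k * \<rho> * lam * (r d * T d - (if d = a then r d * T d else 0)))"
      using pw2 by (intro sum.cong refl) (auto simp: mult_ac)
    also have "\<dots> = k * \<rho> * lam * ((\<Sum>d\<in>\<Sigma>. r d * T d) - r a * T a)"
      using a finite_gens by (simp add: sum_distrib_left[symmetric] sum_subtractf)
    finally show ?thesis .
  qed
  also have "(\<Sum>w\<in>S3. pw w * arr w ?u) = k * lam * \<rho>\<^sup>2 * r a * (\<Sum>d\<in>N a. qr d * Cn d)"
    unfolding S3_def
    by (subst sum.reindex) (auto simp: inj_on_def arr3 pwu sum_distrib_left power2_eq_square mult_ac simp del: arrival_rate.simps intro!: sum.cong)
  also have "pw w0 * arr w0 ?u + k * \<rho> * lam * ((\<Sum>d\<in>\<Sigma>. r d * T d) - r a * T a)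
      + k * lam * \<rho>\<^sup>2 * r a * (\<Sum>d\<in>N a. qr d * Cn d)
    = k * (lam * pmf \<nu> a * rN a + \<rho> * lam * (\<Sum>d\<in>\<Sigma>. r d * T d) + \<rho>\<^sup>2 * lam * r a * (\<Sum>d\<in>N a. qr d * Cn d)
       - \<rho> * lam * r a * T a)"
    unfolding arr1 by (simp add: algebra_simps)
  also have "\<dots> = k * (\<rho> * (lam + \<mu>) * r a - \<rho>\<^sup>2 * \<mu> * r a - \<rho> * lam * r a * T a)"
    using twisted_traffic_eq[OF a] unfolding T_def[symmetric] Cn_def[symmetric] by simp
  also have "\<dots> = (tot ?u - \<mu> * \<rho>) * pw ?u"
    unfolding pwu by (simp add: tot_def T_def algebra_simps power2_eq_square)
  finally show ?thesis .
qed

lemma pw_arrival_inflow: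
  assumes u: "u \<in> L" and W: "finite W" "Lle (Suc (length u)) \<subseteq> W" "W \<subseteq> L"
  shows "(\<Sum>w\<in>W. pw w * arr w u) = (tot u - \<mu> * \<rho>) * pw u"
  using pw_arrival_inflow_Nil[of W] pw_arrival_inflow_Cons[of _ _ W] assms by (cases u) auto

text \<open>Every state leads to the empty queue by services. Hence a summable invariant measure is
  determined by its mass at the empty queue, as the positive part of the difference
  \<open>p - p [] * pw\<close> is a summable subinvariant measure, therefore invariant, that vanishes there.\<close>

lemma subinvariant_imp_invariant:
  assumes f0: "\<And>u. u \<in> L \<Longrightarrow> 0 \<le> f u" and B: "\<And>n. sum f (Lle n) \<le> B"
    and sub: "\<And>u. u \<in> L \<Longrightarrow> tot u * f u \<le> (\<Sum>w\<in>Lle (Suc (length u)). f w * R w u)"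
    and u: "u \<in> L"
  shows "tot u * f u = (\<Sum>w\<in>Lle (Suc (length u)). f w * R w u)"
proof (rule ccontr)
  assume neq: "tot u * f u \<noteq> (\<Sum>w\<in>Lle (Suc (length u)). f w * R w u)"
  define \<epsilon> where "\<epsilon> = (\<Sum>w\<in>Lle (Suc (length u)). f w * R w u) - tot u * f u"
  have \<epsilon>: "\<epsilon> > 0" using neq sub[OF u] by (simp add: \<epsilon>_def)
  define S where "S n = (\<Sum>v\<in>Lle n. tot v * f v)" for n
  \<comment> \<open>Summing the inequalities over \<open>Lle n\<close> and exchanging the sums
    bounds the inflow by the total outflow of \<open>Lle (Suc n)\<close>. The strict inequality at u
    gains \<epsilon> at every level, so the outflows would be unbounded, although bounded exit rates
    and the mass bound B prevent this.\<close>
  have step: "S n + \<epsilon> \<le> S (Suc n)" if n: "length u \<le> n" for n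
  proof -
    have un: "u \<in> Lle n" using u n by (simp add: Lle_def)
    have "S n + \<epsilon> = (\<Sum>v\<in>Lle n. tot v * f v + (if v = u then \<epsilon> else 0))"
      using un by (simp add: S_def sum.distrib)
    also have "\<dots> \<le> (\<Sum>v\<in>Lle n. \<Sum>w\<in>Lle (Suc (length v)). f w * R w v)"
      using sub Lle_sub by (intro sum_mono) (auto simp: \<epsilon>_def)
    also have "\<dots> \<le> (\<Sum>v\<in>Lle n. \<Sum>w\<in>Lle (Suc n). f w * R w v)"
    proof (intro sum_mono sum_mono2)
      fix v assume "v \<in> Lle n"
      then show "Lle (Suc (length v)) \<subseteq> Lle (Suc n)" by (intro Lle_mono) (simp add: Lle_def)
      fix w assume "w \<in> Lle (Suc n) - Lle (Suc (length v))"
      then show "0 \<le> f w * R w v" using f0 Lle_sub R_nonneg(2) by (intro mult_nonneg_nonneg) auto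
    qed simp
    also have "\<dots> = (\<Sum>w\<in>Lle (Suc n). f w * (\<Sum>v\<in>Lle n. R w v))"
      by (subst sum.swap) (simp only: sum_distrib_left)
    also have "\<dots> \<le> (\<Sum>w\<in>Lle (Suc n). f w * tot w)"
    proof (intro sum_mono mult_left_mono)
      fix w assume "w \<in> Lle (Suc n)"
      then have w: "w \<in> L" using Lle_sub by auto
      show "0 \<le> f w" using f0[OF w] .
      have "(\<Sum>v\<in>Lle n. R w v) \<le> (\<Sum>v\<in>Lle n \<union> Lle (Suc (length w)). R w v)"
        using R_nonneg(2) by (intro sum_mono2) auto
      also have "\<dots> = tot w" using w by (intro sum_R) auto
      finally show "(\<Sum>v\<in>Lle n. R w v) \<le> tot w" .
    qed
    finally show ?thesis by (simp add: S_def mult.commute)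
  qed
  have grow: "real k * \<epsilon> \<le> S (length u + k)" for k
  proof (induction k)
    case 0
    show ?case using f0 tot_nonneg Lle_sub unfolding S_def by (simp, intro sum_nonneg mult_nonneg_nonneg) auto
  next
    case (Suc k)
    then show ?case using step[of "length u + k"] by (simp add: algebra_simps)
  qed
  have bnd: "S n \<le> tmax * B" for n
  proof -
    have "S n \<le> (\<Sum>v\<in>Lle n. tmax * f v)"
      unfolding S_def using tot_le f0 Lle_sub by (intro sum_mono mult_right_mono) auto
    also have "\<dots> \<le> tmax * B"
      unfolding sum_distrib_left[symmetric] using B tot_le[of u] tot_nonneg[OF u] by (intro mult_left_mono) auto
    finally show ?thesis .
  qed
  obtain k where "tmax * B < real k * \<epsilon>" using reals_Archimedean3[OF \<epsilon>] by blast
  with grow[of k] bnd[of "length u + k"] show False by simp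
qed

text \<open>If a word has mass 0, balance makes every inflow into it vanish. Each word
  \<open>u @ [d]\<close> is served into u at a positive rate, so zeros spread from the empty word to
  all words.\<close>

lemma invariant_zero:
  assumes f0: "\<And>u. u \<in> L \<Longrightarrow> 0 \<le> f u"
    and inv: "\<And>u. u \<in> L \<Longrightarrow> tot u * f u = (\<Sum>w\<in>Lle (Suc (length u)). f w * R w u)"
    and Nil: "f [] = 0" and u: "u \<in> L"
  shows "f u = 0"
  using u
proof (induction u rule: rev_induct)
  case (snoc d u)
  then have uL: "u \<in> L" using L_snocD by blast
  then have "(\<Sum>w\<in>Lle (Suc (length u)). f w * R w u) = 0" using inv[OF uL] snoc by simp
  then have "\<forall>w\<in>Lle (Suc (length u)). f w * R w u = 0"
    using f0 Lle_sub R_nonneg(2) by (subst (asm) sum_nonneg_eq_0_iff) (auto intro!: mult_nonneg_nonneg)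
  moreover have "u @ [d] \<in> Lle (Suc (length u))" using snoc by (simp add: Lle_def)
  ultimately have "f (u @ [d]) * R (u @ [d]) u = 0" by blast
  moreover have "R (u @ [d]) u > 0" using arr_nonneg[of "u @ [d]" u] mu_pos by simp
  ultimately show ?case by simp
qed (use Nil in simp)

lemma pw_invariant:
  assumes u: "u \<in> L"
  shows "(\<Sum>w\<in>Lle (Suc (length u)). pw w * R w u) = tot u * pw u"
  using pw_arrival_inflow[OF u finite_Lle order_refl Lle_sub] pw_service_inflow[OF u finite_Lle order_refl Lle_sub]
  by (simp add: distrib_left sum.distrib) (simp add: algebra_simps)

theorem invariant_unique:
  assumes p0: "\<And>u. u \<in> L \<Longrightarrow> 0 \<le> p u" and B: "\<And>n. sum p (Lle n) \<le> B"
    and inv: "\<And>u. u \<in> L \<Longrightarrow> tot u * p u = (\<Sum>w\<in>Lle (Suc (length u)). p w * R w u)"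
    and u: "u \<in> L"
  shows "p u = p [] * pw u"
proof -
  define c where "c = p []"
  have c: "0 \<le> c" using p0[OF L_Nil] by (simp add: c_def)
  \<comment> \<open>The positive part of an invariant signed measure is subinvariant, and here it is
    dominated by p, which provides the mass bound that \<open>pw\<close> alone does not.\<close>
  define f where "f u = max 0 (p u - c * pw u)" for u
  have diff: "tot u * (p u - c * pw u) = (\<Sum>w\<in>Lle (Suc (length u)). (p w - c * pw w) * R w u)" if "u \<in> L" for u
    using inv[OF that] pw_invariant[OF that]
    by (simp add: left_diff_distrib right_diff_distrib sum_subtractf mult.assoc sum_distrib_left[symmetric] mult.left_commute del: distrib_left)
  have fp: "f u \<le> p u" if "u \<in> L" for u
    using p0[OF that] c pw_nonneg[OF that] by (simp add: f_def)
  have f_inv: "tot u * f u = (\<Sum>w\<in>Lle (Suc (length u)). f w * R w u)" if "u \<in> L" for u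
  proof (rule subinvariant_imp_invariant[OF _ _ _ that])
    show "0 \<le> f u" for u by (simp add: f_def)
    show "sum f (Lle n) \<le> B" for n
      using fp Lle_sub by (intro order_trans[OF sum_mono B[of n]]) auto
    fix u assume u: "u \<in> L"
    have "(\<Sum>w\<in>Lle (Suc (length u)). (p w - c * pw w) * R w u) \<le> (\<Sum>w\<in>Lle (Suc (length u)). f w * R w u)"
      using R_nonneg(2) by (intro sum_mono mult_right_mono) (auto simp: f_def)
    moreover have "0 \<le> (\<Sum>w\<in>Lle (Suc (length u)). f w * R w u)"
      using R_nonneg(2) by (intro sum_nonneg mult_nonneg_nonneg) (auto simp: f_def)
    ultimately show "tot u * f u \<le> (\<Sum>w\<in>Lle (Suc (length u)). f w * R w u)"
      using diff[OF u] by (auto simp: f_def max_def)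
  qed
  have f_zero: "f u = 0" if "u \<in> L" for u
    by (rule invariant_zero[OF _ f_inv _ that]) (simp_all add: f_def c_def)
  \<comment> \<open>Now p is at most c * \<open>pw\<close>, so this difference is nonnegative; it is
    invariant and vanishes at the empty word. \<open>invariant_zero\<close> asks for no mass bound,
    so the positive part need not be taken again.\<close>
  have "c * pw u - p u = 0"
  proof (rule invariant_zero[OF _ _ _ u])
    show "0 \<le> c * pw u - p u" if "u \<in> L" for u using f_zero[OF that] by (simp add: f_def max_def split: if_splits)
    show "tot u * (c * pw u - p u) = (\<Sum>w\<in>Lle (Suc (length u)). (c * pw w - p w) * R w u)" if "u \<in> L" for u
    proof -
      have "(\<Sum>w\<in>Lle (Suc (length u)). (c * pw w - p w) * R w u)
          = - (\<Sum>w\<in>Lle (Suc (length u)). (p w - c * pw w) * R w u)"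
        unfolding sum_negf[symmetric] by (intro sum.cong refl) (simp add: algebra_simps)
      then show ?thesis using diff[OF that] by (simp add: algebra_simps)
    qed
  qed (simp add: c_def)
  then show ?thesis by (simp add: c_def)
qed

end

section \<open>Poisson weights\<close>

definition pois :: "real \<Rightarrow> nat \<Rightarrow> real" where
  "pois a j = a ^ j / fact j * exp (- a)"

text \<open>Transition probability from k to l of a counter whose number of new points is Poisson
  with mean a.\<close>

definition pois_step :: "real \<Rightarrow> nat \<Rightarrow> nat \<Rightarrow> real" where
  "pois_step a k l = (if k \<le> l then pois a (l - k) else 0)"

lemma pois_nonneg: "0 \<le> a \<Longrightarrow> 0 \<le> pois a j" by (simp add: pois_def)

lemma pois_has_sum:
  assumes "0 \<le> a"
  shows "(pois a has_sum 1) UNIV"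
proof (rule sums_nonneg_imp_has_sum)
  have "(\<lambda>j. a ^ j /\<^sub>R fact j * exp (- a)) sums (exp a * exp (- a))"
    by (intro sums_mult2 exp_converges)
  then show "pois a sums 1" by (simp add: pois_def[abs_def] divide_inverse mult.commute exp_minus)
qed (use assms in \<open>auto simp: pois_nonneg\<close>)

lemma pois_le_1: "0 \<le> a \<Longrightarrow> pois a j \<le> 1"
  using finite_sum_le_has_sum[OF pois_has_sum, of a "{j}"] by (simp add: pois_nonneg)

lemma pois_step_bounds: "0 \<le> a \<Longrightarrow> 0 \<le> pois_step a k l \<and> pois_step a k l \<le> 1"
  by (simp add: pois_step_def pois_nonneg pois_le_1)

lemma pois_step_0: "pois_step 0 k l = of_bool (l = k)"
  by (auto simp: pois_step_def pois_def power_0_left)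

lemma pois_derivative:
  "((\<lambda>t. pois (c * t) j) has_real_derivative
     c * ((if j = 0 then 0 else pois (c * t) (j - 1)) - pois (c * t) j)) (at t)"
proof (cases j)
  case 0
  then show ?thesis unfolding pois_def by (auto intro!: derivative_eq_intros)
next
  case (Suc i)
  have "((\<lambda>t. (c * t) ^ Suc i / fact (Suc i) * exp (- (c * t))) has_real_derivative
      real (Suc i) * c * (c * t) ^ i / fact (Suc i) * exp (- (c * t))
      + (c * t) ^ Suc i / fact (Suc i) * (exp (- (c * t)) * - c)) (at t)"
    by (auto intro!: derivative_eq_intros simp add: diff_divide_distrib mult_ac simp del: power_Suc fact_Suc of_nat_Suc)
  moreover have "real (Suc i) * c * (c * t) ^ i / fact (Suc i) = c * ((c * t) ^ i / fact i)"
    by (simp add: field_simps del: of_nat_Suc)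
  ultimately have "((\<lambda>t. pois (c * t) (Suc i)) has_real_derivative
      c * ((c * t) ^ i / fact i) * exp (- (c * t)) + (c * t) ^ Suc i / fact (Suc i) * (exp (- (c * t)) * - c)) (at t)"
    unfolding pois_def by (simp only:)
  then show ?thesis
    unfolding Suc by (rule DERIV_cong) (simp add: pois_def algebra_simps del: power_Suc fact_Suc of_nat_Suc)
qed

text \<open>The forward equation of a Poisson counter of rate c started at k. The case l = 0 is set
  apart because l - 1 would again be 0.\<close>

lemma pois_step_derivative:
  "((\<lambda>t. pois_step (c * t) k l) has_real_derivative
     c * ((if l = 0 then 0 else pois_step (c * t) k (l - 1)) - pois_step (c * t) k l)) (at t)"
proof (cases "k \<le> l")
  case True
  have "(if l - k = 0 then 0 else pois (c * t) (l - k - 1)) = (if l = 0 then 0 else pois_step (c * t) k (l - 1))"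
    using True by (auto simp: pois_step_def)
  with True show ?thesis using pois_derivative[of c "l - k" t] by (simp add: pois_step_def)
next
  case False
  then show ?thesis by (auto simp: pois_step_def)
qed

section \<open>Laws of the queue-content and of the departure counter\<close>

context queue_data
begin

abbreviation "Q1 \<equiv> queue_generator X \<Sigma> \<nu> r lam \<mu>"
abbreviation "Q2 \<equiv> counted_queue_generator X \<Sigma> \<nu> r lam \<mu>"

lemma queue_generator_eq:
  assumes w: "w \<in> L" and u: "u \<in> L"
  shows "Q1 w u = R w u - (if w = u then tot u else 0)"
proof (cases "w = u")
  case True
  have "((\<lambda>v. R u v) has_sum tot u) (L - {u})"
  proof (rule has_sum_finite_neutralI[of "Lle (Suc (length u)) - {u}"])
    show "R u v = 0" if "v \<in> L - {u} - (Lle (Suc (length u)) - {u})" for v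
      using R_target[OF _ u, of v] that by blast
    show "tot u = (\<Sum>v\<in>Lle (Suc (length u)) - {u}. R u v)"
      using sum_R[OF u finite_Lle order_refl] by (simp add: sum_diff1)
  qed (use Lle_sub in auto)
  then show ?thesis using True by (simp add: queue_generator_def generator_of_def infsumI)
next
  case False
  then show ?thesis by (simp add: queue_generator_def generator_of_def)
qed

lemma counted_queue_generator_eq:
  assumes w: "w \<in> L" and u: "u \<in> L"
  shows "Q2 (w, j) (u, l) = (if l = j then arr w u else if l = Suc j then serv w u else 0)
    - (if w = u \<and> j = l then tot u else 0)"
proof (cases "w = u \<and> j = l")
  case True
  let ?f = "\<lambda>(v, k). if k = l then arr u v else if k = Suc l then serv u v else 0"
  have "(?f has_sum tot u) (L \<times> UNIV - {(u, l)})"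
  proof (rule has_sum_finite_neutralI[of "Lle (Suc (length u)) \<times> {l, Suc l} - {(u, l)}"])
    show "?f x = 0" if "x \<in> L \<times> UNIV - {(u, l)} - (Lle (Suc (length u)) \<times> {l, Suc l} - {(u, l)})" for x
      using arr_target[OF _ u, of "fst x"] serv_target[OF _ u, of "fst x"] that by (cases x) auto
    have "sum ?f (Lle (Suc (length u)) \<times> {l, Suc l}) = (\<Sum>v\<in>Lle (Suc (length u)). \<Sum>k\<in>{l, Suc l}. ?f (v, k))"
      by (rule sum.cartesian_product')
    also have "\<dots> = (\<Sum>v\<in>Lle (Suc (length u)). R u v)" by (intro sum.cong) auto
    also have "\<dots> = tot u" using sum_R[OF u finite_Lle order_refl] .
    finally show "tot u = sum ?f (Lle (Suc (length u)) \<times> {l, Suc l} - {(u, l)})"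
      by (simp add: sum_diff1)
  qed (use Lle_sub in auto)
  then show ?thesis using True
    by (simp add: counted_queue_generator_def generator_of_def infsumI case_prod_unfold cong: if_cong)
next
  case False
  then show ?thesis by (auto simp: counted_queue_generator_def generator_of_def)
qed

text \<open>The evolution of p is constant, so its right derivative at time 0 vanishes; that
  derivative is p applied to the generator, and the balance equations follow.\<close>

lemma stationary_law:
  assumes P: "transition_function L P" "has_generator L P Q1"
    and p: "\<And>u. u \<in> L \<Longrightarrow> 0 \<le> p u" "p summable_on L"
    and st: "\<And>t v. 0 \<le> t \<Longrightarrow> v \<in> L \<Longrightarrow> ((\<lambda>u. p u * P t u v) has_sum p v) L"
    and u: "u \<in> L"
  shows "p u = p [] * pw u"
proof (rule invariant_unique[of p "infsum p L", OF p(1) _ _ u])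
  show "sum p (Lle n) \<le> infsum p L" for n
    using p Lle_sub by (intro finite_sum_le_infsum) auto
  fix v assume v: "v \<in> L"
  have "((\<lambda>h. (evolve L P p h v - p v) / h) \<longlongrightarrow> (\<Sum>w\<in>Lle (Suc (length v)). p w * Q1 w v)) (at_right 0)"
  proof (rule evolve_right_derivative_0[OF P p _ v finite_Lle Lle_sub])
    show "- Q1 x x \<le> tmax" if "x \<in> L" for x using queue_generator_eq[OF that that] tot_le[of x] by simp
    show "Q1 x v = 0" if "x \<in> L - Lle (Suc (length v))" for x
    proof -
      have "arr x v = 0" "serv x v = 0" "x \<noteq> v"
        using that v arr_source(1)[of x v] serv_source_le[of x v] by (auto simp: Lle_def)
      then show ?thesis using that v queue_generator_eq[of x v] by simp
    qed
  qed
  moreover have "\<forall>\<^sub>F h in at_right (0::real). 0 < h" by (simp add: eventually_at_right_less)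
  then have "\<forall>\<^sub>F h in at_right 0. (evolve L P p h v - p v) / h = 0"
    by eventually_elim (simp add: evolve_def[OF P] infsumI[OF st] v)
  then have "((\<lambda>h. (evolve L P p h v - p v) / h) \<longlongrightarrow> 0) (at_right 0)"
    by (rule tendsto_eventually)
  ultimately have "(\<Sum>w\<in>Lle (Suc (length v)). p w * Q1 w v) = 0"
    by (rule tendsto_unique[OF trivial_limit_at_right_real])
  moreover have "(\<Sum>w\<in>Lle (Suc (length v)). p w * Q1 w v)
      = (\<Sum>w\<in>Lle (Suc (length v)). p w * R w v - (if w = v then p v * tot v else 0))"
  proof (rule sum.cong[OF refl])
    fix w assume "w \<in> Lle (Suc (length v))"
    then have "w \<in> L" using Lle_sub by auto
    then show "p w * Q1 w v = p w * R w v - (if w = v then p v * tot v else 0)"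
      using v by (simp add: queue_generator_eq right_diff_distrib)
  qed
  moreover have "v \<in> Lle (Suc (length v))" using v by (simp add: Lle_def)
  ultimately show "tot v * p v = (\<Sum>w\<in>Lle (Suc (length v)). p w * R w v)"
    by (simp add: sum_subtractf mult.commute)
qed

text \<open>Quasi-reversibility: from the stationary law, the counter evolves as a Poisson process of rate
  \<open>\<mu> * \<rho>\<close> and stays independent of the content, because the services flow into each state at
  \<open>\<mu> * \<rho>\<close> times its mass.\<close>

theorem counted_evolution:
  assumes P: "transition_function (L \<times> UNIV) P" "has_generator (L \<times> UNIV) P Q2"
    and p: "\<And>u. u \<in> L \<Longrightarrow> 0 \<le> p u" "p summable_on L"
    and st: "\<And>u. u \<in> L \<Longrightarrow> p u = p0 * pw u"
    and t: "0 \<le> t" and v: "v \<in> L"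
  shows "((\<lambda>u. p u * P t (u, k) (v, l)) has_sum p v * pois_step (\<mu> * \<rho> * t) k l) L"
proof -
  let ?E = "L \<times> (UNIV :: nat set)"
  let ?c = "\<mu> * \<rho>"
  \<comment> \<open>The initial measure m has content p and counter k; the candidate g keeps the
    content p and moves the counter independently as a Poisson process.\<close>
  define m where "m = (\<lambda>(u, j). p u * of_bool (j = k))"
  define g where "g = (\<lambda>t (u, j). p u * pois_step (?c * t) k j)"
  \<comment> \<open>Only the counters l and l - 1 have rates into l. Taking all counters up to l
    avoids subtracting 1 from l = 0.\<close>
  define A where "A = (\<lambda>(u :: 'x list, l). Lle (Suc (length u)) \<times> {..l::nat})"
  have c0: "0 \<le> ?c" using mu_pos rho_pos by simp
  have m0: "\<And>x. x \<in> ?E \<Longrightarrow> 0 \<le> m x" using p(1) by (auto simp: m_def)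
  have inj: "inj_on (\<lambda>u. (u, k)) L" by (simp add: inj_on_def)
  have red: "(f has_sum s) ?E \<longleftrightarrow> ((\<lambda>u. f (u, k)) has_sum s) L"
    if "\<And>x. x \<in> ?E \<Longrightarrow> snd x \<noteq> k \<Longrightarrow> f x = (0::real)" for f s
  proof -
    have "(f has_sum s) ?E \<longleftrightarrow> (f has_sum s) ((\<lambda>u. (u, k)) ` L)"
      by (rule has_sum_cong_neutral) (use that in \<open>auto simp: image_iff\<close>)
    then show ?thesis using has_sum_reindex[OF inj, of f s] by (simp add: o_def)
  qed
  have msum: "m summable_on ?E"
    using red[of m "infsum p L"] has_sum_infsum[OF p(2)] by (auto simp: m_def summable_on_def)
  \<comment> \<open>The column bound K adds \<open>tmax\<close>, for the diagonal entry, to the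
    bound on the jumps into a word. B is the total mass, since g never exceeds p.\<close>
  have "evolve ?E P m t (v, l) = g t (v, l)"
  proof (rule forward_equation_unique[OF P m0 msum, where q = tmax and A = A and K = "real (3 * card \<Sigma> + 1) * tmax + tmax"
        and B = "infsum p L"])
    show "- Q2 x x \<le> tmax" if "x \<in> ?E" for x
      using that counted_queue_generator_eq[of "fst x" "fst x" "snd x" "snd x"] tot_le[of "fst x"] by (cases x) auto
    show "finite (A y)" for y by (simp add: A_def case_prod_unfold)
    show "A y \<subseteq> ?E" for y using Lle_sub by (auto simp: A_def)
    show "Q2 x y = 0" if y: "y \<in> ?E" and x: "x \<in> ?E - A y" for x y
    proof -
      obtain w j u i where e: "x = (w, j)" "y = (u, i)" by (cases x, cases y)
      then have wu: "w \<in> L" "u \<in> L" "w \<notin> Lle (Suc (length u)) \<or> i < j" using x y by (auto simp: A_def)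
      then have "w \<notin> Lle (Suc (length u)) \<Longrightarrow> arr w u = 0 \<and> serv w u = 0 \<and> w \<noteq> u"
        using arr_source(1)[of w u] serv_source_le[of w u] by (auto simp: Lle_def)
      then show ?thesis using wu unfolding e counted_queue_generator_eq[OF wu(1,2)] by auto
    qed
    show "(\<Sum>x\<in>A y. \<bar>Q2 x y\<bar>) \<le> real (3 * card \<Sigma> + 1) * tmax + tmax" if y: "y \<in> ?E" for y
    proof -
      obtain u i where e: "y = (u, i)" and u: "u \<in> L" using y by auto
      have "(\<Sum>x\<in>A y. \<bar>Q2 x y\<bar>) = (\<Sum>w\<in>Lle (Suc (length u)). \<Sum>j\<in>{..i}. \<bar>Q2 (w, j) (u, i)\<bar>)"
        unfolding e A_def by (simp add: sum.cartesian_product')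
      also have "\<dots> \<le> (\<Sum>w\<in>Lle (Suc (length u)). R w u + (if w = u then tot u else 0))"
      proof (rule sum_mono)
        fix w assume "w \<in> Lle (Suc (length u))"
        then have w: "w \<in> L" using Lle_sub by auto
        have "(\<Sum>j\<in>{..i}. \<bar>Q2 (w, j) (u, i)\<bar>)
          \<le> (\<Sum>j\<in>{..i}. (if j = i then arr w u + (if w = u then tot u else 0) else 0) + (if Suc j = i then serv w u else 0))"
          unfolding counted_queue_generator_eq[OF w u]
          using arr_nonneg[of w u] R_nonneg(1)[of w u] tot_nonneg[OF u] by (intro sum_mono) (auto simp: abs_if)
        also have "\<dots> = arr w u + (if w = u then tot u else 0) + (\<Sum>j\<in>{..i}. if Suc j = i then serv w u else 0)"
          by (simp add: sum.distrib)
        also have "(\<Sum>j\<in>{..i}. if Suc j = i then serv w u else 0) \<le> serv w u"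
          using R_nonneg(1)[of w u] by (cases i) auto
        finally show "(\<Sum>j\<in>{..i}. \<bar>Q2 (w, j) (u, i)\<bar>) \<le> R w u + (if w = u then tot u else 0)" by simp
      qed
      also have "\<dots> = (\<Sum>w\<in>Lle (Suc (length u)). R w u) + tot u"
      proof -
        have "u \<in> Lle (Suc (length u))" using u by (simp add: Lle_def)
        then show ?thesis by (simp add: sum.distrib)
      qed
      also have "\<dots> \<le> real (3 * card \<Sigma> + 1) * tmax + tmax"
        using sum_R_column[OF u] tot_le[of u] by (rule add_mono)
      finally show ?thesis .
    qed
    show "g 0 y = m y" if "y \<in> ?E" for y by (cases y) (simp add: g_def m_def pois_step_0)
    show "\<bar>g t y\<bar> \<le> infsum p L" if t: "0 \<le> t" and y: "y \<in> ?E" for t y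
    proof -
      obtain u i where e: "y = (u, i)" and u: "u \<in> L" using y by auto
      have "p u \<le> infsum p L" using finite_sum_le_infsum[OF p(2), of "{u}"] u p(1) by auto
      moreover have "0 \<le> pois_step (?c * t) k i" "pois_step (?c * t) k i \<le> 1"
        using pois_step_bounds[of "?c * t" k i] c0 t by auto
      ultimately show ?thesis
        using p(1)[OF u] unfolding e g_def by (simp add: abs_mult mult_left_le order_trans[OF mult_left_le])
    qed
    show "((\<lambda>t. g t y) has_real_derivative (\<Sum>x\<in>A y. g t x * Q2 x y)) (at t)" if t: "0 \<le> t" and y: "y \<in> ?E" for t y
    proof -
      obtain u i where e: "y = (u, i)" and u: "u \<in> L" using y by auto
      let ?F = "Lle (Suc (length u))"
      let ?s = "\<lambda>j. pois_step (?c * t) k j"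
      have uF: "u \<in> ?F" using u by (simp add: Lle_def)
      have pA: "(\<Sum>w\<in>?F. p w * arr w u) = (tot u - ?c) * p u"
      proof -
        have "(\<Sum>w\<in>?F. p w * arr w u) = p0 * (\<Sum>w\<in>?F. pw w * arr w u)"
          unfolding sum_distrib_left using st Lle_sub by (intro sum.cong refl) auto
        then show ?thesis using pw_arrival_inflow[OF u finite_Lle order_refl Lle_sub] st[OF u] by simp
      qed
      have pS: "(\<Sum>w\<in>?F. p w * serv w u) = ?c * p u"
      proof -
        have "(\<Sum>w\<in>?F. p w * serv w u) = p0 * (\<Sum>w\<in>?F. pw w * serv w u)"
          unfolding sum_distrib_left using st Lle_sub by (intro sum.cong refl) auto
        then show ?thesis using pw_service_inflow[OF u finite_Lle order_refl Lle_sub] st[OF u] by simp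
      qed
      have "(\<Sum>x\<in>A y. g t x * Q2 x y) = (\<Sum>w\<in>?F. \<Sum>j\<in>{..i}. p w * ?s j * Q2 (w, j) (u, i))"
        unfolding e A_def g_def by (simp add: sum.cartesian_product')
      also have "\<dots> = (\<Sum>w\<in>?F. p w * arr w u * ?s i - (if w = u then p u * tot u * ?s i else 0)
          + p w * serv w u * (if i = 0 then 0 else ?s (i - 1)))"
      proof (rule sum.cong[OF refl])
        fix w assume "w \<in> ?F"
        then have w: "w \<in> L" using Lle_sub by auto
        have "(\<Sum>j\<in>{..i}. p w * ?s j * Q2 (w, j) (u, i))
          = (\<Sum>j\<in>{..i}. (if j = i then p w * ?s i * (arr w u - (if w = u then tot u else 0)) else 0)
              + (if Suc j = i then p w * ?s j * serv w u else 0))"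
          unfolding counted_queue_generator_eq[OF w u] by (intro sum.cong refl) auto
        also have "\<dots> = p w * ?s i * (arr w u - (if w = u then tot u else 0))
            + (\<Sum>j\<in>{..i}. if Suc j = i then p w * ?s j * serv w u else 0)"
          by (simp add: sum.distrib)
        also have "(\<Sum>j\<in>{..i}. if Suc j = i then p w * ?s j * serv w u else 0)
            = p w * serv w u * (if i = 0 then 0 else ?s (i - 1))"
          by (cases i) auto
        finally show "(\<Sum>j\<in>{..i}. p w * ?s j * Q2 (w, j) (u, i))
            = p w * arr w u * ?s i - (if w = u then p u * tot u * ?s i else 0)
            + p w * serv w u * (if i = 0 then 0 else ?s (i - 1))" by (auto simp: algebra_simps)
      qed
      also have "\<dots> = (\<Sum>w\<in>?F. p w * arr w u) * ?s i - p u * tot u * ?s i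
          + (\<Sum>w\<in>?F. p w * serv w u) * (if i = 0 then 0 else ?s (i - 1))"
        using uF by (simp add: sum.distrib sum_subtractf sum_distrib_right)
      \<comment> \<open>The exit rate cancels against the arrivals up to the rate \<open>?c\<close>,
        and the services bring the same rate with the counter one lower. What remains is p u times
        the forward equation of the Poisson counter.\<close>
      also have "\<dots> = p u * (?c * ((if i = 0 then 0 else ?s (i - 1)) - ?s i))"
        unfolding pA pS by (simp add: algebra_simps)
      finally show ?thesis
        using DERIV_cmult[OF pois_step_derivative[of ?c k i t], of "p u"] unfolding e g_def by simp
    qed
  qed (use t v in auto)
  moreover have "(\<lambda>x. m x * P t x (v, l)) summable_on ?E"
    using v t by (intro summable_on_trans[OF P m0 msum t]) (auto intro!: trans_nonneg[OF P] trans_le_1[OF P])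
  ultimately have "((\<lambda>x. m x * P t x (v, l)) has_sum g t (v, l)) ?E"
    unfolding evolve_def[OF P] by (metis has_sum_infsum)
  then show ?thesis
    by (subst (asm) red) (auto simp: m_def g_def)
qed

end

section \<open>From the semigroups to the processes\<close>

lemma has_sum_eqI: "(f has_sum a) A \<Longrightarrow> (\<And>x. x \<in> A \<Longrightarrow> f x = g x) \<Longrightarrow> (g has_sum a) A"
  by (metis has_sum_cong)

text \<open>Countable additivity over the values of Y. The values are numbered so that the version
  for sequences of disjoint events applies.\<close>

lemma (in prob_space) has_sum_prob:
  assumes E: "countable E" and Y: "Y \<in> measurable M (count_space E)" and A: "A \<in> sets M"
  shows "((\<lambda>y. prob {\<omega> \<in> A. Y \<omega> = y}) has_sum prob {\<omega> \<in> A. Y \<omega> \<in> S}) (E \<inter> S)"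
proof -
  let ?C = "E \<inter> S"
  have C: "countable ?C" using E by blast
  have AM: "A \<subseteq> space M" using A sets.sets_into_space by blast
  have YE: "Y \<omega> \<in> E" if "\<omega> \<in> A" for \<omega> using measurable_space[OF Y] that AM by auto
  define f where "f = to_nat_on ?C"
  have inj: "inj_on f ?C" unfolding f_def by (rule inj_on_to_nat_on[OF C])
  define B where "B n = {\<omega> \<in> A. Y \<omega> \<in> S \<and> f (Y \<omega>) = n}" for n
  have ev: "{\<omega> \<in> A. Q (Y \<omega>)} \<in> sets M" for Q
  proof -
    have "{\<omega> \<in> A. Q (Y \<omega>)} = A \<inter> (Y -` {y \<in> E. Q y} \<inter> space M)" using AM YE by auto
    also have "\<dots> \<in> sets M" using Y A by (intro sets.Int measurable_sets[OF Y]) auto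
    finally show ?thesis .
  qed
  have "(\<lambda>n. prob (B n)) sums prob (\<Union>n. B n)"
    by (rule finite_measure_UNION) (auto simp: B_def disjoint_family_on_def intro!: ev)
  moreover have "(\<Union>n. B n) = {\<omega> \<in> A. Y \<omega> \<in> S}" by (auto simp: B_def)
  ultimately have "((\<lambda>n. prob (B n)) has_sum prob {\<omega> \<in> A. Y \<omega> \<in> S}) UNIV"
    by (intro sums_nonneg_imp_has_sum) simp_all
  moreover have "prob (B n) = 0" if "n \<notin> f ` ?C" for n
  proof -
    have "B n = {}" using that YE by (auto simp: B_def)
    then show ?thesis by simp
  qed
  ultimately have "((\<lambda>n. prob (B n)) has_sum prob {\<omega> \<in> A. Y \<omega> \<in> S}) (f ` ?C)"
    by (subst has_sum_cong_neutral[where T = UNIV and g = "\<lambda>n. prob (B n)"]) auto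
  then have "((\<lambda>y. prob (B (f y))) has_sum prob {\<omega> \<in> A. Y \<omega> \<in> S}) ?C"
    by (simp add: has_sum_reindex[OF inj] o_def)
  moreover have "prob (B (f y)) = prob {\<omega> \<in> A. Y \<omega> = y}" if "y \<in> ?C" for y
  proof -
    have "B (f y) = {\<omega> \<in> A. Y \<omega> = y}"
      using that YE inj by (auto simp: B_def dest: inj_onD)
    then show ?thesis by simp
  qed
  ultimately show ?thesis by (rule has_sum_eqI)
qed

lemma (in prob_space) has_sum_prob_UNIV:
  assumes "countable E" "Y \<in> measurable M (count_space E)" "A \<in> sets M"
  shows "((\<lambda>y. prob {\<omega> \<in> A. Y \<omega> = y}) has_sum prob A) E"
  using has_sum_prob[OF assms, of UNIV] by simp

text \<open>The Markov hypothesis prescribes the exact state at every time, whereas here the earlier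
  states need only lie in given sets. These are relaxed one at a time by summing over the value of
  one coordinate; the last transition probability is a common factor of the sums.\<close>

lemma (in prob_space) markov_history:
  fixes Z :: "real \<Rightarrow> 'a \<Rightarrow> 'e" and \<tau> :: "nat \<Rightarrow> real"
  assumes E: "countable E" and Z: "\<And>t. 0 \<le> t \<Longrightarrow> Z t \<in> measurable M (count_space E)"
    and markov: "\<And>n (\<tau> :: nat \<Rightarrow> real) z. 0 \<le> \<tau> 0 \<and> (\<forall>i\<le>n. \<tau> i \<le> \<tau> (Suc i)) \<and> (\<forall>i\<le>Suc n. z i \<in> E) \<Longrightarrow>
           prob {\<omega> \<in> space M. \<forall>i\<le>Suc n. Z (\<tau> i) \<omega> = z i} =
           prob {\<omega> \<in> space M. \<forall>i\<le>n. Z (\<tau> i) \<omega> = z i} * P (\<tau> (Suc n) - \<tau> n) (z n) (z (Suc n))"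
    and \<tau>0: "0 \<le> \<tau> 0" and \<tau>: "\<forall>i\<le>n. \<tau> i \<le> \<tau> (Suc i)" and z: "z \<in> E" "z' \<in> E"
  shows "prob {\<omega> \<in> space M. (\<forall>i\<in>{..<n}. Z (\<tau> i) \<omega> \<in> S i) \<and> Z (\<tau> n) \<omega> = z \<and> Z (\<tau> (Suc n)) \<omega> = z'}
    = prob {\<omega> \<in> space M. (\<forall>i\<in>{..<n}. Z (\<tau> i) \<omega> \<in> S i) \<and> Z (\<tau> n) \<omega> = z} * P (\<tau> (Suc n) - \<tau> n) z z'"
proof -
  have \<tau>n: "0 \<le> \<tau> i" if "i \<le> Suc n" for i
    using that
  proof (induction i)
    case (Suc i)
    then have "\<tau> i \<le> \<tau> (Suc i)" "0 \<le> \<tau> i" using \<tau> by auto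
    then show ?case by linarith
  qed (use \<tau>0 in simp)
  have pred: "{\<omega> \<in> space M. Q (Z (\<tau> i) \<omega>)} \<in> sets M" if "i \<le> Suc n" for i Q
  proof -
    have "{\<omega> \<in> space M. Q (Z (\<tau> i) \<omega>)} = Z (\<tau> i) -` {y \<in> E. Q y} \<inter> space M"
      using measurable_space[OF Z[OF \<tau>n[OF that]]] by auto
    also have "\<dots> \<in> sets M" by (rule measurable_sets[OF Z[OF \<tau>n[OF that]]]) auto
    finally show ?thesis .
  qed
  \<comment> \<open>Coordinates before m are only confined to their sets S i, while those in J are
    fixed by z.\<close>
  define G where "G m J z = {\<omega> \<in> space M. (\<forall>i\<in>{..<m}. Z (\<tau> i) \<omega> \<in> S i) \<and> (\<forall>i\<in>J. Z (\<tau> i) \<omega> = z i)}" for m J z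
  have G: "G m J z \<in> sets M" if "m \<le> Suc n" "J \<subseteq> {..Suc n}" for m J z
    unfolding G_def
    by (intro sets.sets_Collect_conj sets.sets_Collect_finite_All pred)
      (use that finite_subset[OF that(2)] in auto)
  have claim: "prob (G m {m..Suc n} z) = prob (G m {m..n} z) * P (\<tau> (Suc n) - \<tau> n) (z n) (z (Suc n))"
    if "m \<le> n" "\<forall>i\<le>Suc n. z i \<in> E" for m z
    using that
  proof (induction m arbitrary: z)
    case 0
    have "G 0 {0..Suc n} z = {\<omega> \<in> space M. \<forall>i\<le>Suc n. Z (\<tau> i) \<omega> = z i}"
      and "G 0 {0..n} z = {\<omega> \<in> space M. \<forall>i\<le>n. Z (\<tau> i) \<omega> = z i}" by (auto simp: G_def)
    then show ?case using markov[of \<tau> n z] \<tau>0 \<tau> 0 by simp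
  next
    case (Suc m)
    have hs: "((\<lambda>y. prob (G m {m..k} (z(m := y)))) has_sum prob (G (Suc m) {Suc m..k} z)) (E \<inter> S m)"
      if k: "m \<le> k" "k \<le> Suc n" for k
    proof -
      have "((\<lambda>y. prob {\<omega> \<in> G m {Suc m..k} z. Z (\<tau> m) \<omega> = y}) has_sum
          prob {\<omega> \<in> G m {Suc m..k} z. Z (\<tau> m) \<omega> \<in> S m}) (E \<inter> S m)"
        using Suc.prems k by (intro has_sum_prob E Z \<tau>n G) auto
      moreover have "{\<omega> \<in> G m {Suc m..k} z. Z (\<tau> m) \<omega> = y} = G m {m..k} (z(m := y))" for y
      proof -
        have "{m..k} = insert m {Suc m..k}" using k by auto
        then show ?thesis by (auto simp: G_def)
      qed
      moreover have "{\<omega> \<in> G m {Suc m..k} z. Z (\<tau> m) \<omega> \<in> S m} = G (Suc m) {Suc m..k} z"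
        by (auto simp: G_def less_Suc_eq)
      ultimately show ?thesis by simp
    qed
    have "((\<lambda>y. prob (G m {m..n} (z(m := y))) * P (\<tau> (Suc n) - \<tau> n) (z n) (z (Suc n))) has_sum
        prob (G (Suc m) {Suc m..Suc n} z)) (E \<inter> S m)"
    proof -
      have "prob (G m {m..Suc n} (z(m := y))) = prob (G m {m..n} (z(m := y))) * P (\<tau> (Suc n) - \<tau> n) (z n) (z (Suc n))"
        if "y \<in> E \<inter> S m" for y
      proof -
        have "\<forall>i\<le>Suc n. (z(m := y)) i \<in> E" using Suc.prems(2) that by simp
        from Suc.IH[OF _ this] Suc.prems(1) show ?thesis by (simp add: fun_upd_def)
      qed
      moreover have "((\<lambda>y. prob (G m {m..Suc n} (z(m := y)))) has_sum prob (G (Suc m) {Suc m..Suc n} z)) (E \<inter> S m)"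
        using hs[of "Suc n"] Suc.prems by simp
      ultimately show ?thesis by (rule has_sum_eqI[rotated])
    qed
    moreover have "((\<lambda>y. prob (G m {m..n} (z(m := y))) * P (\<tau> (Suc n) - \<tau> n) (z n) (z (Suc n))) has_sum
        prob (G (Suc m) {Suc m..n} z) * P (\<tau> (Suc n) - \<tau> n) (z n) (z (Suc n))) (E \<inter> S m)"
      using hs[of n] Suc.prems by (intro has_sum_cmult_left) auto
    ultimately show ?case by (rule has_sum_unique)
  qed
  \<comment> \<open>With m = n only the values at n and n + 1 are read; the earlier ones merely have
    to be states.\<close>
  let ?z = "\<lambda>i. if i = Suc n then z' else z"
  have "G n {n..Suc n} ?z = {\<omega> \<in> space M. (\<forall>i\<in>{..<n}. Z (\<tau> i) \<omega> \<in> S i) \<and> Z (\<tau> n) \<omega> = z \<and> Z (\<tau> (Suc n)) \<omega> = z'}"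
    by (auto simp: G_def atLeastAtMostSuc_conv)
  moreover have "G n {n..n} ?z = {\<omega> \<in> space M. (\<forall>i\<in>{..<n}. Z (\<tau> i) \<omega> \<in> S i) \<and> Z (\<tau> n) \<omega> = z}"
    by (auto simp: G_def)
  ultimately show ?thesis using claim[of n ?z] z by simp
qed

text \<open>The joint law and the product of the marginal laws live on countably many points, so
  equality on singletons identifies them, and independence is that identity of measures.\<close>

lemma (in prob_space) indep_vars_discreteI:
  fixes Y :: "'i \<Rightarrow> 'a \<Rightarrow> nat"
  assumes I: "finite I" and Y: "\<And>i. i \<in> I \<Longrightarrow> Y i \<in> measurable M (count_space UNIV)"
    and prod: "\<And>x. prob {\<omega> \<in> space M. \<forall>i\<in>I. Y i \<omega> = x i} = (\<Prod>i\<in>I. prob {\<omega> \<in> space M. Y i \<omega> = x i})"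
  shows "indep_vars (\<lambda>_. count_space UNIV) Y I"
proof (cases "I = {}")
  case True
  then show ?thesis by (simp add: indep_vars_def indep_sets_def)
next
  case False
  \<comment> \<open>Product measures here require a probability law at every index, so the family is
    extended by the constant 0 outside I.\<close>
  define Y' where "Y' i = (if i \<in> I then Y i else (\<lambda>_. 0))" for i
  have Y': "Y' i \<in> measurable M (count_space UNIV)" for i using Y by (auto simp: Y'_def)
  interpret product_sigma_finite "\<lambda>i. distr M (count_space UNIV) (Y' i)"
    by (intro product_sigma_finite.intro prob_space_imp_sigma_finite prob_space_distr Y')
  have cs: "(\<Pi>\<^sub>M i\<in>I. count_space (UNIV :: nat set)) = count_space (PiE I (\<lambda>_. UNIV))"
    using count_space_PiM_finite[OF I, of "\<lambda>_. UNIV :: nat set"] by simp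
  have Ym: "(\<lambda>\<omega>. \<lambda>i\<in>I. Y i \<omega>) \<in> measurable M (\<Pi>\<^sub>M i\<in>I. count_space UNIV)"
    by (rule measurable_restrict) (rule Y)
  have "distr M (\<Pi>\<^sub>M i\<in>I. count_space UNIV) (\<lambda>\<omega>. \<lambda>i\<in>I. Y i \<omega>) = (\<Pi>\<^sub>M i\<in>I. distr M (count_space UNIV) (Y' i))"
  proof (rule measure_eqI_countable')
    show "space (distr M (\<Pi>\<^sub>M i\<in>I. count_space UNIV) (\<lambda>\<omega>. \<lambda>i\<in>I. Y i \<omega>)) = PiE I (\<lambda>_. UNIV :: nat set)"
      by (simp add: cs)
    show "space (\<Pi>\<^sub>M i\<in>I. distr M (count_space UNIV) (Y' i)) = PiE I (\<lambda>_. UNIV :: nat set)"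
      by (simp add: space_PiM)
    show "countable (PiE I (\<lambda>_. UNIV :: nat set))" by (intro countable_PiE I) auto
    fix x assume x: "x \<in> PiE I (\<lambda>_. UNIV :: nat set)"
    show "{x} \<in> sets (distr M (\<Pi>\<^sub>M i\<in>I. count_space UNIV) (\<lambda>\<omega>. \<lambda>i\<in>I. Y i \<omega>))" using x by (simp add: cs)
    have x_eq: "{x} = PiE I (\<lambda>i. {x i})" using x PiE_singleton[of x I] by (simp add: PiE_iff)
    show "{x} \<in> sets (\<Pi>\<^sub>M i\<in>I. distr M (count_space UNIV) (Y' i))"
      unfolding x_eq by (rule sets_PiM_I_finite[OF I]) simp
    have "emeasure (distr M (\<Pi>\<^sub>M i\<in>I. count_space UNIV) (\<lambda>\<omega>. \<lambda>i\<in>I. Y i \<omega>)) {x}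
        = emeasure M ((\<lambda>\<omega>. \<lambda>i\<in>I. Y i \<omega>) -` {x} \<inter> space M)"
      using x by (intro emeasure_distr Ym) (simp add: cs)
    also have "(\<lambda>\<omega>. \<lambda>i\<in>I. Y i \<omega>) -` {x} \<inter> space M = {\<omega> \<in> space M. \<forall>i\<in>I. Y i \<omega> = x i}"
      using x by (auto simp: PiE_iff extensional_def fun_eq_iff restrict_def)
    also have "emeasure M \<dots> = (\<Prod>i\<in>I. ennreal (prob {\<omega> \<in> space M. Y i \<omega> = x i}))"
      by (simp add: emeasure_eq_measure prod prod_ennreal)
    also have "\<dots> = (\<Prod>i\<in>I. emeasure (distr M (count_space UNIV) (Y' i)) {x i})"
    proof (rule prod.cong[OF refl])
      fix i assume i: "i \<in> I"
      have "emeasure (distr M (count_space UNIV) (Y' i)) {x i} = emeasure M (Y' i -` {x i} \<inter> space M)"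
        by (rule emeasure_distr[OF Y']) simp
      also have "Y' i -` {x i} \<inter> space M = {\<omega> \<in> space M. Y i \<omega> = x i}" using i by (auto simp: Y'_def)
      finally show "ennreal (prob {\<omega> \<in> space M. Y i \<omega> = x i}) = emeasure (distr M (count_space UNIV) (Y' i)) {x i}"
        by (simp add: emeasure_eq_measure)
    qed
    also have "\<dots> = emeasure (\<Pi>\<^sub>M i\<in>I. distr M (count_space UNIV) (Y' i)) {x}"
      unfolding x_eq by (rule emeasure_PiM[symmetric, OF I]) simp
    finally show "emeasure (distr M (\<Pi>\<^sub>M i\<in>I. count_space UNIV) (\<lambda>\<omega>. \<lambda>i\<in>I. Y i \<omega>)) {x}
      = emeasure (\<Pi>\<^sub>M i\<in>I. distr M (count_space UNIV) (Y' i)) {x}" .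
  qed
  also have "\<dots> = (\<Pi>\<^sub>M i\<in>I. distr M (count_space UNIV) (Y i))"
    by (rule PiM_cong) (auto simp: Y'_def)
  finally show ?thesis
    using indep_vars_iff_distr_eq_PiM'[OF False Y] by simp
qed

section \<open>The departure process of a stationary queue\<close>

locale stationary_queue = queue_data X \<Sigma> \<nu> lam \<mu> \<rho> r + prob_space M
  for X :: "'x monoid" and \<Sigma> \<nu> lam \<mu> \<rho> r and M :: "'w measure" +
  fixes qc :: "real \<Rightarrow> 'w \<Rightarrow> 'x list" and D :: "'w \<Rightarrow> real set"
  assumes queue: "automatic_queue M X \<Sigma> \<nu> r lam \<mu> qc D"
    and stationary: "stationary_process M qc"
begin

abbreviation "NN \<equiv> npoints D 0"
abbreviation "c \<equiv> \<mu> * \<rho>"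

definition p :: "'x list \<Rightarrow> real" where
  "p u = prob {\<omega> \<in> space M. qc 0 \<omega> = u}"

lemma c_pos: "0 < c" using mu_pos rho_pos by simp

lemma departures_point_process: "point_process M D" using queue by (simp add: automatic_queue_def)

lemma qc_meas: "0 \<le> t \<Longrightarrow> qc t \<in> measurable M (count_space L)"
  using queue by (simp add: automatic_queue_def markov_jump_process_def)

lemma NN_meas: "0 \<le> t \<Longrightarrow> NN t \<in> measurable M (count_space UNIV)"
  using departures_point_process by (simp add: point_process_def)

lemma Z_meas: "0 \<le> t \<Longrightarrow> (\<lambda>\<omega>. (qc t \<omega>, NN t \<omega>)) \<in> measurable M (count_space (L \<times> UNIV))"
  using queue by (simp add: automatic_queue_def markov_jump_process_def)

lemma ev_qc:
  assumes "0 \<le> t"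
  shows "{\<omega> \<in> space M. Q (qc t \<omega>)} \<in> sets M"
proof -
  have "{\<omega> \<in> space M. Q (qc t \<omega>)} = qc t -` {y \<in> L. Q y} \<inter> space M"
    using measurable_space[OF qc_meas[OF assms]] by auto
  also have "\<dots> \<in> sets M" by (rule measurable_sets[OF qc_meas[OF assms]]) auto
  finally show ?thesis .
qed

lemma ev_NN:
  assumes "0 \<le> t"
  shows "{\<omega> \<in> space M. Q (NN t \<omega>)} \<in> sets M"
proof -
  have "{\<omega> \<in> space M. Q (NN t \<omega>)} = NN t -` {y \<in> UNIV. Q y} \<inter> space M"
    using measurable_space[OF NN_meas[OF assms]] by auto
  also have "\<dots> \<in> sets M" by (rule measurable_sets[OF NN_meas[OF assms]]) auto
  finally show ?thesis .
qed

lemma ev_NN_all: "finite J \<Longrightarrow> (\<And>i. i \<in> J \<Longrightarrow> 0 \<le> \<tau> i) \<Longrightarrow> {\<omega> \<in> space M. \<forall>i\<in>J. NN (\<tau> i) \<omega> = \<kappa> i} \<in> sets M"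
  by (intro sets.sets_Collect_finite_All ev_NN) auto

lemma prob_qc: "0 \<le> t \<Longrightarrow> prob {\<omega> \<in> space M. qc t \<omega> = u} = p u"
  using stationary[unfolded stationary_process_def, rule_format, of t 0 "\<lambda>_. 0" "\<lambda>_. u"] by (simp add: p_def)

lemma p_nonneg: "0 \<le> p u" by (simp add: p_def)

lemma p_has_sum: "(p has_sum 1) L"
proof -
  have "((\<lambda>u. prob {\<omega> \<in> space M. qc 0 \<omega> = u}) has_sum prob {\<omega> \<in> space M. qc 0 \<omega> \<in> UNIV}) (L \<inter> UNIV)"
    by (intro has_sum_prob countable_L qc_meas) auto
  then show ?thesis by (simp add: p_def[abs_def] prob_space)
qed

text \<open>The Markov property at the times 0 and t, with the same law at both by stationarity,
  says that p is preserved by the transition function.\<close>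

lemma p_eq:
  assumes "u \<in> L"
  shows "p u = p [] * pw u"
proof -
  obtain P where P: "transition_function L P" "has_generator L P Q1"
    and markov: "\<And>n (\<tau> :: nat \<Rightarrow> real) z. 0 \<le> \<tau> 0 \<and> (\<forall>i\<le>n. \<tau> i \<le> \<tau> (Suc i)) \<and> (\<forall>i\<le>Suc n. z i \<in> L) \<Longrightarrow>
           prob {\<omega> \<in> space M. \<forall>i\<le>Suc n. qc (\<tau> i) \<omega> = z i} =
           prob {\<omega> \<in> space M. \<forall>i\<le>n. qc (\<tau> i) \<omega> = z i} * P (\<tau> (Suc n) - \<tau> n) (z n) (z (Suc n))"
    using queue unfolding automatic_queue_def markov_jump_process_def by blast
  show ?thesis
  proof (rule stationary_law[OF P p_nonneg _ _ assms])
    show "p summable_on L" using p_has_sum by (rule has_sum_imp_summable)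
    fix t :: real and v assume t: "0 \<le> t" and v: "v \<in> L"
    have "((\<lambda>u. prob {\<omega> \<in> {\<omega> \<in> space M. qc t \<omega> = v}. qc 0 \<omega> = u}) has_sum
        prob {\<omega> \<in> space M. qc t \<omega> = v}) L"
      by (intro has_sum_prob_UNIV countable_L qc_meas ev_qc t) auto
    moreover have "prob {\<omega> \<in> {\<omega> \<in> space M. qc t \<omega> = v}. qc 0 \<omega> = u} = p u * P t u v" if u: "u \<in> L" for u
    proof -
      have "{\<omega> \<in> {\<omega> \<in> space M. qc t \<omega> = v}. qc 0 \<omega> = u}
        = {\<omega> \<in> space M. \<forall>i\<le>Suc 0. qc (if i = 0 then 0 else t) \<omega> = (if i = 0 then u else v)}"
        by (auto simp: le_Suc_eq)
      then show ?thesis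
        using markov[of "\<lambda>i. if i = 0 then 0 else t" 0 "\<lambda>i. if i = 0 then u else v"] t u v by (simp add: p_def)
    qed
    ultimately have "((\<lambda>u. p u * P t u v) has_sum prob {\<omega> \<in> space M. qc t \<omega> = v}) L"
      by (rule has_sum_eqI)
    then show "((\<lambda>u. p u * P t u v) has_sum p v) L"
      using prob_qc[OF t, of v] by simp
  qed
qed

lemma mono_nonneg:
  fixes \<tau> :: "nat \<Rightarrow> real"
  assumes "0 \<le> \<tau> 0" "\<forall>i<n. \<tau> i \<le> \<tau> (Suc i)" "i \<le> n"
  shows "0 \<le> \<tau> i"
  using assms(3)
proof (induction i)
  case (Suc i)
  then have "\<tau> i \<le> \<tau> (Suc i)" "0 \<le> \<tau> i" using assms(2) by auto
  then show ?case by linarith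
qed (use assms(1) in simp)

text \<open>The product form of the joint law propagates: by induction the content at the last time
  has law p and is independent of the counter history, which is the situation from which
  \<open>counted_evolution\<close> computes the next step. At time 0 the counter is 0.\<close>

lemma joint_law:
  fixes \<tau> :: "nat \<Rightarrow> real"
  assumes "\<tau> 0 = 0" "\<forall>i<n. \<tau> i \<le> \<tau> (Suc i)" "v \<in> L"
  shows "prob {\<omega> \<in> space M. (\<forall>i\<in>{..n}. NN (\<tau> i) \<omega> = \<kappa> i) \<and> qc (\<tau> n) \<omega> = v}
    = p v * (of_bool (\<kappa> 0 = 0) * (\<Prod>i<n. pois_step (c * (\<tau> (Suc i) - \<tau> i)) (\<kappa> i) (\<kappa> (Suc i))))"
  using assms(2,3)
proof (induction n arbitrary: v)
  case 0
  have "NN 0 \<omega> = 0" for \<omega> by (simp add: npoints_def)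
  then have "{\<omega> \<in> space M. (\<forall>i\<in>{..0}. NN (\<tau> i) \<omega> = \<kappa> i) \<and> qc (\<tau> 0) \<omega> = v}
    = (if \<kappa> 0 = 0 then {\<omega> \<in> space M. qc 0 \<omega> = v} else {})" using assms(1) by auto
  then show ?case by (simp add: p_def)
next
  case (Suc n)
  obtain P where P: "transition_function (L \<times> UNIV) P" "has_generator (L \<times> UNIV) P Q2"
    and markov: "\<And>n (\<tau> :: nat \<Rightarrow> real) z. 0 \<le> \<tau> 0 \<and> (\<forall>i\<le>n. \<tau> i \<le> \<tau> (Suc i)) \<and> (\<forall>i\<le>Suc n. z i \<in> L \<times> UNIV) \<Longrightarrow>
           prob {\<omega> \<in> space M. \<forall>i\<le>Suc n. (qc (\<tau> i) \<omega>, NN (\<tau> i) \<omega>) = z i} =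
           prob {\<omega> \<in> space M. \<forall>i\<le>n. (qc (\<tau> i) \<omega>, NN (\<tau> i) \<omega>) = z i} * P (\<tau> (Suc n) - \<tau> n) (z n) (z (Suc n))"
    using queue unfolding automatic_queue_def markov_jump_process_def by blast
  let ?W = "of_bool (\<kappa> 0 = 0) * (\<Prod>i<n. pois_step (c * (\<tau> (Suc i) - \<tau> i)) (\<kappa> i) (\<kappa> (Suc i)))"
  let ?d = "\<tau> (Suc n) - \<tau> n"
  have pos: "0 \<le> \<tau> i" if "i \<le> Suc n" for i using mono_nonneg[of \<tau> "Suc n" i] assms(1) Suc.prems(1) that by simp
  let ?A = "{\<omega> \<in> space M. (\<forall>i\<in>{..Suc n}. NN (\<tau> i) \<omega> = \<kappa> i) \<and> qc (\<tau> (Suc n)) \<omega> = v}"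
  have A: "?A \<in> sets M" by (intro sets.sets_Collect_conj ev_NN_all ev_qc) (auto intro: pos)
  have "((\<lambda>u. prob {\<omega> \<in> ?A. qc (\<tau> n) \<omega> = u}) has_sum prob ?A) L"
    by (intro has_sum_prob_UNIV countable_L qc_meas A pos) simp
  moreover have atM: "{..n} = insert n {..<n}" by auto
  have "prob {\<omega> \<in> ?A. qc (\<tau> n) \<omega> = u} = ?W * (p u * P ?d (u, \<kappa> n) (v, \<kappa> (Suc n)))" if u: "u \<in> L" for u
  proof -
    have eq1: "{\<omega> \<in> ?A. qc (\<tau> n) \<omega> = u} = {\<omega> \<in> space M.
        (\<forall>i\<in>{..<n}. (qc (\<tau> i) \<omega>, NN (\<tau> i) \<omega>) \<in> UNIV \<times> {\<kappa> i}) \<and> (qc (\<tau> n) \<omega>, NN (\<tau> n) \<omega>) = (u, \<kappa> n)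
        \<and> (qc (\<tau> (Suc n)) \<omega>, NN (\<tau> (Suc n)) \<omega>) = (v, \<kappa> (Suc n))}"
      by (auto simp: atMost_Suc atM)
    have hist: "prob {\<omega> \<in> space M.
        (\<forall>i\<in>{..<n}. (qc (\<tau> i) \<omega>, NN (\<tau> i) \<omega>) \<in> UNIV \<times> {\<kappa> i}) \<and> (qc (\<tau> n) \<omega>, NN (\<tau> n) \<omega>) = (u, \<kappa> n)
        \<and> (qc (\<tau> (Suc n)) \<omega>, NN (\<tau> (Suc n)) \<omega>) = (v, \<kappa> (Suc n))} = prob {\<omega> \<in> space M.
        (\<forall>i\<in>{..<n}. (qc (\<tau> i) \<omega>, NN (\<tau> i) \<omega>) \<in> UNIV \<times> {\<kappa> i}) \<and> (qc (\<tau> n) \<omega>, NN (\<tau> n) \<omega>) = (u, \<kappa> n)}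
        * P ?d (u, \<kappa> n) (v, \<kappa> (Suc n))"
    proof (rule markov_history[where E = "L \<times> UNIV" and Z = "\<lambda>t \<omega>. (qc t \<omega>, NN t \<omega>)" and P = P
          and \<tau> = \<tau> and n = n and z = "(u, \<kappa> n)" and z' = "(v, \<kappa> (Suc n))" and S = "\<lambda>i. UNIV \<times> {\<kappa> i}",
          OF _ Z_meas markov])
      show "\<forall>i\<le>n. \<tau> i \<le> \<tau> (Suc i)" using Suc.prems(1) by (simp add: less_Suc_eq_le)
      show "countable (L \<times> (UNIV :: nat set))" using countable_L by simp
      show "0 \<le> \<tau> 0" using assms(1) by simp
      show "(u, \<kappa> n) \<in> L \<times> UNIV" "(v, \<kappa> (Suc n)) \<in> L \<times> UNIV" using Suc.prems(2) u by simp_all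
    qed assumption+
    have eq2: "{\<omega> \<in> space M.
        (\<forall>i\<in>{..<n}. (qc (\<tau> i) \<omega>, NN (\<tau> i) \<omega>) \<in> UNIV \<times> {\<kappa> i}) \<and> (qc (\<tau> n) \<omega>, NN (\<tau> n) \<omega>) = (u, \<kappa> n)}
        = {\<omega> \<in> space M. (\<forall>i\<in>{..n}. NN (\<tau> i) \<omega> = \<kappa> i) \<and> qc (\<tau> n) \<omega> = u}"
      by (auto simp: atM)
    have "prob {\<omega> \<in> space M. (\<forall>i\<in>{..n}. NN (\<tau> i) \<omega> = \<kappa> i) \<and> qc (\<tau> n) \<omega> = u} = p u * ?W"
      using Suc.IH[of u] Suc.prems u by simp
    then show ?thesis unfolding eq1 hist eq2 by (simp only: mult_ac)
  qed
  ultimately have "((\<lambda>u. ?W * (p u * P ?d (u, \<kappa> n) (v, \<kappa> (Suc n)))) has_sum prob ?A) L"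
    by (rule has_sum_eqI)
  moreover have "((\<lambda>u. ?W * (p u * P ?d (u, \<kappa> n) (v, \<kappa> (Suc n)))) has_sum ?W * (p v * pois_step (c * ?d) (\<kappa> n) (\<kappa> (Suc n)))) L"
    using Suc.prems
    by (intro has_sum_cmult_right counted_evolution[OF P p_nonneg _ p_eq]) (auto intro: has_sum_imp_summable[OF p_has_sum])
  ultimately have "prob ?A = ?W * (p v * pois_step (c * ?d) (\<kappa> n) (\<kappa> (Suc n)))" by (rule has_sum_unique)
  then show ?case by (simp add: mult_ac)
qed

lemma counter_law:
  fixes \<tau> :: "nat \<Rightarrow> real"
  assumes "\<tau> 0 = 0" "\<forall>i<n. \<tau> i \<le> \<tau> (Suc i)"
  shows "prob {\<omega> \<in> space M. \<forall>i\<in>{..n}. NN (\<tau> i) \<omega> = \<kappa> i}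
    = of_bool (\<kappa> 0 = 0) * (\<Prod>i<n. pois_step (c * (\<tau> (Suc i) - \<tau> i)) (\<kappa> i) (\<kappa> (Suc i)))" (is "prob ?A = ?W")
proof -
  have pos: "0 \<le> \<tau> i" if "i \<le> n" for i using mono_nonneg[of \<tau> n i] assms that by simp
  have "((\<lambda>u. prob {\<omega> \<in> ?A. qc (\<tau> n) \<omega> = u}) has_sum prob ?A) L"
    by (intro has_sum_prob_UNIV countable_L qc_meas ev_NN_all pos) auto
  moreover have "prob {\<omega> \<in> ?A. qc (\<tau> n) \<omega> = u} = p u * ?W" if "u \<in> L" for u
    using joint_law[OF assms that, of \<kappa>] by (simp add: conj_assoc)
  ultimately have "((\<lambda>u. p u * ?W) has_sum prob ?A) L" by (rule has_sum_eqI)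
  moreover have "((\<lambda>u. p u * ?W) has_sum 1 * ?W) L" by (intro has_sum_cmult_left p_has_sum)
  ultimately show ?thesis using has_sum_unique by fastforce
qed

lemma NN_split:
  assumes \<omega>: "\<omega> \<in> space M" and st: "0 \<le> s" "s \<le> t"
  shows "NN t \<omega> = NN s \<omega> + npoints D s t \<omega>"
proof -
  have "finite (D \<omega> \<inter> {..t})" using departures_point_process \<omega> by (simp add: point_process_def)
  then have "finite (D \<omega> \<inter> {0<..s})" "finite (D \<omega> \<inter> {s<..t})"
    using st by (auto elim!: finite_subset[rotated])
  moreover have "D \<omega> \<inter> {0<..t} = (D \<omega> \<inter> {0<..s}) \<union> (D \<omega> \<inter> {s<..t})" using st by auto
  ultimately show ?thesis
    unfolding npoints_def by (subst card_Un_disjoint[symmetric]) auto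
qed

text \<open>\<open>counter_law\<close> speaks of counter values from time 0 on. Prescribing the
  increments and the number k of points up to the first time prescribes all these values; summing
  over k removes the extra Poisson factor.\<close>

lemma increments_law:
  fixes \<tau> :: "nat \<Rightarrow> real"
  assumes \<tau>: "0 \<le> \<tau> 0" "\<forall>i<n. \<tau> i \<le> \<tau> (Suc i)"
  shows "prob {\<omega> \<in> space M. \<forall>i\<in>{..<n}. npoints D (\<tau> i) (\<tau> (Suc i)) \<omega> = x i}
    = (\<Prod>i<n. pois (c * (\<tau> (Suc i) - \<tau> i)) (x i))" (is "prob ?A = ?W")
proof -
  have pos: "0 \<le> \<tau> i" if "i \<le> n" for i using mono_nonneg[of \<tau> n i] \<tau> that by simp
  \<comment> \<open>The times with 0 put in front, and the matching counter values: 0 at time 0,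
    then k plus the partial sums of the increments.\<close>
  define \<sigma> where "\<sigma> = case_nat 0 \<tau>"
  define \<kappa> where "\<kappa> k = case_nat 0 (\<lambda>i. k + (\<Sum>j<i. x j))" for k
  have \<sigma>: "\<sigma> 0 = 0" "\<forall>i<Suc n. \<sigma> i \<le> \<sigma> (Suc i)"
    using \<tau> by (auto simp: \<sigma>_def split: nat.split)
  have A: "?A \<in> sets M"
  proof (intro sets.sets_Collect_finite_All)
    fix i assume "i \<in> {..<n}"
    then have "npoints D (\<tau> i) (\<tau> (Suc i)) \<in> measurable M (count_space UNIV)"
      using departures_point_process pos[of i] \<tau> by (simp add: point_process_def)
    then show "{\<omega> \<in> space M. npoints D (\<tau> i) (\<tau> (Suc i)) \<omega> = x i} \<in> sets M" by simp
  qed simp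
  have "((\<lambda>k. prob {\<omega> \<in> ?A. NN (\<tau> 0) \<omega> = k}) has_sum prob ?A) UNIV"
    by (intro has_sum_prob_UNIV NN_meas A \<tau>) auto
  moreover have "prob {\<omega> \<in> ?A. NN (\<tau> 0) \<omega> = k} = pois (c * \<tau> 0) k * ?W" for k
  proof -
    have iff: "(\<forall>i\<in>{..<m}. npoints D (\<tau> i) (\<tau> (Suc i)) \<omega> = x i) \<and> NN (\<tau> 0) \<omega> = k
        \<longleftrightarrow> (\<forall>i\<in>{..m}. NN (\<tau> i) \<omega> = k + (\<Sum>j<i. x j))" if "\<omega> \<in> space M" "m \<le> n" for \<omega> m
      using that(2)
    proof (induction m)
      case (Suc m)
      let ?R = "\<forall>i\<in>{..m}. NN (\<tau> i) \<omega> = k + (\<Sum>j<i. x j)"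
      have split: "NN (\<tau> (Suc m)) \<omega> = NN (\<tau> m) \<omega> + npoints D (\<tau> m) (\<tau> (Suc m)) \<omega>"
        using NN_split[OF that(1), of "\<tau> m" "\<tau> (Suc m)"] pos[of m] \<tau> Suc.prems by simp
      have "(\<forall>i\<in>{..<Suc m}. npoints D (\<tau> i) (\<tau> (Suc i)) \<omega> = x i) \<and> NN (\<tau> 0) \<omega> = k
        \<longleftrightarrow> npoints D (\<tau> m) (\<tau> (Suc m)) \<omega> = x m \<and>
          (\<forall>i\<in>{..<m}. npoints D (\<tau> i) (\<tau> (Suc i)) \<omega> = x i) \<and> NN (\<tau> 0) \<omega> = k"
        unfolding lessThan_Suc by blast
      also have "\<dots> \<longleftrightarrow> npoints D (\<tau> m) (\<tau> (Suc m)) \<omega> = x m \<and> ?R"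
        using Suc by simp
      also have "\<dots> \<longleftrightarrow> NN (\<tau> (Suc m)) \<omega> = k + (\<Sum>j<Suc m. x j) \<and> ?R"
      proof -
        have "NN (\<tau> m) \<omega> = k + (\<Sum>j<m. x j)" if ?R using bspec[OF that, of m] by simp
        moreover have "i = y \<and> Q \<longleftrightarrow> N + i = k + (S + y) \<and> Q" if "Q \<Longrightarrow> N = k + S" for i y N S :: nat and Q
          using that by (cases Q) auto
        ultimately show ?thesis unfolding split sum.lessThan_Suc by blast
      qed
      also have "\<dots> \<longleftrightarrow> (\<forall>i\<in>{..Suc m}. NN (\<tau> i) \<omega> = k + (\<Sum>j<i. x j))"
        unfolding atMost_Suc by blast
      finally show ?case .
    qed auto
    have NN0: "NN 0 \<omega> = 0" for \<omega> by (simp add: npoints_def)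
    have "{\<omega> \<in> ?A. NN (\<tau> 0) \<omega> = k} = {\<omega> \<in> space M. \<forall>i\<in>{..Suc n}. NN (\<sigma> i) \<omega> = \<kappa> k i}"
    proof -
      have "(\<forall>i\<in>{..Suc n}. NN (\<sigma> i) \<omega> = \<kappa> k i) \<longleftrightarrow> (\<forall>i\<in>{..n}. NN (\<tau> i) \<omega> = k + (\<Sum>j<i. x j))" for \<omega>
        by (simp add: atMost_Suc_eq_insert_0 \<sigma>_def \<kappa>_def NN0)
      then have "\<omega> \<in> {\<omega> \<in> ?A. NN (\<tau> 0) \<omega> = k} \<longleftrightarrow> \<omega> \<in> {\<omega> \<in> space M. \<forall>i\<in>{..Suc n}. NN (\<sigma> i) \<omega> = \<kappa> k i}" for \<omega>
        unfolding mem_Collect_eq using iff[of \<omega> n] by blast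
      then show ?thesis by blast
    qed
    also have "prob \<dots> = of_bool (\<kappa> k 0 = 0) * (\<Prod>i<Suc n. pois_step (c * (\<sigma> (Suc i) - \<sigma> i)) (\<kappa> k i) (\<kappa> k (Suc i)))"
      by (rule counter_law[OF \<sigma>])
    also have "\<dots> = pois (c * \<tau> 0) k * ?W"
      by (simp add: prod.lessThan_Suc_shift \<kappa>_def \<sigma>_def pois_step_def del: prod.lessThan_Suc)
    finally show ?thesis .
  qed
  ultimately have "((\<lambda>k. pois (c * \<tau> 0) k * ?W) has_sum prob ?A) UNIV" by (rule has_sum_eqI)
  moreover have "((\<lambda>k. pois (c * \<tau> 0) k * ?W) has_sum 1 * ?W) UNIV"
    using \<tau> c_pos by (intro has_sum_cmult_left pois_has_sum) simp
  ultimately show ?thesis using has_sum_unique by fastforce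
qed

lemma increment_law:
  assumes "0 \<le> s" "s \<le> t"
  shows "prob {\<omega> \<in> space M. npoints D s t \<omega> = j} = pois (c * (t - s)) j"
  using increments_law[of "\<lambda>i. if i = 0 then s else t" 1 "\<lambda>_. j"] assms by (simp add: lessThan_Suc)

theorem departures_poisson: "poisson_process M D (\<rho> * \<mu>)"
  unfolding poisson_process_def
proof (intro conjI allI impI)
  show "point_process M D" by (rule departures_point_process)
next
  fix s t :: real assume st: "0 \<le> s \<and> s < t"
  then have pos: "0 < \<rho> * \<mu> * (t - s)" using mu_pos rho_pos by simp
  have m: "npoints D s t \<in> measurable M (count_space UNIV)" using departures_point_process st by (simp add: point_process_def)
  show "distr M (count_space UNIV) (npoints D s t) = measure_pmf (poisson_pmf (\<rho> * \<mu> * (t - s)))"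
  proof (rule measure_eqI_countable[where A = UNIV])
    fix j :: nat
    have "emeasure (distr M (count_space UNIV) (npoints D s t)) {j} = emeasure M (npoints D s t -` {j} \<inter> space M)"
      by (rule emeasure_distr[OF m]) simp
    also have "npoints D s t -` {j} \<inter> space M = {\<omega> \<in> space M. npoints D s t \<omega> = j}" by auto
    finally show "emeasure (distr M (count_space UNIV) (npoints D s t)) {j}
        = emeasure (measure_pmf (poisson_pmf (\<rho> * \<mu> * (t - s)))) {j}"
      using increment_law[of s t j] st pos
      by (simp add: emeasure_eq_measure emeasure_pmf_single pois_def mult.commute)
  qed auto
next
  fix n and \<tau> :: "nat \<Rightarrow> real" assume \<tau>: "0 \<le> \<tau> 0 \<and> (\<forall>i<n. \<tau> i \<le> \<tau> (Suc i))"
  then have pos: "0 \<le> \<tau> i" if "i \<le> n" for i using mono_nonneg[of \<tau> n i] that by simp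
  show "indep_vars (\<lambda>_. count_space UNIV) (\<lambda>i. npoints D (\<tau> i) (\<tau> (Suc i))) {..<n}"
  proof (rule indep_vars_discreteI)
    show "npoints D (\<tau> i) (\<tau> (Suc i)) \<in> measurable M (count_space UNIV)" if "i \<in> {..<n}" for i
      using departures_point_process pos[of i] \<tau> that by (simp add: point_process_def)
    show "prob {\<omega> \<in> space M. \<forall>i\<in>{..<n}. npoints D (\<tau> i) (\<tau> (Suc i)) \<omega> = x i}
        = (\<Prod>i<n. prob {\<omega> \<in> space M. npoints D (\<tau> i) (\<tau> (Suc i)) \<omega> = x i})" for x
      using increments_law[of \<tau> n x] \<tau> pos by (simp add: increment_law)
  qed simp
qed

section \<open>Independence of the content from the past departures\<close>

text \<open>The set F contains 0 and t, so its increasing enumeration starts at 0 and ends at t, as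
  \<open>joint_law\<close> requires; dividing the counter law out of the joint law leaves the factor
  p u.\<close>

lemma content_indep_history:
  assumes t: "0 \<le> t" and F: "finite F" "0 \<in> F" "t \<in> F" "F \<subseteq> {0..t}" and u: "u \<in> L"
  shows "prob {\<omega> \<in> space M. (\<forall>s\<in>F. NN s \<omega> = \<kappa> s) \<and> qc t \<omega> = u}
    = p u * prob {\<omega> \<in> space M. \<forall>s\<in>F. NN s \<omega> = \<kappa> s}"
proof -
  define xs where "xs = sorted_list_of_set F"
  have xs: "set xs = F" "sorted xs" "length xs = card F" using F(1) by (auto simp: xs_def)
  define n where "n = card F - 1"
  have n: "Suc n = card F" using F card_gt_0_iff[of F] by (auto simp: n_def)
  have mem: "xs ! i \<in> F" if "i \<le> n" for i using that n xs nth_mem[of i xs] by auto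
  have idx: "\<exists>i\<le>n. s = xs ! i" if "s \<in> F" for s
    using that xs n by (metis in_set_conv_nth less_Suc_eq_le)
  have le: "xs ! i \<le> xs ! j" if "i \<le> j" "j \<le> n" for i j
    using that xs n by (intro sorted_nth_mono) auto
  have x0: "xs ! 0 = 0"
    using idx[OF F(2)] le[of 0] mem[of 0] F(4) by force
  have xn: "xs ! n = t"
    using idx[OF F(3)] le[of _ n] mem[of n] F(4) by force
  have ball: "(\<forall>s\<in>F. Q s) \<longleftrightarrow> (\<forall>i\<in>{..n}. Q (xs ! i))" for Q
    using mem idx by (metis atMost_iff)
  have mono: "\<forall>i<n. xs ! i \<le> xs ! Suc i" using le by simp
  show ?thesis
    unfolding ball
    using joint_law[where \<tau> = "(!) xs" and n = n and \<kappa> = "\<lambda>i. \<kappa> (xs ! i)", OF x0 mono u]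
      counter_law[where \<tau> = "(!) xs" and n = n and \<kappa> = "\<lambda>i. \<kappa> (xs ! i)", OF x0 mono] xn by simp
qed

theorem content_indep_departures:
  assumes t: "0 \<le> t"
  shows "indep_set (sigma_sets (space M) {qc t -` B \<inter> space M | B. True}) (points_upto M D t)"
proof -
  let ?A = "{qc t -` B \<inter> space M | B. True}"
  \<comment> \<open>Events that depend on the counter at finitely many times. Reading the counter as
    a function on F makes them stable under intersection: the union of two time sets carries both
    conditions.\<close>
  define H where "H F Q = {\<omega> \<in> space M. Q (\<lambda>s\<in>F. NN s \<omega>)}" for F :: "real set" and Q :: "(real \<Rightarrow> nat) \<Rightarrow> bool"
  define \<F> where "\<F> = {F. finite F \<and> 0 \<in> F \<and> t \<in> F \<and> F \<subseteq> {0..t}}"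
  let ?H = "{H F Q | F Q. F \<in> \<F>}"
  have Ym: "(\<lambda>\<omega>. \<lambda>s\<in>F. NN s \<omega>) \<in> measurable M (count_space (PiE F (\<lambda>_. UNIV)))" if "F \<in> \<F>" for F
  proof -
    have "(\<lambda>\<omega>. \<lambda>s\<in>F. NN s \<omega>) \<in> measurable M (\<Pi>\<^sub>M s\<in>F. count_space UNIV)"
      using that by (intro measurable_restrict NN_meas) (auto simp: \<F>_def)
    then show ?thesis
      using that count_space_PiM_finite[of F "\<lambda>_. UNIV :: nat set"] by (simp add: \<F>_def)
  qed
  have H: "H F Q \<in> sets M" if "F \<in> \<F>" for F Q
  proof -
    have "H F Q = (\<lambda>\<omega>. \<lambda>s\<in>F. NN s \<omega>) -` {y \<in> PiE F (\<lambda>_. UNIV). Q y} \<inter> space M" by (auto simp: H_def)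
    also have "\<dots> \<in> sets M" by (rule measurable_sets[OF Ym[OF that]]) auto
    finally show ?thesis .
  qed
  have A: "qc t -` B \<inter> space M \<in> sets M" for B
    using ev_qc[OF t, of "\<lambda>u. u \<in> B"] by (simp add: vimage_def Int_def conj_commute)
  \<comment> \<open>The counter has countably many histories on the finite set F, so an event of
    this kind is a countable union of exact histories, each covered by
    \<open>content_indep_history\<close>.\<close>
  have point: "prob {\<omega> \<in> {\<omega> \<in> space M. qc t \<omega> = u}. Q (\<lambda>s\<in>F. NN s \<omega>)} = p u * prob (H F Q)"
    if F: "F \<in> \<F>" and u: "u \<in> L" for F Q u
  proof -
    let ?Y = "\<lambda>\<omega>. \<lambda>s\<in>F. NN s \<omega>"
    let ?P = "PiE F (\<lambda>_. UNIV :: nat set)"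
    have cP: "countable ?P" using F by (intro countable_PiE) (auto simp: \<F>_def)
    have eq: "?Y \<omega> = y \<longleftrightarrow> (\<forall>s\<in>F. NN s \<omega> = y s)" if "y \<in> ?P" for y \<omega>
      using that by (auto simp: PiE_iff extensional_def fun_eq_iff restrict_def)
    have "((\<lambda>y. prob {\<omega> \<in> {\<omega> \<in> space M. qc t \<omega> = u}. ?Y \<omega> = y}) has_sum
        prob {\<omega> \<in> {\<omega> \<in> space M. qc t \<omega> = u}. ?Y \<omega> \<in> {y. Q y}}) (?P \<inter> {y. Q y})"
      by (intro has_sum_prob cP Ym F ev_qc t)
    moreover have "prob {\<omega> \<in> {\<omega> \<in> space M. qc t \<omega> = u}. ?Y \<omega> = y} = p u * prob {\<omega> \<in> space M. ?Y \<omega> = y}"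
      if "y \<in> ?P \<inter> {y. Q y}" for y
      using content_indep_history[of t F u y] F u t that eq[of y] by (simp add: \<F>_def conj_commute conj_left_commute)
    ultimately have "((\<lambda>y. p u * prob {\<omega> \<in> space M. ?Y \<omega> = y}) has_sum
        prob {\<omega> \<in> {\<omega> \<in> space M. qc t \<omega> = u}. ?Y \<omega> \<in> {y. Q y}}) (?P \<inter> {y. Q y})"
      by (rule has_sum_eqI)
    moreover have "((\<lambda>y. prob {\<omega> \<in> space M. ?Y \<omega> = y}) has_sum
        prob {\<omega> \<in> space M. ?Y \<omega> \<in> {y. Q y}}) (?P \<inter> {y. Q y})"
      by (intro has_sum_prob cP Ym F) simp
    then have "((\<lambda>y. p u * prob {\<omega> \<in> space M. ?Y \<omega> = y}) has_sum
        p u * prob {\<omega> \<in> space M. ?Y \<omega> \<in> {y. Q y}}) (?P \<inter> {y. Q y})"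
      by (rule has_sum_cmult_right)
    ultimately show ?thesis using has_sum_unique by (fastforce simp: H_def)
  qed
  have indep: "prob ((qc t -` B \<inter> space M) \<inter> H F Q) = prob (qc t -` B \<inter> space M) * prob (H F Q)"
    if F: "F \<in> \<F>" for B F Q
  proof -
    have "((\<lambda>u. prob {\<omega> \<in> H F Q. qc t \<omega> = u}) has_sum prob {\<omega> \<in> H F Q. qc t \<omega> \<in> B}) (L \<inter> B)"
      by (intro has_sum_prob countable_L qc_meas t H F)
    moreover have "prob {\<omega> \<in> H F Q. qc t \<omega> = u} = p u * prob (H F Q)" if "u \<in> L \<inter> B" for u
      using point[OF F, of u Q] that by (simp add: H_def conj_commute conj_left_commute)
    ultimately have "((\<lambda>u. p u * prob (H F Q)) has_sum prob {\<omega> \<in> H F Q. qc t \<omega> \<in> B}) (L \<inter> B)"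
      by (rule has_sum_eqI)
    moreover have "((\<lambda>u. prob {\<omega> \<in> space M. qc t \<omega> = u}) has_sum prob {\<omega> \<in> space M. qc t \<omega> \<in> B}) (L \<inter> B)"
      by (intro has_sum_prob countable_L qc_meas t) simp
    then have "((\<lambda>u. p u * prob (H F Q)) has_sum prob {\<omega> \<in> space M. qc t \<omega> \<in> B} * prob (H F Q)) (L \<inter> B)"
      by (intro has_sum_cmult_left) (simp add: prob_qc[OF t])
    ultimately have "prob {\<omega> \<in> H F Q. qc t \<omega> \<in> B} = prob {\<omega> \<in> space M. qc t \<omega> \<in> B} * prob (H F Q)"
      by (rule has_sum_unique)
    moreover have "(qc t -` B \<inter> space M) \<inter> H F Q = {\<omega> \<in> H F Q. qc t \<omega> \<in> B}"
      "qc t -` B \<inter> space M = {\<omega> \<in> space M. qc t \<omega> \<in> B}" by (auto simp: H_def)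
    ultimately show ?thesis by simp
  qed
  have "indep_set ?A ?H"
    unfolding indep_sets2_eq using A H indep by auto
  moreover have "Int_stable ?A"
  proof (rule Int_stableI)
    fix a b assume "a \<in> ?A" "b \<in> ?A"
    then obtain B B' where "a = qc t -` B \<inter> space M" "b = qc t -` B' \<inter> space M" by auto
    then have "a \<inter> b = qc t -` (B \<inter> B') \<inter> space M" by auto
    then show "a \<inter> b \<in> ?A" by blast
  qed
  moreover have "Int_stable ?H"
  proof (rule Int_stableI)
    fix a b assume "a \<in> ?H" "b \<in> ?H"
    then obtain F Q F' Q' where ab: "a = H F Q" "b = H F' Q'" "F \<in> \<F>" "F' \<in> \<F>" by auto
    have "a \<inter> b = H (F \<union> F') (\<lambda>y. Q (restrict y F) \<and> Q' (restrict y F'))"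
      unfolding ab H_def by (auto simp: restrict_restrict Int_absorb1 Int_absorb2)
    moreover have "F \<union> F' \<in> \<F>" using ab by (auto simp: \<F>_def)
    ultimately show "a \<inter> b \<in> ?H" by blast
  qed
  ultimately have "indep_set (sigma_sets (space M) ?A) (sigma_sets (space M) ?H)"
    by (rule indep_set_sigma_sets)
  \<comment> \<open>A generator of the past involves a single time s; it becomes an event H for the
    time set {0, s, t}, since 0 and t may be added freely.\<close>
  moreover have "points_upto M D t \<subseteq> sigma_sets (space M) ?H"
    unfolding points_upto_def
  proof (rule sigma_sets_mono')
    show "{NN s -` B \<inter> space M | s B. 0 \<le> s \<and> s \<le> t} \<subseteq> ?H"
    proof
      fix a assume "a \<in> {NN s -` B \<inter> space M | s B. 0 \<le> s \<and> s \<le> t}"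
      then obtain s B where s: "0 \<le> s" "s \<le> t" and a: "a = NN s -` B \<inter> space M" by auto
      have "a = H {0, s, t} (\<lambda>y. y s \<in> B)" by (auto simp: a H_def)
      moreover have "{0, s, t} \<in> \<F>" using s t by (auto simp: \<F>_def)
      ultimately show "a \<in> ?H" by blast
    qed
  qed
  ultimately show ?thesis
    unfolding indep_sets2_eq by blast
qed

end

theorem mainTheorem10:
  fixes X :: "('s, 't, 'm) plain monoid"
    and \<Sigma> :: "('s, 't, 'm) plain set"
    and \<nu> :: "('s, 't, 'm) plain pmf"
    and lam \<mu> \<gamma> \<rho> :: real
    and r :: "('s, 't, 'm) plain \<Rightarrow> real"
    and M :: "'w measure"
    and qc :: "real \<Rightarrow> 'w \<Rightarrow> ('s, 't, 'm) plain list"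
    and D :: "'w \<Rightarrow> real set"
  assumes "plain_triple X \<Sigma> \<nu>"
    and "lam > 0" and "\<mu> > 0"
    and "has_drift X \<Sigma> \<nu> \<gamma>"
    and "lam * \<gamma> < \<mu>"
    and "admissible_solution X \<Sigma> \<nu> lam \<mu> \<rho> r"
    and "prob_space M"
    and "automatic_queue M X \<Sigma> \<nu> r lam \<mu> qc D"
    and "stationary_process M qc"
  shows "poisson_process M D (\<rho> * \<mu>)
    \<and> (\<forall>t\<ge>0. prob_space.indep_set M
          (sigma_sets (space M) {qc t -` B \<inter> space M | B. True}) (points_upto M D t))"
proof -
  obtain S T Xs where S: "finite S" "finite T" "\<forall>F\<in>set Xs. Group.monoid F \<and> finite (carrier F)"
    and X: "X = plain_monoid S T Xs" "\<Sigma> = plain_gens S T Xs"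
    and \<nu>: "set_pmf \<nu> \<subseteq> \<Sigma>"
    using assms(1) unfolding plain_triple_def by blast
  interpret zero_automatic X \<Sigma> unfolding X by (rule zero_automatic_plain[OF S])
  interpret prob_space M by fact
  interpret stationary_queue X \<Sigma> \<nu> lam \<mu> \<rho> r M qc D
    by unfold_locales (use \<nu> assms in auto)
  show ?thesis using departures_poisson content_indep_departures by blast
qed

end
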